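(* Let $\lambda,\xi>0$, let $g$ be a Bernstein function as described in the context, and let $B=\{B(t),t\ge 0\}$ be the linear birth (Yule) process of rate $\lambda$ with one progenitor, $B(0)=1$. Let $X_j^{(g)}$, $j=1,2,\dots$, be i.i.d. positive random variables, independent of $B$, with density $f_{X^{(g)}}$. Then the solution to the equation $$\frac{\partial}{\partial t} f(y,t) = -\lambda\,\frac{e^{\lambda t}}{\xi}\,\mathcal{D}_y^{g}\,[f\ast f](y,t),\qquad y,t>0,$$ under the initial condition $f(y,0)=f_{X^{(g)}}(y)$, is given by the density function (in $y$) of the process $$Y_g(t)=\sum_{j=1}^{B(t)} X_j^{(g)},\qquad t\ge 0.$$
   Context: Linear birth process: $B$ is the continuous-time Markov process on $\{1,2,\dots\}$ with $B(0)=1$ which jumps from $k$ to $k+1$ at rate $k\lambda$; its one-dimensional law is $P\{B(t)=n\}=e^{-\lambda t}(1-e^{-\lambda t})^{n-1}$, $n=1,2,\dots$, $t\ge 0$. The function $g$: a Bernstein function $g(\theta)=\int_0^{\infty}(1-e^{-\theta s})\,\overline{\nu}(ds)$, $\theta>0$, where $\overline{\nu}$ is a Lévy measure on $(0,\infty)$ (that is, $\int_0^\infty \min(s,1)\,\overline\nu(ds)<\infty$); the trivial case $g(\theta)=\theta$ is also included. $\mathcal{A}_g=\{\mathcal{A}_g(t),t\ge 0\}$ is the subordinator (process with non-decreasing paths) with $\mathbb{E}e^{-\theta\mathcal{A}_g(t)}=e^{-g(\theta)t}$, and $h_g(\cdot,t)$ denotes the density of $\mathcal{A}_g(t)$, assumed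 to exist (in the trivial case $\mathcal{A}_g(t)=t$). The addends: $X^{(g)}$ has the law of $\mathcal{A}_g(X)$, where $X\sim \mathrm{Exp}(\xi)$ (density $\xi e^{-\xi x}$, $x>0$) is independent of $\mathcal{A}_g$. Thus $\mathbb{E}e^{-\theta X^{(g)}}=\xi/(\xi+g(\theta))$, and the density is $f_{X^{(g)}}(x)=\xi\int_0^{+\infty} e^{-\xi t}h_g(x,t)\,dt$, $x>0$ (in the trivial case, $f_{X^{(g)}}(x)=\xi e^{-\xi x}$). Convolution: $[f\ast f](y,t)=\int_0^y f(y-z,t)f(z,t)\,dz$, i.e. in the space variable. Convolution-type derivative in the sense of Caputo: with $\nu(s)=\int_s^{+\infty}\overline\nu(dz)$ the tail of the Lévy measure, $$\mathcal{D}^g_y u(y)=\int_0^y \frac{d}{dy}u(y-s)\,\nu(s)\,ds,\qquad y>0;$$ for $g(\theta)=\theta$, $\mathcal{D}_y^g$ is the first-order derivative $d/dy$, and for $g(\theta)=\theta^\alpha$, $\alpha\in(0,1)$, it is the Caputo fractional derivative of order $\alpha$.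
   Formalization: The printed formula for the derivative fails, e.g. for g(θ)=θ^{1/2}; where f∗f is not absolutely continuous up to 0 it is taken weakly. The equation holds for a.e. y, and uniqueness is a.e. among integrable f whose time derivative is locally dominated. *)

theory Defs
  imports "HOL-Probability.Probability"
begin

section \<open>Bernstein functions and subordinators\<close>

definition levy_measure :: "real measure \<Rightarrow> bool" where
  "levy_measure N \<longleftrightarrow> sets N = sets borel \<and> emeasure N {..0} = 0 \<and>
     (\<integral>\<^sup>+ s. ennreal (min s 1) \<partial>N) < \<infinity>"

text \<open>\<open>Levy N\<close> stands for the driftless Bernstein function with Levy measure \<open>N\<close>,
  \<open>Drift\<close> for the trivial case \<open>g \<theta> = \<theta>\<close>.\<close>

datatype bernstein = Drift | Levy "real measure"

fun wf_bernstein :: "bernstein \<Rightarrow> bool" where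
  "wf_bernstein Drift \<longleftrightarrow> True"
| "wf_bernstein (Levy N) \<longleftrightarrow> levy_measure N"

fun bernstein_fun :: "bernstein \<Rightarrow> real \<Rightarrow> real" where
  "bernstein_fun Drift \<theta> = \<theta>"
| "bernstein_fun (Levy N) \<theta> = (\<integral> s. (1 - exp (- \<theta> * s)) \<partial>N)"

definition levy_tail :: "real measure \<Rightarrow> real \<Rightarrow> real" where
  "levy_tail N s = measure N {s<..}"

definition subordinator :: "'b measure \<Rightarrow> (real \<Rightarrow> real) \<Rightarrow> (real \<Rightarrow> 'b \<Rightarrow> real) \<Rightarrow> bool" where
  "subordinator P g A \<longleftrightarrow> prob_space P \<and>
     (\<forall>t\<ge>0. A t \<in> borel_measurable P) \<and>
     (\<forall>\<omega>\<in>space P. A 0 \<omega> = 0 \<and> mono_on {0..} (\<lambda>t. A t \<omega>) \<and>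
        (\<forall>t\<ge>0. continuous (at_right t) (\<lambda>r. A r \<omega>))) \<and>
     (\<forall>n t. 0 \<le> t 0 \<and> mono t \<longrightarrow>
        prob_space.indep_vars P (\<lambda>_. borel) (\<lambda>i \<omega>. A (t (Suc i)) \<omega> - A (t i) \<omega>) {..<n::nat}) \<and>
     (\<forall>r\<ge>0. \<forall>t\<ge>0. distr P borel (\<lambda>\<omega>. A (r + t) \<omega> - A r \<omega>) = distr P borel (A t)) \<and>
     (\<forall>\<theta>>0. \<forall>t\<ge>0. prob_space.expectation P (\<lambda>\<omega>. exp (- \<theta> * A t \<omega>)) = exp (- g \<theta> * t))"

text \<open>In the trivial case \<open>A t = t\<close> has no density, and \<open>h\<close> is not used. Joint measurability
  of \<open>h\<close> is what makes the mixture over \<open>t\<close> in \<open>addend_density\<close> meaningful.\<close>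

fun subordinator_density ::
  "bernstein \<Rightarrow> 'b measure \<Rightarrow> (real \<Rightarrow> 'b \<Rightarrow> real) \<Rightarrow> (real \<Rightarrow> real \<Rightarrow> real) \<Rightarrow> bool" where
  "subordinator_density Drift P A h \<longleftrightarrow> True"
| "subordinator_density (Levy N) P A h \<longleftrightarrow>
     set_borel_measurable (borel \<Otimes>\<^sub>M borel) (UNIV \<times> {0<..}) (\<lambda>(x, t). h x t) \<and>
     (\<forall>t>0. (\<forall>x. h x t \<ge> 0) \<and> distributed P lborel (A t) (\<lambda>x. ennreal (h x t)))"

definition addend_density :: "bernstein \<Rightarrow> real \<Rightarrow> (real \<Rightarrow> real \<Rightarrow> real) \<Rightarrow> real \<Rightarrow> real" where
  "addend_density S \<xi> h x =
     (if x \<le> 0 then 0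
      else case S of
        Drift \<Rightarrow> \<xi> * exp (- \<xi> * x)
      | Levy N \<Rightarrow> \<xi> * (LBINT t:{0<..}. exp (- \<xi> * t) * h x t))"

section \<open>The linear birth process\<close>

definition birth_rate :: "real \<Rightarrow> nat \<Rightarrow> nat \<Rightarrow> real" where
  "birth_rate lam k m = (if m = Suc k then real k * lam else if m = k then - (real k * lam) else 0)"

text \<open>A time-homogeneous Markov process, given by its finite-dimensional distributions with
  transition function \<open>p\<close>, whose infinitesimal rates at time 0 are those of \<open>birth_rate\<close>.\<close>

definition linear_birth_process :: "'a measure \<Rightarrow> real \<Rightarrow> (real \<Rightarrow> 'a \<Rightarrow> nat) \<Rightarrow> bool" where
  "linear_birth_process M lam B \<longleftrightarrow> prob_space M \<and>
     (\<forall>t\<ge>0. B t \<in> measurable M (count_space UNIV)) \<and>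
     (\<forall>\<omega>\<in>space M. B 0 \<omega> = 1 \<and> mono_on {0..} (\<lambda>t. B t \<omega>) \<and>
        (\<forall>t\<ge>0. continuous (at_right t) (\<lambda>r. B r \<omega>))) \<and>
     (\<exists>p :: real \<Rightarrow> nat \<Rightarrow> nat \<Rightarrow> real.
        (\<forall>t\<ge>0. \<forall>k\<ge>1. (\<forall>m. p t k m \<ge> 0) \<and> p t k 0 = 0 \<and> p t k sums 1) \<and>
        (\<forall>k\<ge>1. \<forall>m\<ge>1. p 0 k m = of_bool (k = m) \<and>
           ((\<lambda>t. p t k m) has_real_derivative birth_rate lam k m) (at_right 0)) \<and>
        (\<forall>n (t :: nat \<Rightarrow> real) (k :: nat \<Rightarrow> nat).
           0 \<le> t 0 \<and> strict_mono t \<and> (\<forall>i. 1 \<le> k i) \<longrightarrow>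
           measure M {\<omega> \<in> space M. \<forall>i\<le>Suc n. B (t i) \<omega> = k i} =
           measure M {\<omega> \<in> space M. \<forall>i\<le>n. B (t i) \<omega> = k i}
             * p (t (Suc n) - t n) (k n) (k (Suc n))))"

section \<open>The convolution-type Caputo derivative\<close>

definition space_conv :: "(real \<Rightarrow> real \<Rightarrow> real) \<Rightarrow> real \<Rightarrow> real \<Rightarrow> real" where
  "space_conv f y t = (LBINT z:{0<..<y}. f (y - z) t * f z t)"

definition conv_caputo :: "bernstein \<Rightarrow> (real \<Rightarrow> real) \<Rightarrow> real \<Rightarrow> real" where
  "conv_caputo S u y =
     (case S of
        Drift \<Rightarrow> deriv u y
      | Levy N \<Rightarrow> (LBINT s:{0<..<y}. deriv (\<lambda>x. u (x - s)) y * levy_tail N s))"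

text \<open>The functions to which the formula \<open>conv_caputo\<close> applies: local absolute continuity on
  \<open>[0,\<infinity>)\<close>, stated as validity of the fundamental theorem of calculus.\<close>

definition locally_ac :: "(real \<Rightarrow> real) \<Rightarrow> bool" where
  "locally_ac u \<longleftrightarrow>
     (AE y in lborel. y > 0 \<longrightarrow> u differentiable (at y)) \<and>
     (\<forall>b>0. set_integrable lborel {0<..<b} (deriv u) \<and>
        u b = u 0 + (LBINT y:{0<..<b}. deriv u y))"

text \<open>\<open>conv_caputo_of S u v\<close>: the function \<open>v\<close> is the Caputo-type derivative of \<open>u\<close>. For locally
  absolutely continuous \<open>u\<close> this is the formula \<open>conv_caputo\<close>. That formula makes no sense when
  \<open>u\<close> is singular at the origin or not differentiable (for the \<open>\<alpha>\<close>-stable subordinator,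
  \<open>f * f\<close> behaves like \<open>y powr (2 * \<alpha> - 1)\<close> at 0, and so is not absolutely continuous up to
  the origin when \<open>\<alpha> \<le> 1/2\<close>). For such \<open>u\<close> the derivative under the integral sign is
  taken in the weak sense, i.e. \<open>v\<close> is the locally integrable function with primitive
  \<open>\<integral>\<^sub>0\<^sup>y (u (y - s) - u 0) \<nu>(s) ds\<close>. The lemma \<open>conv_caputo_primitive_of_ac\<close> below shows
  that the formula satisfies the same requirement, so that the second branch extends the first.\<close>

definition conv_caputo_primitive :: "bernstein \<Rightarrow> (real \<Rightarrow> real) \<Rightarrow> (real \<Rightarrow> real) \<Rightarrow> bool" where
  "conv_caputo_primitive S u v \<longleftrightarrow>
     (\<forall>y>0. set_integrable lborel {0<..<y} v \<and>
        (case S of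
           Drift \<Rightarrow> (LBINT z:{0<..<y}. v z) = u y - u 0
         | Levy N \<Rightarrow>
             set_integrable lborel {0<..<y} (\<lambda>s. (u (y - s) - u 0) * levy_tail N s) \<and>
             (LBINT z:{0<..<y}. v z) = (LBINT s:{0<..<y}. (u (y - s) - u 0) * levy_tail N s)))"

definition conv_caputo_of :: "bernstein \<Rightarrow> (real \<Rightarrow> real) \<Rightarrow> (real \<Rightarrow> real) \<Rightarrow> bool" where
  "conv_caputo_of S u v \<longleftrightarrow>
     (if locally_ac u then AE y in lborel. y > 0 \<longrightarrow> v y = conv_caputo S u y
      else conv_caputo_primitive S u v)"

lemma levy_measure_tail_finite:
  assumes N: "levy_measure N" and s: "s > 0"
  shows "emeasure N {s<..} < \<infinity>"
proof -
  have sets: "sets N = sets borel" and fin: "(\<integral>\<^sup>+ s. ennreal (min s 1) \<partial>N) < \<infinity>"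
    using N by (auto simp: levy_measure_def)
  have "ennreal (min s 1) * emeasure N {s<..} = (\<integral>\<^sup>+ x. ennreal (min s 1) * indicator {s<..} x \<partial>N)"
    by (subst nn_integral_cmult_indicator) (auto simp: sets)
  also have "\<dots> \<le> (\<integral>\<^sup>+ x. ennreal (min x 1) \<partial>N)"
    by (intro nn_integral_mono) (auto simp: indicator_def intro!: ennreal_leI)
  finally have "ennreal (min s 1) * emeasure N {s<..} < \<infinity>"
    using fin by (rule le_less_trans)
  then show ?thesis
    using s by (auto simp: ennreal_mult_less_top)
qed

lemma levy_tail_eq:
  assumes N: "levy_measure N" and s: "s > 0"
  shows "ennreal (levy_tail N s) = emeasure N {s<..}"
  unfolding levy_tail_def
  using levy_measure_tail_finite[OF assms] by (intro emeasure_eq_ennreal_measure[symmetric]) auto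

lemma levy_tail_antimono:
  assumes N: "levy_measure N" and "0 < s" "s \<le> t"
  shows "levy_tail N t \<le> levy_tail N s"
  unfolding levy_tail_def using N levy_measure_tail_finite[OF N \<open>0 < s\<close>] \<open>s \<le> t\<close>
  by (intro measure_mono_fmeasurable) (auto simp: levy_measure_def fmeasurable_def)

lemma levy_tail_measurable:
  assumes N: "levy_measure N"
  shows "(\<lambda>s. indicator {0<..<b} s * levy_tail N s) \<in> borel_measurable borel"
proof -
  have "levy_tail N \<in> borel_measurable (restrict_space borel {0<..<b})"
  proof -
    have "(\<lambda>s. - levy_tail N s) \<in> borel_measurable (restrict_space borel {0<..<b})"
      using levy_tail_antimono[OF N]
      by (intro borel_measurable_mono_on_fnc) (auto simp: mono_on_def)
    from borel_measurable_uminus[OF this] show ?thesis by simp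
  qed
  then show ?thesis
    by (subst (asm) borel_measurable_restrict_space_iff) (auto simp: mult.commute)
qed

lemma levy_tail_integrable:
  assumes N: "levy_measure N"
  shows "set_integrable lborel {0<..<b} (levy_tail N)"
proof -
  have sets: "sets N = sets borel" and null: "emeasure N {..0} = 0"
    and fin: "(\<integral>\<^sup>+ s. ennreal (min s 1) \<partial>N) < \<infinity>"
    using N by (auto simp: levy_measure_def)
  have [measurable_cong]: "sets N = sets borel" by fact
  have "sigma_finite_measure N"
  proof
    let ?C = "insert {..0} (range (\<lambda>n. {inverse (real (Suc n))<..}))"
    have "\<Union> ?C = space N"
    proof -
      have "x \<in> \<Union> ?C" for x :: real
        using reals_Archimedean[of x] by (cases "x \<le> 0") (auto simp: not_le)
      then show ?thesis
        using sets_eq_imp_space_eq[OF sets] by auto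
    qed
    moreover have "emeasure N a \<noteq> \<infinity>" if "a \<in> ?C" for a
      using that
    proof
      assume "a = {..0}"
      with null show ?thesis by simp
    next
      assume "a \<in> range (\<lambda>n. {inverse (real (Suc n))<..})"
      then obtain n where "a = {inverse (real (Suc n))<..}" ..
      then show ?thesis
        using levy_measure_tail_finite[OF N, of "inverse (real (Suc n))"] by simp
    qed
    moreover have "?C \<subseteq> sets N"
      unfolding sets by (auto simp del: of_nat_Suc)
    moreover have "countable ?C"
      by simp
    ultimately show "\<exists>C. countable C \<and> C \<subseteq> sets N \<and> \<Union> C = space N \<and> (\<forall>a\<in>C. emeasure N a \<noteq> \<infinity>)"
      by (intro exI[of _ ?C]) (intro conjI ballI)
  qed
  then interpret N: sigma_finite_measure N .
  interpret pair_sigma_finite lborel N ..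
  have "(\<integral>\<^sup>+ s. ennreal (indicator {0<..<b} s * levy_tail N s) \<partial>lborel)
      = (\<integral>\<^sup>+ s. (\<integral>\<^sup>+ x. indicator {0<..<b} s * indicator {s<..} x \<partial>N) \<partial>lborel)"
    by (intro nn_integral_cong, subst nn_integral_cmult)
      (auto simp: indicator_def sets levy_tail_eq[OF N])
  also have "\<dots> = (\<integral>\<^sup>+ x. (\<integral>\<^sup>+ s. indicator {0<..<b} s * indicator {s<..} x \<partial>lborel) \<partial>N)"
  proof (rule Fubini'[symmetric])
    have "(\<lambda>(s, x). indicator {0<..<b} s * indicator {s<..} x :: ennreal)
        = (\<lambda>p. indicator {0<..<b} (fst p) * indicator {p. fst p < snd p} p)"
      by (auto simp: indicator_def fun_eq_iff)
    also have "\<dots> \<in> borel_measurable (lborel \<Otimes>\<^sub>M N)"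
      by measurable
    finally show "(\<lambda>(s, x). indicator {0<..<b} s * indicator {s<..} x :: ennreal)
        \<in> borel_measurable (lborel \<Otimes>\<^sub>M N)" .
  qed
  also have "\<dots> \<le> (\<integral>\<^sup>+ x. ennreal (max b 1) * ennreal (min x 1) \<partial>N)"
  proof (rule nn_integral_mono_AE)
    have "AE x in N. x > 0"
      using null by (intro AE_I[of _ _ "{..0}"]) (auto simp: sets not_less)
    then show "AE x in N. (\<integral>\<^sup>+ s. indicator {0<..<b} s * indicator {s<..} x \<partial>lborel)
        \<le> ennreal (max b 1) * ennreal (min x 1)"
    proof eventually_elim
      case (elim x)
      have "(\<integral>\<^sup>+ s. indicator {0<..<b} s * indicator {s<..} x \<partial>lborel)
          = (\<integral>\<^sup>+ s. indicator {0<..<min b x} s \<partial>lborel)"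
        by (intro nn_integral_cong) (auto simp: indicator_def)
      also have "\<dots> = emeasure lborel {0<..<min b x}"
        by simp
      also have "\<dots> \<le> ennreal (max b 1 * min x 1)"
      proof (cases "0 \<le> min b x")
        case True
        have "min b x \<le> max b 1 * min x 1"
        proof (cases "x \<le> 1")
          case True
          then show ?thesis
            using elim mult_right_mono[of 1 "max b 1" x] by (auto simp: min_def)
        qed auto
        then show ?thesis
          using True by (auto intro!: ennreal_leI)
      qed auto
      finally show ?case
        using elim by (simp add: ennreal_mult)
    qed
  qed
  also have "\<dots> = ennreal (max b 1) * (\<integral>\<^sup>+ x. ennreal (min x 1) \<partial>N)"
    by (rule nn_integral_cmult) measurable
  also have "\<dots> < \<infinity>"
    using fin by (simp add: ennreal_mult_less_top)
  finally have "(\<integral>\<^sup>+ s. ennreal (indicator {0<..<b} s * levy_tail N s) \<partial>lborel) < \<infinity>" .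
  then show ?thesis
    unfolding set_integrable_def
    using levy_tail_measurable[OF N, of b]
    by (intro integrableI_nonneg) (simp_all add: levy_tail_def)
qed

lemma conv_caputo_primitive_of_ac:
  assumes wf: "wf_bernstein S" and ac: "locally_ac u"
  shows "conv_caputo_primitive S u (conv_caputo S u)"
proof (cases S)
  case Drift
  have "conv_caputo S u = deriv u"
    by (simp add: conv_caputo_def Drift fun_eq_iff)
  with ac show ?thesis
    by (simp add: conv_caputo_primitive_def locally_ac_def Drift)
next
  case (Levy N)
  then have N: "levy_measure N"
    using wf by simp
  have shift: "deriv (\<lambda>x. u (x - s)) y = deriv u (y - s)" for s y
    using DERIV_shift[of u _ y "- s"] by (simp add: deriv_def)
  show ?thesis
    unfolding conv_caputo_primitive_def Levy bernstein.case
  proof (intro allI impI)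
    fix y :: real assume y: "y > 0"
    define V where "V = (\<lambda>s. indicator {0<..<y} s * levy_tail N s)"
    define W where "W = (\<lambda>s. indicator {0<..<y} s * deriv u s)"
    have V: "integrable lborel V"
      using levy_tail_integrable[OF N, of y] by (simp add: set_integrable_def V_def)
    have W: "integrable lborel W"
      using ac y by (simp add: locally_ac_def set_integrable_def W_def)
    have [measurable]: "V \<in> borel_measurable borel" "W \<in> borel_measurable borel"
      using V W by auto
    have W_shift: "integrable lborel (\<lambda>z. W (z - s))" for s
      using lborel_integrable_real_affine[OF W, of 1 "- s"] by simp
    define F where "F = (\<lambda>(s, z). V s * W (z - s) * indicator {..<y} z)"
    have [measurable]: "F \<in> borel_measurable (lborel \<Otimes>\<^sub>M lborel)"
      unfolding F_def by measurable
    have F_eq: "F (s, z) = indicator {0<..<y} z * (indicator {0<..<z} s * (deriv u (z - s) * levy_tail N s))" for s z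
      by (auto simp: F_def V_def W_def indicator_def)
    have F_eq2: "F (s, z) = (indicator {0<..<y} s * levy_tail N s) * (indicator {0<..<y - s} (z - s) * deriv u (z - s))" for s z
      by (auto simp: F_def V_def W_def indicator_def)
    have F: "integrable (lborel \<Otimes>\<^sub>M lborel) F"
    proof (rule lborel_pair.Fubini_integrable)
      show "AE s in lborel. integrable lborel (\<lambda>z. F (s, z))"
        unfolding F_def by (auto intro!: integrable_real_mult_indicator W_shift)
      have nW: "(\<integral> z. \<bar>W (z - s)\<bar> \<partial>lborel) = (\<integral> z. \<bar>W z\<bar> \<partial>lborel)" for s
        using lborel_integral_real_affine[of 1 "\<lambda>z. \<bar>W z\<bar>" "- s"] by simp
      have iF: "integrable lborel (\<lambda>z. F (s, z))" for s
        unfolding F_def by (auto intro!: integrable_real_mult_indicator W_shift)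
      show "integrable lborel (\<lambda>s. \<integral> z. norm (F (s, z)) \<partial>lborel)"
      proof (rule Bochner_Integration.integrable_bound)
        show "integrable lborel (\<lambda>s. \<bar>V s\<bar> * (\<integral> z. \<bar>W z\<bar> \<partial>lborel))"
          using V by auto
        show "AE s in lborel. norm (\<integral> z. norm (F (s, z)) \<partial>lborel)
            \<le> norm (\<bar>V s\<bar> * (\<integral> z. \<bar>W z\<bar> \<partial>lborel))"
        proof (rule AE_I2)
          fix s
          have "(\<integral> z. norm (F (s, z)) \<partial>lborel) \<le> (\<integral> z. \<bar>V s\<bar> * \<bar>W (z - s)\<bar> \<partial>lborel)"
          proof (rule integral_mono)
            show "integrable lborel (\<lambda>z. norm (F (s, z)))"
              by (rule integrable_norm[OF iF])
            show "integrable lborel (\<lambda>z. \<bar>V s\<bar> * \<bar>W (z - s)\<bar>)"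
              using W_shift by simp
          qed (auto simp: F_def abs_mult indicator_def)
          also have "\<dots> = \<bar>V s\<bar> * (\<integral> z. \<bar>W z\<bar> \<partial>lborel)"
            by (simp add: nW)
          finally show "norm (\<integral> z. norm (F (s, z)) \<partial>lborel)
            \<le> norm (\<bar>V s\<bar> * (\<integral> z. \<bar>W z\<bar> \<partial>lborel))" by simp
        qed
      qed simp
    qed simp
    have inner1: "(\<integral> s. F (s, z) \<partial>lborel) = indicator {0<..<y} z * conv_caputo S u z" for z
      by (simp add: F_eq conv_caputo_def Levy set_lebesgue_integral_def shift)
    have inner2: "(\<integral> z. F (s, z) \<partial>lborel)
        = indicator {0<..<y} s * ((u (y - s) - u 0) * levy_tail N s)" for s
    proof (cases "s \<in> {0<..<y}")
      case True
      have "(\<integral> z. indicator {0<..<y - s} (z - s) * deriv u (z - s) \<partial>lborel)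
          = (\<integral> z. indicator {0<..<y - s} z * deriv u z \<partial>lborel)"
        using lborel_integral_real_affine[of 1 "\<lambda>z. indicator {0<..<y - s} z * deriv u z" "- s"]
        by simp
      also have "\<dots> = u (y - s) - u 0"
        using ac True by (auto simp: locally_ac_def set_lebesgue_integral_def)
      finally show ?thesis
        using True by (simp add: F_eq2)
    qed (simp add: F_eq2)
    have "integrable lborel (\<lambda>s. \<integral> z. F (s, z) \<partial>lborel)"
      using lborel_pair.integrable_fst'[OF F] by simp
    moreover have "integrable lborel (\<lambda>z. \<integral> s. F (s, z) \<partial>lborel)"
      using lborel_pair.integrable_snd[of "\<lambda>s z. F (s, z)"] F by simp
    moreover have "(\<integral> z. (\<integral> s. F (s, z) \<partial>lborel) \<partial>lborel) = (\<integral> s. (\<integral> z. F (s, z) \<partial>lborel) \<partial>lborel)"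
      using lborel_pair.Fubini_integral[of "\<lambda>s z. F (s, z)"] F by simp
    ultimately show "set_integrable lborel {0<..<y} (conv_caputo (Levy N) u) \<and>
        set_integrable lborel {0<..<y} (\<lambda>s. (u (y - s) - u 0) * levy_tail N s) \<and>
        (LBINT z:{0<..<y}. conv_caputo (Levy N) u z) =
        (LBINT s:{0<..<y}. (u (y - s) - u 0) * levy_tail N s)"
      unfolding inner1 inner2 by (simp add: set_integrable_def set_lebesgue_integral_def Levy)
  qed
qed

section \<open>Solutions of the equation\<close>

text \<open>Since densities are determined only up to null sets in \<open>y\<close>, the equation is required for
  almost every \<open>y > 0\<close>. The first three conditions fix the class of functions in which a
  solution is sought: integrable in \<open>y\<close>, with time derivative locally dominated in \<open>t\<close> by an
  integrable function of \<open>y\<close>, and attaining the initial value continuously.\<close>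

definition solves_birth_equation ::
  "bernstein \<Rightarrow> real \<Rightarrow> real \<Rightarrow> (real \<Rightarrow> real) \<Rightarrow> (real \<Rightarrow> real \<Rightarrow> real) \<Rightarrow> bool" where
  "solves_birth_equation S lam \<xi> f0 f \<longleftrightarrow>
     (\<forall>t\<ge>0. set_integrable lborel {0<..} (\<lambda>y. f y t)) \<and>
     (\<forall>T>0. \<exists>G. set_integrable lborel {0<..} G \<and>
        (AE y in lborel. y > 0 \<longrightarrow>
           (\<forall>t\<in>{0<..T}. f y differentiable (at t) \<and> \<bar>deriv (f y) t\<bar> \<le> G y))) \<and>
     (AE y in lborel. y > 0 \<longrightarrow> continuous (at_right 0) (f y)) \<and>
     (\<forall>t>0. \<exists>v. conv_caputo_of S (\<lambda>y. space_conv f y t) v \<and>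
        (AE y in lborel. y > 0 \<longrightarrow>
           (f y has_real_derivative (- lam * (exp (lam * t) / \<xi>) * v y)) (at t))) \<and>
     (\<forall>y>0. f y 0 = f0 y)"

end

theory Submission
  imports Defs
begin

text \<open>Since \<open>B(t)\<close> is geometric with parameter \<open>p = exp (- lam * t)\<close> and the addends have Laplace
  transform \<open>\<xi> / (\<xi> + g \<theta>)\<close>, the sum \<open>Y(t)\<close> has Laplace transform \<open>a / (a + g \<theta>)\<close> with
  \<open>a = \<xi> * p\<close>: it is distributed as an addend with \<open>\<xi>\<close> replaced by \<open>a\<close>. Its density \<open>f\<close> is
  thus an explicit mixture, which is differentiated in \<open>a\<close> under the integral sign. The equation
  itself amounts to the renewal-type identity \<open>f * \<nu> + a * (f * 1) = a\<close> on the half-line, convolved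
  once more with \<open>f\<close>. For uniqueness, the Laplace transform of any solution satisfies the
  Riccati equation \<open>\<phi>' = - lam * exp (lam * t) / \<xi> * g \<theta> * \<phi>\<^sup>2\<close>, and the difference of two
  solutions of that equation satisfies a linear homogeneous one.\<close>

section \<open>Laplace transforms and convolutions\<close>

text \<open>Probabilistic background: a geometric sum of independent Exp(\<xi>) times is Exp(\<xi>
  p), and adding independent copies of the subordinator run for these times amounts to running it
  for the total time. Analytically, f = a U with U the a-potential density of the subordinator, and
  the resolvent equation dU/da = - U * U is what turns a time derivative into a self-convolution.
  Three obstacles shape the work. First, g is not the Laplace transform of a function, whereas
  g(\<theta>)/\<theta> is that of the tail \<nu> (of a unit mass at 0 in the trivial case); the
  operator is therefore handled through primitives. Second, injectivity of the Laplace transform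
  gives equality only for almost every y, while the primitive of the Caputo derivative is prescribed
  at every y > 0, where f * f might be infinite a priori. Third, differentiation in t needs a null
  set of y common to all t; monotonicity in a reduces this to countably many values of a. Moreover
  the law of B has to be derived, since the process is given by its rates at time 0.\<close>

text \<open>The map x -> exp (- x) carries the half-line into [0,1]. There, Weierstrass
  approximation extends the equality from powers to continuous functions, and continuous cutoffs
  then reach the sets \<open>{b<..}\<close>.\<close>

lemma measure_eqI_exp_moments:
  fixes M N :: "real measure"
  assumes finM: "finite_measure M" and finN: "finite_measure N"
    and setsM[measurable_cong]: "sets M = sets borel" and setsN[measurable_cong]: "sets N = sets borel"
    and posM: "AE x in M. 0 \<le> x" and posN: "AE x in N. 0 \<le> x"
    and moments: "\<And>n::nat. (\<integral>x. exp (- x) ^ n \<partial>M) = (\<integral>x. exp (- x) ^ n \<partial>N)"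
  shows "M = N"
proof -
  interpret M: finite_measure M by fact
  interpret N: finite_measure N by fact
  have integrable: "integrable K (\<lambda>x. g (exp (- x)))"
    if "finite_measure K" "sets K = sets borel" "AE x in K. 0 \<le> x" "continuous_on UNIV g"
    for K :: "real measure" and g :: "real \<Rightarrow> real"
  proof -
    have [measurable_cong]: "sets K = sets borel" by fact
    have [measurable]: "g \<in> borel_measurable borel"
      using that(4) by (rule borel_measurable_continuous_onI)
    have "compact (g ` {0..1})"
      using that(4) by (intro compact_continuous_image) (auto intro: continuous_on_subset)
    then obtain b where b: "\<And>x. x \<in> {0..1} \<Longrightarrow> \<bar>g x\<bar> \<le> b"
      by (force dest!: compact_imp_bounded simp: bounded_iff)
    interpret finite_measure K by fact
    show ?thesis
      using that(3) by (intro integrable_const_bound[of _ b]) (auto intro!: b elim: eventually_mono)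
  qed
  have approx: "\<bar>(\<integral>x. g (exp (- x)) \<partial>K) - (\<integral>x. p (exp (- x)) \<partial>K)\<bar> \<le> e * measure K (space K)"
    if K: "finite_measure K" "sets K = sets borel" "AE x in K. 0 \<le> x" and g: "continuous_on UNIV g"
      and p: "continuous_on UNIV p" and e: "\<And>x. x \<in> {0..1} \<Longrightarrow> \<bar>g x - p x\<bar> < e"
    for K :: "real measure" and g p :: "real \<Rightarrow> real" and e
  proof -
    interpret finite_measure K by fact
    note [simp] = integrable[OF K g] integrable[OF K p]
    have "\<bar>(\<integral>x. g (exp (- x)) \<partial>K) - (\<integral>x. p (exp (- x)) \<partial>K)\<bar>
        = \<bar>\<integral>x. g (exp (- x)) - p (exp (- x)) \<partial>K\<bar>"
      by simp
    also have "\<dots> \<le> (\<integral>x. \<bar>g (exp (- x)) - p (exp (- x))\<bar> \<partial>K)"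
      by (rule integral_abs_bound)
    also have "\<dots> \<le> (\<integral>x. e \<partial>K)"
      using K(3) by (intro integral_mono_AE) (auto elim!: eventually_mono intro!: less_imp_le e)
    finally show ?thesis by (simp add: mult.commute)
  qed
  have cont_eq: "(\<integral>x. g (exp (- x)) \<partial>M) = (\<integral>x. g (exp (- x)) \<partial>N)"
    if g: "continuous_on UNIV g" for g :: "real \<Rightarrow> real"
  proof (rule ccontr)
    assume neq: "\<not> ?thesis"
    define d where "d = \<bar>(\<integral>x. g (exp (- x)) \<partial>M) - (\<integral>x. g (exp (- x)) \<partial>N)\<bar>"
    \<comment> \<open>The summand 1 keeps \<open>c\<close> positive and leaves slack: the two
      approximation errors add up to \<open>d / c * (c - 1)\<close>, which is below
      \<open>d\<close>.\<close>
    define c where "c = measure M (space M) + measure N (space N) + 1"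
    have "d > 0" using neq by (simp add: d_def)
    have "c > 0" unfolding c_def using measure_nonneg[of M] measure_nonneg[of N] by (metis add_nonneg_nonneg add_nonneg_pos zero_less_one)
    obtain p where p: "real_polynomial_function p" and pg: "\<And>x. x \<in> {0..1} \<Longrightarrow> \<bar>g x - p x\<bar> < d / c"
      using g \<open>d > 0\<close> \<open>c > 0\<close>
      by (rule_tac Stone_Weierstrass_real_polynomial_function[of "{0..1::real}" g "d / c"])
        (auto intro: continuous_on_subset)
    then obtain a n where p_eq: "p = (\<lambda>x. \<Sum>i\<le>n. a i * x ^ i)"
      by (auto simp: real_polynomial_function_iff_sum)
    have cp: "continuous_on UNIV p" unfolding p_eq by (intro continuous_intros)
    have ip: "integrable M (\<lambda>x. exp (- x) ^ i)" "integrable N (\<lambda>x. exp (- x) ^ i)" for i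
      using integrable[OF finM setsM posM, of "\<lambda>x. x ^ i"] integrable[OF finN setsN posN, of "\<lambda>x. x ^ i"]
      by (simp_all add: continuous_on_power continuous_on_id)
    have "(\<integral>x. p (exp (- x)) \<partial>M) = (\<integral>x. p (exp (- x)) \<partial>N)"
      unfolding p_eq by (simp add: ip moments)
    then have "d \<le> d / c * measure M (space M) + d / c * measure N (space N)"
      using approx[OF finM setsM posM g cp pg] approx[OF finN setsN posN g cp pg]
      unfolding d_def by linarith
    also have "\<dots> = d / c * (c - 1)" by (simp add: c_def add_divide_distrib distrib_left)
    also have "\<dots> < d" using \<open>d > 0\<close> \<open>c > 0\<close> by (simp add: field_simps)
    finally show False by simp
  qed
  \<comment> \<open>A clamped ramp that increases with \<open>k\<close> to the indicator of z < c.
    For c = exp (- b) and z = exp (- x) this is the indicator of x > b.\<close>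
  define \<phi> where "\<phi> c k z = max 0 (min 1 (real k * (c - z)))" for c z :: real and k :: nat
  have cont: "continuous_on UNIV (\<phi> c k)" for c k
    unfolding \<phi>_def by (intro continuous_intros)
  have lim: "(\<lambda>k. \<phi> (exp (- b)) k (exp (- x))) \<longlonglongrightarrow> indicator {b<..} x" for b x
  proof (cases "b < x")
    case True
    then have pos: "exp (- b) - exp (- x) > 0" by simp
    then obtain k0 :: nat where k0: "1 < real k0 * (exp (- b) - exp (- x))"
      using reals_Archimedean3 by blast
    have "\<phi> (exp (- b)) k (exp (- x)) = 1" if "k \<ge> k0" for k
    proof -
      have "real k0 * (exp (- b) - exp (- x)) \<le> real k * (exp (- b) - exp (- x))"
        using that pos by (intro mult_right_mono) auto
      then show ?thesis using k0 by (simp add: \<phi>_def)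
    qed
    then show ?thesis
      using True by (intro tendsto_eventually) (auto simp: eventually_at_top_linorder)
  next
    case False
    then have "real k * (exp (- b) - exp (- x)) \<le> 0" for k by (intro mult_nonneg_nonpos) auto
    then have "\<phi> (exp (- b)) k (exp (- x)) = 0" for k
      unfolding \<phi>_def by (metis max.absorb1 min.coboundedI2)
    then show ?thesis using False by simp
  qed
  have meas: "measure K {b<..} = lim (\<lambda>k. \<integral>x. \<phi> (exp (- b)) k (exp (- x)) \<partial>K)"
    if K: "finite_measure K" "sets K = sets borel" for K :: "real measure" and b
  proof -
    interpret finite_measure K by fact
    have [measurable_cong]: "sets K = sets borel" by fact
    have [measurable]: "\<phi> c k \<in> borel_measurable borel" for c k
      using cont by (rule borel_measurable_continuous_onI)
    have "(\<lambda>k. \<integral>x. \<phi> (exp (- b)) k (exp (- x)) \<partial>K) \<longlonglongrightarrow> (\<integral>x. indicator {b<..} x \<partial>K)"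
    proof (rule integral_dominated_convergence[where w="\<lambda>_. 1"])
      show "AE x in K. (\<lambda>k. \<phi> (exp (- b)) k (exp (- x))) \<longlonglongrightarrow> indicat_real {b<..} x"
        by (intro AE_I2 lim)
      show "AE x in K. norm (\<phi> (exp (- b)) k (exp (- x))) \<le> 1" for k
        by (intro AE_I2) (auto simp: \<phi>_def)
    qed (auto simp: K(2))
    then show ?thesis
      using K(2) by (simp add: limI sets_eq_imp_space_eq)
  qed
  have "measure M {b<..} = measure N {b<..}" for b
  proof -
    have "(\<integral>x. \<phi> (exp (- b)) k (exp (- x)) \<partial>M) = (\<integral>x. \<phi> (exp (- b)) k (exp (- x)) \<partial>N)" for k
      by (rule cont_eq[of "\<lambda>z. \<phi> (exp (- b)) k z"]) (intro continuous_intros cont)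
    then show ?thesis by (simp add: meas finM finN setsM setsN)
  qed
  then have eq: "emeasure M {b<..} = emeasure N {b<..}" for b
    by (simp add: M.emeasure_eq_measure N.emeasure_eq_measure)
  show ?thesis
    by (rule measure_eqI_lessThan) (use eq setsM setsN in \<open>auto simp: M.emeasure_finite less_top[symmetric]\<close>)
qed

text \<open>Under the tilted measure, the n-th moment of exp (- x) is the transform at n + 1, so
  that even the total mass is a value at a positive argument. Reweighting by exp x recovers the
  original measure.\<close>

lemma measure_eqI_laplace:
  fixes M N :: "real measure"
  assumes setsM[measurable_cong]: "sets M = sets borel" and setsN[measurable_cong]: "sets N = sets borel"
    and pos: "AE x in M. 0 \<le> x" "AE x in N. 0 \<le> x"
    and fin: "\<And>\<theta>. \<theta> > 0 \<Longrightarrow> (\<integral>\<^sup>+x. exp (- \<theta> * x) \<partial>M) < \<infinity>"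
    and eq: "\<And>\<theta>. \<theta> > 0 \<Longrightarrow> (\<integral>\<^sup>+x. exp (- \<theta> * x) \<partial>M) = (\<integral>\<^sup>+x. exp (- \<theta> * x) \<partial>N)"
  shows "M = N"
proof -
  \<comment> \<open>Tilting by \<open>exp (- x)\<close> makes the measures finite.\<close>
  define tilt :: "real measure \<Rightarrow> real measure" where "tilt K = density K (\<lambda>x. ennreal (exp (- x)))" for K
  have tilt_moment: "(\<integral>\<^sup>+x. ennreal (exp (- x) ^ n) \<partial>tilt K) = (\<integral>\<^sup>+x. exp (- real (Suc n) * x) \<partial>K)"
    if [measurable_cong]: "sets K = sets borel" for K n
    unfolding tilt_def
    by (subst nn_integral_density)
      (auto intro!: nn_integral_cong simp: ennreal_mult[symmetric] exp_of_nat_mult[symmetric] exp_add[symmetric] algebra_simps)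
  have fin_tilt: "finite_measure (tilt K)"
    if K: "sets K = sets borel" and "(\<integral>\<^sup>+x. exp (- 1 * x) \<partial>K) < \<infinity>" for K
    using tilt_moment[OF K, of 0] that(2) by (intro finite_measureI) auto
  have "tilt M = tilt N"
  proof (rule measure_eqI_exp_moments)
    show "finite_measure (tilt M)"
      using fin[of 1] by (intro fin_tilt setsM) auto
    show "finite_measure (tilt N)"
      using fin[of 1] eq[of 1] by (intro fin_tilt setsN) auto
    show "AE x in tilt M. 0 \<le> x" "AE x in tilt N. 0 \<le> x"
      unfolding tilt_def using pos by (subst AE_density; auto)+
    show "(\<integral>x. exp (- x) ^ n \<partial>tilt M) = (\<integral>x. exp (- x) ^ n \<partial>tilt N)" for n
    proof -
      have "(\<integral>x. exp (- x) ^ n \<partial>tilt K) = enn2real (\<integral>\<^sup>+x. exp (- real (Suc n) * x) \<partial>K)"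
        if K: "sets K = sets borel" for K
        unfolding tilt_moment[OF K, symmetric]
        by (rule integral_eq_nn_integral) (auto simp: tilt_def measurable_cong_sets[OF K refl])
      then show ?thesis
        using eq[of "real (Suc n)"] by (simp add: setsM setsN del: of_nat_Suc)
    qed
  qed (simp_all add: tilt_def setsM setsN)
  moreover have "K = density (tilt K) (\<lambda>x. ennreal (exp x))" if [measurable_cong]: "sets K = sets borel" for K
    unfolding tilt_def
    by (subst density_density_eq) (auto simp: ennreal_mult[symmetric] exp_add[symmetric] density_1)
  ultimately show ?thesis
    using setsM setsN by metis
qed

section \<open>Laplace transforms of functions on the half-line\<close>

text \<open>Weaker than integrability on the half-line, so as to cover constants and Levy tails,
  whose total integral may be infinite.\<close>

definition laplace_integrable :: "(real \<Rightarrow> real) \<Rightarrow> bool" where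
  "laplace_integrable f \<longleftrightarrow> (\<forall>\<theta>>0. set_integrable lborel {0<..} (\<lambda>x. exp (- \<theta> * x) * f x))"

definition laplace :: "(real \<Rightarrow> real) \<Rightarrow> real \<Rightarrow> real" where
  "laplace f \<theta> = (LBINT x:{0<..}. exp (- \<theta> * x) * f x)"

lemma laplace_integrableD:
  "laplace_integrable f \<Longrightarrow> \<theta> > 0 \<Longrightarrow> integrable lborel (\<lambda>x. indicator {0<..} x * (exp (- \<theta> * x) * f x))"
  by (simp add: laplace_integrable_def set_integrable_def)

lemma laplace_integrable_measurable:
  assumes "laplace_integrable f"
  shows "(\<lambda>x. indicator {0<..} x * f x) \<in> borel_measurable borel"
proof -
  have [measurable]: "(\<lambda>x. indicator {0<..} x * (exp (- 1 * x) * f x)) \<in> borel_measurable borel"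
    using laplace_integrableD[OF assms, of 1] by (auto dest: borel_measurable_integrable)
  have "(\<lambda>x. exp x * (indicator {0<..} x * (exp (- 1 * x) * f x))) \<in> borel_measurable borel"
    by measurable
  also have "(\<lambda>x. exp x * (indicator {0<..} x * (exp (- 1 * x) * f x))) = (\<lambda>x. indicator {0<..} x * f x)"
    by (auto simp: fun_eq_iff indicator_def mult.assoc[symmetric] exp_add[symmetric])
  finally show ?thesis .
qed

lemma laplace_integrable_cong_AE:
  assumes "laplace_integrable f" "(\<lambda>x. indicator {0<..} x * g x) \<in> borel_measurable borel"
    and "AE x in lborel. x > 0 \<longrightarrow> f x = g x"
  shows "laplace_integrable g"
  unfolding laplace_integrable_def set_integrable_def
proof (intro allI impI)
  fix \<theta> :: real assume "\<theta> > 0"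
  note i = laplace_integrableD[OF assms(1) this]
  have m: "(\<lambda>x. exp (- \<theta> * x) * (indicator {0<..} x * g x)) \<in> borel_measurable borel"
    using assms(2) by measurable
  show "integrable lborel (\<lambda>x. indicator {0<..} x *\<^sub>R (exp (- \<theta> * x) * g x))"
  proof (rule integrable_cong_AE_imp[OF i])
    show "(\<lambda>x. indicator {0<..} x *\<^sub>R (exp (- \<theta> * x) * g x)) \<in> borel_measurable lborel"
      using m by (simp add: ac_simps)
  qed (use assms(3) in \<open>auto simp: indicator_def\<close>)
qed

lemma laplace_integrable_add:
  "laplace_integrable f \<Longrightarrow> laplace_integrable g \<Longrightarrow> laplace_integrable (\<lambda>x. f x + g x)"
  unfolding laplace_integrable_def by (simp add: distrib_left set_integral_add)

lemma laplace_integrable_cmult: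
  "laplace_integrable f \<Longrightarrow> laplace_integrable (\<lambda>x. c * f x)"
  unfolding laplace_integrable_def by (simp add: mult.left_commute[of _ c])

lemma laplace_add:
  "laplace_integrable f \<Longrightarrow> laplace_integrable g \<Longrightarrow> \<theta> > 0 \<Longrightarrow> laplace (\<lambda>x. f x + g x) \<theta> = laplace f \<theta> + laplace g \<theta>"
  unfolding laplace_integrable_def laplace_def by (simp add: distrib_left set_integral_add)

lemma laplace_cmult: "laplace (\<lambda>x. c * f x) \<theta> = c * laplace f \<theta>"
  unfolding laplace_def by (simp add: mult.left_commute[of _ c])

lemma nn_integral_power_exp:
  assumes "b > 0"
  shows "(\<integral>\<^sup>+x. indicator {0<..} x * ennreal (x ^ k * exp (- b * x)) \<partial>lborel) = ennreal (fact k / b ^ Suc k)"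
proof -
  have "(\<integral>\<^sup>+x. indicator {0<..} x * ennreal (x ^ k * exp (- b * x)) \<partial>lborel)
      = (\<integral>\<^sup>+x. ennreal (fact k / b ^ Suc k) * ennreal (erlang_density k b x) \<partial>lborel)"
  proof (rule nn_integral_cong_AE)
    show "AE x in lborel. indicator {0<..} x * ennreal (x ^ k * exp (- b * x)) = ennreal (fact k / b ^ Suc k) * ennreal (erlang_density k b x)"
      using AE_lborel_singleton[of "0::real"]
      by eventually_elim (use assms in \<open>auto simp: erlang_density_def indicator_def ennreal_mult[symmetric]\<close>)
  qed
  also have "\<dots> = ennreal (fact k / b ^ Suc k) * 1"
    using nn_integral_erlang_ith_moment[OF assms, of k 0]
    by (subst nn_integral_cmult) auto
  finally show ?thesis by simp
qed

text \<open>Bridge from Tonelli computations in [0,\<infinity>] to Bochner integrals: one finite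
  value delivers integrability and the transform together.\<close>

lemma laplace_nn:
  assumes m: "(\<lambda>x. indicator {0<..} x * f x) \<in> borel_measurable borel"
    and f: "\<And>x. x > 0 \<Longrightarrow> f x \<ge> 0" and c: "c \<ge> 0"
    and eq: "(\<integral>\<^sup>+x. indicator {0<..} x * ennreal (exp (- \<theta> * x) * f x) \<partial>lborel) = ennreal c"
  shows "set_integrable lborel {0<..} (\<lambda>x. exp (- \<theta> * x) * f x)" "laplace f \<theta> = c"
proof -
  have "(\<lambda>x. exp (- \<theta> * x) * (indicator {0<..} x * f x)) \<in> borel_measurable borel"
    by (rule borel_measurable_times[OF _ m]) measurable
  then have [measurable]: "(\<lambda>x. indicator {0<..} x * (exp (- \<theta> * x) * f x)) \<in> borel_measurable borel"
    by (subst mult.left_commute)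
  have eq: "(\<integral>\<^sup>+x. ennreal (indicator {0<..} x * (exp (- \<theta> * x) * f x)) \<partial>lborel) = ennreal c"
    unfolding eq[symmetric] by (intro nn_integral_cong) (auto simp: indicator_def)
  have "has_bochner_integral lborel (\<lambda>x. indicator {0<..} x * (exp (- \<theta> * x) * f x)) c"
    using f c by (intro has_bochner_integral_nn_integral eq AE_I2) (measurable, auto simp: indicator_def)
  then show "set_integrable lborel {0<..} (\<lambda>x. exp (- \<theta> * x) * f x)" "laplace f \<theta> = c"
    by (auto simp: has_bochner_integral_iff set_integrable_def laplace_def set_lebesgue_integral_def)
qed

lemma laplace_one: 
  assumes "\<theta> > 0"
  shows "set_integrable lborel {0<..} (\<lambda>x. exp (- \<theta> * x) * 1)" "laplace (\<lambda>_. 1) \<theta> = 1 / \<theta>"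
  by (rule laplace_nn; use assms nn_integral_power_exp[of \<theta> 0] in simp)+

lemma laplace_integrable_const: "laplace_integrable (\<lambda>_. c)"
  using laplace_one(1) laplace_integrable_cmult[of "\<lambda>_. 1" c] by (auto simp: laplace_integrable_def)

lemma laplace_const: "\<theta> > 0 \<Longrightarrow> laplace (\<lambda>_. c) \<theta> = c / \<theta>"
  using laplace_cmult[of c "\<lambda>_. 1" \<theta>] laplace_one(2)[of \<theta>] by simp

text \<open>The difference \<open>r\<close> has a sign, so its positive and negative parts are
  treated as densities of two measures, \<open>D 1\<close> and \<open>D (-1)\<close>. Their
  transforms are finite and equal, hence the measures coincide, the two parts agree a.e., and
  \<open>r\<close> vanishes.\<close>

lemma laplace_eq_imp_AE_eq:
  assumes p: "laplace_integrable p" and q: "laplace_integrable q"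
    and eq: "\<And>\<theta>. \<theta> > 0 \<Longrightarrow> laplace p \<theta> = laplace q \<theta>"
  shows "AE x in lborel. x > 0 \<longrightarrow> p x = q x"
proof -
  define r where "r x = indicator {0<..} x * p x - indicator {0<..} x * q x" for x :: real
  have [measurable]: "r \<in> borel_measurable borel"
    unfolding r_def using laplace_integrable_measurable[OF p] laplace_integrable_measurable[OF q]
    by measurable
  have i: "integrable lborel (\<lambda>x. exp (- \<theta> * x) * r x)" "(\<integral>x. exp (- \<theta> * x) * r x \<partial>lborel) = 0"
    if "\<theta> > 0" for \<theta>
  proof -
    have *: "(\<lambda>x. exp (- \<theta> * x) * r x) = (\<lambda>x. indicator {0<..} x * (exp (- \<theta> * x) * p x) - indicator {0<..} x * (exp (- \<theta> * x) * q x))"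
      by (auto simp: r_def fun_eq_iff indicator_def algebra_simps)
    note ip = laplace_integrableD[OF p that] laplace_integrableD[OF q that]
    show "integrable lborel (\<lambda>x. exp (- \<theta> * x) * r x)"
      unfolding * using ip by simp
    show "(\<integral>x. exp (- \<theta> * x) * r x \<partial>lborel) = 0"
      unfolding * using ip eq[OF that] by (simp add: laplace_def set_lebesgue_integral_def)
  qed
  define D where "D s = density lborel (\<lambda>x. ennreal (max 0 (s * r x)))" for s
  have D: "(\<integral>\<^sup>+x. exp (- \<theta> * x) \<partial>D s) = ennreal (\<integral>x. max 0 (s * (exp (- \<theta> * x) * r x)) \<partial>lborel)"
    if "\<theta> > 0" for s \<theta>
  proof -
    have "(\<integral>\<^sup>+x. exp (- \<theta> * x) \<partial>D s) = (\<integral>\<^sup>+x. ennreal (max 0 (s * (exp (- \<theta> * x) * r x))) \<partial>lborel)"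
      unfolding D_def
      by (subst nn_integral_density)
        (auto intro!: nn_integral_cong simp: ennreal_mult''[symmetric] max_mult_distrib_right ac_simps)
    also have "\<dots> = ennreal (\<integral>x. max 0 (s * (exp (- \<theta> * x) * r x)) \<partial>lborel)"
      using i(1)[OF that] by (intro nn_integral_eq_integral integrable_max) auto
    finally show ?thesis .
  qed
  have "D 1 = D (-1)"
  proof (rule measure_eqI_laplace)
    have "AE x in D s. 0 \<le> x" for s
      unfolding D_def by (subst AE_density) (auto, auto simp: r_def indicator_def)
    then show "AE x in D 1. 0 \<le> x" "AE x in D (-1). 0 \<le> x" by blast+
    fix \<theta> :: real assume \<theta>: "\<theta> > 0"
    show "(\<integral>\<^sup>+x. exp (- \<theta> * x) \<partial>D 1) < \<infinity>" unfolding D[OF \<theta>] by simp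
    have "(\<integral>x. max 0 (1 * (exp (- \<theta> * x) * r x)) \<partial>lborel) - (\<integral>x. max 0 (-1 * (exp (- \<theta> * x) * r x)) \<partial>lborel)
      = (\<integral>x. max 0 (1 * (exp (- \<theta> * x) * r x)) - max 0 (-1 * (exp (- \<theta> * x) * r x)) \<partial>lborel)"
      using i(1)[OF \<theta>] by (intro Bochner_Integration.integral_diff[symmetric] integrable_max) auto
    also have "\<dots> = (\<integral>x. exp (- \<theta> * x) * r x \<partial>lborel)"
      by (intro Bochner_Integration.integral_cong) auto
    finally show "(\<integral>\<^sup>+x. exp (- \<theta> * x) \<partial>D 1) = (\<integral>\<^sup>+x. exp (- \<theta> * x) \<partial>D (-1))"
      unfolding D[OF \<theta>] using i(2)[OF \<theta>] by simp
  qed (simp_all add: D_def)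
  then have "AE x in lborel. ennreal (max 0 (1 * r x)) = ennreal (max 0 (-1 * r x))"
    unfolding D_def by (subst (asm) sigma_finite_measure.density_unique_iff[OF sigma_finite_lborel]) auto
  then show ?thesis
  proof eventually_elim
    case (elim x)
    then have "max 0 (r x) = max 0 (- r x)" by (subst (asm) ennreal_inj) auto
    then have "r x = 0" by linarith
    then show ?case by (auto simp: r_def)
  qed
qed

section \<open>Convolution on the half-line and differentiation under the integral\<close>

definition conv :: "(real \<Rightarrow> real) \<Rightarrow> (real \<Rightarrow> real) \<Rightarrow> real \<Rightarrow> real" where
  "conv p q y = (LBINT z:{0<..<y}. p (y - z) * q z)"

lemma integrable_conv:
  fixes p q :: "real \<Rightarrow> real"
  assumes p: "integrable lborel p" and q: "integrable lborel q"
  shows "AE y in lborel. integrable lborel (\<lambda>z. p (y - z) * q z)"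
    and "integrable lborel (\<lambda>y. \<integral>z. p (y - z) * q z \<partial>lborel)"
    and "(\<integral>y. (\<integral>z. p (y - z) * q z \<partial>lborel) \<partial>lborel) = (\<integral>x. p x \<partial>lborel) * (\<integral>x. q x \<partial>lborel)"
proof -
  have [measurable]: "p \<in> borel_measurable borel" "q \<in> borel_measurable borel"
    using p q by auto
  have p_shift: "integrable lborel (\<lambda>y. p (y - z))" for z
    using lborel_integrable_real_affine[OF p, of 1 "- z"] by simp
  have p_int: "(\<integral>y. p (y - z) \<partial>lborel) = (\<integral>y. p y \<partial>lborel)"
     "(\<integral>y. \<bar>p (y - z)\<bar> \<partial>lborel) = (\<integral>y. \<bar>p y\<bar> \<partial>lborel)" for z
    using lborel_integral_real_affine[of 1 p "- z"] lborel_integral_real_affine[of 1 "\<lambda>y. \<bar>p y\<bar>" "- z"] by simp_all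
  have F: "integrable (lborel \<Otimes>\<^sub>M lborel) (\<lambda>(z, y). p (y - z) * q z)"
  proof (rule lborel_pair.Fubini_integrable)
    show "integrable lborel (\<lambda>z. \<integral>y. norm (case (z, y) of (z, y) \<Rightarrow> p (y - z) * q z) \<partial>lborel)"
      using q by (simp add: abs_mult p_int)
    show "AE z in lborel. integrable lborel (\<lambda>y. case (z, y) of (z, y) \<Rightarrow> p (y - z) * q z)"
      using p_shift by simp
  qed simp
  show "AE y in lborel. integrable lborel (\<lambda>z. p (y - z) * q z)"
    using lborel_pair.AE_integrable_snd[OF F] by simp
  show "integrable lborel (\<lambda>y. \<integral>z. p (y - z) * q z \<partial>lborel)"
    using lborel_pair.integrable_snd[OF F] by simp
  show "(\<integral>y. (\<integral>z. p (y - z) * q z \<partial>lborel) \<partial>lborel) = (\<integral>x. p x \<partial>lborel) * (\<integral>x. q x \<partial>lborel)"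
    using lborel_pair.Fubini_integral[OF F] by (simp add: p_int)
qed

text \<open>The factor exp (- \<theta> x) is multiplicative, so tilting commutes with convolution.
  Extended by zero, the tilted functions \<open>e p \<theta>\<close> and \<open>e q \<theta>\<close>
  are integrable on the line, where \<open>integrable_conv\<close> applies.\<close>

lemma laplace_conv:
  assumes p: "laplace_integrable p" and q: "laplace_integrable q"
  shows "AE y in lborel. y > 0 \<longrightarrow> set_integrable lborel {0<..<y} (\<lambda>z. p (y - z) * q z)" (is ?AE)
    and "laplace_integrable (conv p q)"
    and "\<theta> > 0 \<Longrightarrow> laplace (conv p q) \<theta> = laplace p \<theta> * laplace q \<theta>"
proof -
  define e where "e f \<theta> x = indicator {0<..} x * (exp (- \<theta> * x) * f x)" for f \<theta> and x :: real
  have shift: "e p \<theta> (y - z) * e q \<theta> z = (if y > 0 then exp (- \<theta> * y) * (indicator {0<..<y} z * (p (y - z) * q z)) else 0)" for y z \<theta>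
    by (auto simp: e_def indicator_def exp_add[symmetric] algebra_simps)
  have inner: "(\<integral>z. e p \<theta> (y - z) * e q \<theta> z \<partial>lborel) = indicator {0<..} y * (exp (- \<theta> * y) * conv p q y)" for y \<theta>
    unfolding shift by (cases "y > 0") (auto simp: conv_def set_lebesgue_integral_def)
  have i: "integrable lborel (e p \<theta>)" "integrable lborel (e q \<theta>)" if "\<theta> > 0" for \<theta>
    unfolding e_def using laplace_integrableD[OF p that] laplace_integrableD[OF q that] by auto
  have "AE y in lborel. integrable lborel (\<lambda>z. e p 1 (y - z) * e q 1 z)"
    using i by (intro integrable_conv) auto
  then show ?AE
    by eventually_elim (auto simp: shift set_integrable_def)
  show "laplace_integrable (conv p q)"
    using integrable_conv(2)[of "e p \<theta>" "e q \<theta>" for \<theta>] i inner by (simp add: laplace_integrable_def set_integrable_def)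
  show "laplace (conv p q) \<theta> = laplace p \<theta> * laplace q \<theta>" if "\<theta> > 0"
    using integrable_conv(3)[OF i[OF that]] unfolding inner
    by (simp add: laplace_def set_lebesgue_integral_def e_def)
qed

text \<open>The Lipschitz bound at \<open>t0\<close> dominates the difference quotients, so
  dominated convergence applies along every sequence tending to \<open>t0\<close>.\<close>

lemma has_real_derivative_lebesgue_integral:
  fixes f :: "real \<Rightarrow> 'a \<Rightarrow> real"
  assumes "\<epsilon> > 0" and f: "\<And>t. \<bar>t - t0\<bar> < \<epsilon> \<Longrightarrow> integrable M (f t)"
    and lip: "AE x in M. \<forall>t. \<bar>t - t0\<bar> < \<epsilon> \<longrightarrow> \<bar>f t x - f t0 x\<bar> \<le> G x * \<bar>t - t0\<bar>"
    and G: "integrable M G"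
    and D: "AE x in M. ((\<lambda>t. f t x) has_real_derivative D x) (at t0)"
    and [measurable]: "D \<in> borel_measurable M"
  shows "((\<lambda>t. \<integral>x. f t x \<partial>M) has_real_derivative (\<integral>x. D x \<partial>M)) (at t0)"
  unfolding has_field_derivative_iff
proof (subst tendsto_at_iff_sequentially, intro allI impI)
  fix s :: "nat \<Rightarrow> real" assume s: "\<forall>i. s i \<in> UNIV - {t0}" "s \<longlonglongrightarrow> t0"
  then have "eventually (\<lambda>i. \<bar>s i - t0\<bar> < \<epsilon>) sequentially"
    using \<open>\<epsilon> > 0\<close> by (auto simp: tendsto_iff dist_real_def)
  \<comment> \<open>The domination has to hold for every index, so the first \<open>N\<close> terms
    are dropped; \<open>LIMSEQ_offset\<close> restores them at the end.\<close>
  then obtain N where N: "\<And>i. \<bar>s (i + N) - t0\<bar> < \<epsilon>"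
    unfolding eventually_at_top_linorder by (meson le_add2)
  have neq: "s i \<noteq> t0" for i using s by auto
  have ft0: "integrable M (f t0)" using f[of t0] \<open>\<epsilon> > 0\<close> by simp
  have "(\<lambda>i. \<integral>x. (f (s (i + N)) x - f t0 x) / (s (i + N) - t0) \<partial>M) \<longlonglongrightarrow> (\<integral>x. D x \<partial>M)"
  proof (rule integral_dominated_convergence)
    show "integrable M G" by fact
    show "AE x in M. (\<lambda>i. (f (s (i + N)) x - f t0 x) / (s (i + N) - t0)) \<longlonglongrightarrow> D x"
      using D
    proof eventually_elim
      case (elim x)
      then have "((\<lambda>t. (f t x - f t0 x) / (t - t0)) \<longlongrightarrow> D x) (at t0)"
        by (simp add: has_field_derivative_iff)
      moreover have "filterlim (\<lambda>i. s (i + N)) (at t0) sequentially"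
        using LIMSEQ_ignore_initial_segment[OF s(2), of N] neq by (auto simp: filterlim_at)
      ultimately show ?case by (rule filterlim_compose)
    qed
    show "AE x in M. norm ((f (s (i + N)) x - f t0 x) / (s (i + N) - t0)) \<le> G x" for i
      using lip
    proof eventually_elim
      case (elim x)
      then show ?case using N[of i] neq[of "i + N"] by (auto simp: field_simps)
    qed
    show "(\<lambda>x. (f (s (i + N)) x - f t0 x) / (s (i + N) - t0)) \<in> borel_measurable M" for i
      using f[OF N[of i]] ft0 by auto
  qed simp
  also have "(\<lambda>i. \<integral>x. (f (s (i + N)) x - f t0 x) / (s (i + N) - t0) \<partial>M)
      = (\<lambda>i. (((\<integral>x. f (s (i + N)) x \<partial>M) - (\<integral>x. f t0 x \<partial>M)) / (s (i + N) - t0)))"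
    using f[OF N] ft0 by simp
  finally show "((\<lambda>t. ((\<integral>x. f t x \<partial>M) - (\<integral>x. f t0 x \<partial>M)) / (t - t0)) \<circ> s) \<longlonglongrightarrow> (\<integral>x. D x \<partial>M)"
    unfolding o_def by (rule LIMSEQ_offset)
qed

section \<open>Convolution with values in [0,\<infinity>]\<close>

text \<open>Taken over the whole line: functions on the half-line enter extended by zero, which
  restricts the range of integration to (0,y) by itself.\<close>

definition nnconv :: "(real \<Rightarrow> ennreal) \<Rightarrow> (real \<Rightarrow> ennreal) \<Rightarrow> real \<Rightarrow> ennreal" where
  "nnconv p q y = (\<integral>\<^sup>+z. p (y - z) * q z \<partial>lborel)"

lemma nnconv_measurable[measurable]:
  assumes [measurable]: "p \<in> borel_measurable borel" "q \<in> borel_measurable borel"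
  shows "nnconv p q \<in> borel_measurable borel"
  unfolding nnconv_def by measurable

text \<open>The reflection z -> y - z preserves Lebesgue null sets, so a.e. changes of the factors
  leave the value at each single \<open>y\<close> intact.\<close>

lemma nnconv_cong_AE:
  assumes [measurable]: "p \<in> borel_measurable borel" "p' \<in> borel_measurable borel"
    and "AE x in lborel. p x = p' x" "AE x in lborel. q x = q' x"
  shows "nnconv p q y = nnconv p' q' y"
proof -
  have "lborel = distr lborel borel (\<lambda>x. y - x)"
    using lborel_real_affine[of "-1" y] by (simp add: density_1)
  then have "AE x in distr lborel borel (\<lambda>x. y - x). p x = p' x"
    using assms(3) by metis
  then have "AE z in lborel. p (y - z) = p' (y - z)"
    by (subst (asm) AE_distr_iff) auto
  then show ?thesis
    unfolding nnconv_def using assms(4) by (intro nn_integral_cong_AE) auto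
qed

lemma nnconv_assoc:
  assumes [measurable]: "p \<in> borel_measurable borel" "q \<in> borel_measurable borel" "r \<in> borel_measurable borel"
  shows "nnconv (nnconv p q) r y = nnconv p (nnconv q r) y"
proof -
  have "nnconv p q (y - z) = (\<integral>\<^sup>+v. p (y - v) * q (v - z) \<partial>lborel)" for z
    unfolding nnconv_def
    by (subst nn_integral_real_affine[of _ 1 "- z"]) (auto simp: algebra_simps)
  then have "nnconv (nnconv p q) r y = (\<integral>\<^sup>+z. (\<integral>\<^sup>+v. p (y - v) * q (v - z) \<partial>lborel) * r z \<partial>lborel)"
    by (simp add: nnconv_def[of "nnconv p q"])
  also have "\<dots> = (\<integral>\<^sup>+z. (\<integral>\<^sup>+v. p (y - v) * q (v - z) * r z \<partial>lborel) \<partial>lborel)"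
    by (simp add: nn_integral_multc)
  also have "\<dots> = (\<integral>\<^sup>+v. (\<integral>\<^sup>+z. p (y - v) * q (v - z) * r z \<partial>lborel) \<partial>lborel)"
    by (rule lborel_pair.Fubini') simp
  also have "\<dots> = nnconv p (nnconv q r) y"
    by (simp add: nnconv_def mult.assoc nn_integral_cmult)
  finally show ?thesis .
qed

lemma nnconv_add_right:
  assumes [measurable]: "p \<in> borel_measurable borel" "q \<in> borel_measurable borel" "r \<in> borel_measurable borel"
  shows "nnconv p (\<lambda>x. q x + r x) y = nnconv p q y + nnconv p r y"
  unfolding nnconv_def by (simp add: distrib_left nn_integral_add)

lemma nnconv_cmult_right:
  assumes [measurable]: "p \<in> borel_measurable borel" "q \<in> borel_measurable borel"
  shows "nnconv p (\<lambda>x. c * q x) y = c * nnconv p q y"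
  unfolding nnconv_def by (subst nn_integral_cmult[symmetric]) (auto simp: ac_simps)

section \<open>The law of the linear birth process\<close>

definition yule_pmf :: "real \<Rightarrow> real \<Rightarrow> nat \<Rightarrow> real" where
  "yule_pmf lam t n = (if n = 0 then 0 else exp (- lam * t) * (1 - exp (- lam * t)) ^ (n - 1))"

text \<open>The forward Kolmogorov equations. By truncated subtraction the inflow coefficient
  \<open>real (m - 1)\<close> is zero for m = 0 as well as for m = 1.\<close>

lemma yule_pmf_has_derivative:
  "((\<lambda>t. yule_pmf lam t m) has_real_derivative
     real (m - 1) * lam * yule_pmf lam t (m - 1) - real m * lam * yule_pmf lam t m) (at t)"
proof (cases m)
  case 0
  then show ?thesis by (simp add: yule_pmf_def)
next
  case (Suc j)
  show ?thesis
  proof (cases j)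
    case 0
    then show ?thesis
      unfolding yule_pmf_def Suc by (auto intro!: derivative_eq_intros)
  next
    case (Suc i)
    define x where "x = exp (- lam * t)"
    have 1: "((\<lambda>t. exp (- lam * t)) has_real_derivative - lam * x) (at t)"
      unfolding x_def by (auto intro!: derivative_eq_intros)
    have 2: "((\<lambda>t. 1 - exp (- lam * t)) has_real_derivative lam * x) (at t)"
      unfolding x_def by (auto intro!: derivative_eq_intros)
    show ?thesis
      using DERIV_mult[OF 1 DERIV_power[OF 2, of "Suc i"]]
      unfolding yule_pmf_def \<open>m = Suc j\<close> Suc x_def[symmetric]
      by (simp add: algebra_simps)
  qed
qed

text \<open>Gronwall for the square: its derivative is 2 k D^2, at most 2 K D^2, so the weight exp
  (- 2 K t) makes it decrease from the value 0.\<close>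

lemma linear_ode_zero:
  fixes D k :: "real \<Rightarrow> real"
  assumes cont: "continuous_on {0..T} D" and "D 0 = 0" and "T \<ge> 0"
    and deriv: "\<And>t. 0 < t \<Longrightarrow> t < T \<Longrightarrow> (D has_real_derivative k t * D t) (at t)"
    and bound: "\<And>t. 0 < t \<Longrightarrow> t < T \<Longrightarrow> k t \<le> K"
  shows "D T = 0"
proof -
  let ?E = "\<lambda>t. exp (- 2 * K * t) * (D t)\<^sup>2"
  have "?E T \<le> ?E 0"
  proof (rule DERIV_nonpos_imp_decreasing_open[OF \<open>T \<ge> 0\<close>])
    fix t assume t: "0 < t" "t < T"
    have "(?E has_real_derivative 2 * exp (- 2 * K * t) * (D t)\<^sup>2 * (k t - K)) (at t)"
      by (rule derivative_eq_intros deriv t refl)+ (simp add: algebra_simps power2_eq_square)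
    moreover have "2 * exp (- 2 * K * t) * (D t)\<^sup>2 * (k t - K) \<le> 0"
      using bound[OF t] by (intro mult_nonneg_nonpos) auto
    ultimately show "\<exists>y. (?E has_real_derivative y) (at t) \<and> y \<le> 0" by blast
  qed (intro continuous_intros cont)
  then show ?thesis using \<open>D 0 = 0\<close> by (simp add: mult_le_0_iff)
qed

text \<open>The rates are given at time 0 only. The time-homogeneous transition function carries
  them to all times, which yields the forward Kolmogorov equations for \<open>q\<close>. This system
  is triangular, state m + 1 being fed by state m alone, and is solved by induction on the
  state.\<close>

lemma linear_birth_process_law:
  assumes B: "linear_birth_process M lam B" and "t \<ge> 0"
  shows "measure M {\<omega> \<in> space M. B t \<omega> = n} = yule_pmf lam t n"
proof -
  have "prob_space M" using B by (simp add: linear_birth_process_def)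
  then interpret prob_space M .
  have meas[measurable]: "B t \<in> measurable M (count_space UNIV)" if "t \<ge> 0" for t
    using B that by (simp add: linear_birth_process_def)
  have B0: "B 0 \<omega> = 1" and mono: "0 \<le> s \<Longrightarrow> s \<le> t \<Longrightarrow> B s \<omega> \<le> B t \<omega>" if "\<omega> \<in> space M" for \<omega> s t
    using B that by (auto simp: linear_birth_process_def mono_on_def)
  have ge1: "B t \<omega> \<ge> 1" if "\<omega> \<in> space M" "t \<ge> 0" for \<omega> t
    using mono[OF that(1) order_refl that(2)] B0[OF that(1)] by simp
  from B[unfolded linear_birth_process_def] obtain p :: "real \<Rightarrow> nat \<Rightarrow> nat \<Rightarrow> real" where
    "\<forall>k\<ge>1. \<forall>m\<ge>1. p 0 k m = of_bool (k = m) \<and>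
       ((\<lambda>t. p t k m) has_real_derivative birth_rate lam k m) (at_right 0)" and
    "\<forall>n (t :: nat \<Rightarrow> real) (k :: nat \<Rightarrow> nat). 0 \<le> t 0 \<and> strict_mono t \<and> (\<forall>i. 1 \<le> k i) \<longrightarrow>
       measure M {\<omega> \<in> space M. \<forall>i\<le>Suc n. B (t i) \<omega> = k i} =
       measure M {\<omega> \<in> space M. \<forall>i\<le>n. B (t i) \<omega> = k i} * p (t (Suc n) - t n) (k n) (k (Suc n))"
    by (elim conjE exE) (rule that)
  then have
    p0: "\<And>k m. k \<ge> 1 \<Longrightarrow> m \<ge> 1 \<Longrightarrow> p 0 k m = of_bool (k = m)" and
    p_deriv: "\<And>k m. k \<ge> 1 \<Longrightarrow> m \<ge> 1 \<Longrightarrow> ((\<lambda>t. p t k m) has_real_derivative birth_rate lam k m) (at_right 0)" and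
    fdd: "\<And>n (t :: nat \<Rightarrow> real) (k :: nat \<Rightarrow> nat). 0 \<le> t 0 \<Longrightarrow> strict_mono t \<Longrightarrow> (\<forall>i. 1 \<le> k i) \<Longrightarrow>
           measure M {\<omega> \<in> space M. \<forall>i\<le>Suc n. B (t i) \<omega> = k i} =
           measure M {\<omega> \<in> space M. \<forall>i\<le>n. B (t i) \<omega> = k i} * p (t (Suc n) - t n) (k n) (k (Suc n))"
    by simp_all
  define q where "q m t = measure M {\<omega> \<in> space M. B t \<omega> = m}" for m t
  \<comment> \<open>The finite-dimensional formula with \<open>n = 0\<close>, for the times s, s +
    r, s + 2 r, ... and the states k, m, m, ...; the entries after the second are fillers.\<close>
  have markov: "measure M {\<omega> \<in> space M. B s \<omega> = k \<and> B (s + r) \<omega> = m} = q k s * p r k m"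
    if "s \<ge> 0" "r > 0" "k \<ge> 1" "m \<ge> 1" for s r k m
  proof -
    have "strict_mono (\<lambda>i. s + real i * r)"
      using \<open>r > 0\<close> by (auto simp: strict_mono_def)
    from fdd[OF _ this, of "\<lambda>i. if i = 0 then k else m" 0] that
    have "measure M {\<omega> \<in> space M. \<forall>i\<le>Suc 0. B (s + real i * r) \<omega> = (if i = 0 then k else m)} =
        measure M {\<omega> \<in> space M. \<forall>i\<le>0. B (s + real i * r) \<omega> = (if i = 0 then k else m)} * p r k m"
      by simp
    moreover have "(\<forall>i\<le>Suc 0. Q i) \<longleftrightarrow> Q 0 \<and> Q 1" for Q :: "nat \<Rightarrow> bool"
      by (auto simp: le_Suc_eq)
    ultimately show ?thesis by (simp add: q_def)
  qed
  \<comment> \<open>The sum is finite because the paths are monotone.\<close>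
  have chapman: "q m (s + r) = (\<Sum>k\<in>{1..m}. q k s * p r k m)"
    if "s \<ge> 0" "r > 0" "m \<ge> 1" for s r m
  proof -
    have "{\<omega> \<in> space M. B (s + r) \<omega> = m} = (\<Union>k\<in>{1..m}. {\<omega> \<in> space M. B s \<omega> = k \<and> B (s + r) \<omega> = m})"
    proof (intro set_eqI iffI)
      fix \<omega> assume "\<omega> \<in> {\<omega> \<in> space M. B (s + r) \<omega> = m}"
      then show "\<omega> \<in> (\<Union>k\<in>{1..m}. {\<omega> \<in> space M. B s \<omega> = k \<and> B (s + r) \<omega> = m})"
        using ge1[of \<omega> s] mono[of \<omega> s "s + r"] that by simp
    qed simp
    also have "measure M \<dots> = (\<Sum>k\<in>{1..m}. measure M {\<omega> \<in> space M. B s \<omega> = k \<and> B (s + r) \<omega> = m})"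
      using that by (intro finite_measure_finite_Union) (auto simp: disjoint_family_on_def)
    also have "\<dots> = (\<Sum>k\<in>{1..m}. q k s * p r k m)"
      using that by (intro sum.cong markov) auto
    finally show ?thesis by (simp add: q_def)
  qed
  have increment: "q m (s + r) - q m s = (\<Sum>k\<in>{1..m}. q k s * (p r k m - p 0 k m))"
    if "s \<ge> 0" "r > 0" "m \<ge> 1" for s r m
  proof -
    have "(\<Sum>k\<in>{1..m}. q k s * p 0 k m) = (\<Sum>k\<in>{1..m}. if k = m then q k s else 0)"
      using that by (intro sum.cong) (auto simp: p0)
    then show ?thesis
      using that by (simp add: chapman right_diff_distrib sum_subtractf)
  qed
  have slope: "((\<lambda>r. (p r k m - p 0 k m) / r) \<longlongrightarrow> birth_rate lam k m) (at_right 0)"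
    if "k \<ge> 1" "m \<ge> 1" for k m
    using p_deriv[OF that] by (simp add: has_field_derivative_iff)
  have p_lim: "((\<lambda>r. p r k m - p 0 k m) \<longlongrightarrow> 0) (at_right 0)" if "k \<ge> 1" "m \<ge> 1" for k m
  proof -
    have "((\<lambda>r. (p r k m - p 0 k m) / r * r) \<longlongrightarrow> birth_rate lam k m * 0) (at_right 0)"
      by (intro tendsto_mult slope that tendsto_ident_at)
    moreover have "\<forall>\<^sub>F r in at_right 0. (p r k m - p 0 k m) / r * r = p r k m - p 0 k m"
      by (auto simp: eventually_at_filter)
    ultimately have "((\<lambda>r. p r k m - p 0 k m) \<longlongrightarrow> birth_rate lam k m * 0) (at_right 0)"
      by (rule Lim_transform_eventually)
    then show ?thesis by simp
  qed
  have q_bounds: "0 \<le> q m t" "q m t \<le> 1" for m t by (auto simp: q_def)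
  have right_slope: "((\<lambda>r. (q m (s + r) - q m s) / r) \<longlongrightarrow> (\<Sum>k\<in>{1..m}. q k s * birth_rate lam k m)) (at_right 0)"
    if "s \<ge> 0" "m \<ge> 1" for s m
  proof -
    have "((\<lambda>r. \<Sum>k\<in>{1..m}. q k s * ((p r k m - p 0 k m) / r)) \<longlongrightarrow> (\<Sum>k\<in>{1..m}. q k s * birth_rate lam k m)) (at_right 0)"
      using that by (intro tendsto_intros slope) auto
    moreover have "\<forall>\<^sub>F r in at_right 0. (\<Sum>k\<in>{1..m}. q k s * ((p r k m - p 0 k m) / r)) = (q m (s + r) - q m s) / r"
      using eventually_at_right_less[of 0] by eventually_elim (simp add: increment[OF that(1) _ that(2)] sum_divide_distrib)
    ultimately show ?thesis by (rule Lim_transform_eventually)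
  qed
  \<comment> \<open>As \<open>q\<close> lies in [0,1], the increment over a step \<open>r\<close>
    has a bound independent of where the step starts. The left limit is wanted because the weights
    in \<open>left_slope\<close> sit at s - r instead of s.\<close>
  have left_lim: "((\<lambda>r. q m (s - r)) \<longlongrightarrow> q m s) (at_right 0)" if "s > 0" "m \<ge> 1" for s m
  proof -
    have "((\<lambda>r. \<Sum>k\<in>{1..m}. \<bar>p r k m - p 0 k m\<bar>) \<longlongrightarrow> (\<Sum>k\<in>{1..m}. \<bar>0\<bar>)) (at_right 0)"
      using that by (intro tendsto_intros p_lim) auto
    then have lim0: "((\<lambda>r. \<Sum>k\<in>{1..m}. \<bar>p r k m - p 0 k m\<bar>) \<longlongrightarrow> 0) (at_right 0)" by simp
    have "\<forall>\<^sub>F r in at_right 0. 0 < r \<and> r < s"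
      using that by (auto simp: eventually_at_right_field)
    then have "\<forall>\<^sub>F r in at_right 0. norm (q m (s - r) - q m s) \<le> (\<Sum>k\<in>{1..m}. \<bar>p r k m - p 0 k m\<bar>)"
    proof eventually_elim
      case (elim r)
      then have "q m s - q m (s - r) = (\<Sum>k\<in>{1..m}. q k (s - r) * (p r k m - p 0 k m))"
        using increment[of "s - r" r m] that by simp
      also have "\<bar>\<dots>\<bar> \<le> (\<Sum>k\<in>{1..m}. \<bar>q k (s - r) * (p r k m - p 0 k m)\<bar>)"
        by (rule sum_abs)
      also have "\<dots> \<le> (\<Sum>k\<in>{1..m}. \<bar>p r k m - p 0 k m\<bar>)"
        using q_bounds by (intro sum_mono) (auto simp: abs_mult intro!: mult_left_le_one_le)
      finally show ?case by (simp add: abs_minus_commute)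
    qed
    from tendsto_0_le[OF lim0, of "\<lambda>r. q m (s - r) - q m s" 1] this show ?thesis
      by (simp add: LIM_zero_iff)
  qed
  have left_slope: "((\<lambda>r. (q m s - q m (s - r)) / r) \<longlongrightarrow> (\<Sum>k\<in>{1..m}. q k s * birth_rate lam k m)) (at_right 0)"
    if "s > 0" "m \<ge> 1" for s m
  proof -
    have "((\<lambda>r. \<Sum>k\<in>{1..m}. q k (s - r) * ((p r k m - p 0 k m) / r)) \<longlongrightarrow> (\<Sum>k\<in>{1..m}. q k s * birth_rate lam k m)) (at_right 0)"
      using that by (intro tendsto_intros slope left_lim) auto
    moreover have "\<forall>\<^sub>F r in at_right 0. 0 < r \<and> r < s"
      using that by (auto simp: eventually_at_right_field)
    then have "\<forall>\<^sub>F r in at_right 0. (\<Sum>k\<in>{1..m}. q k (s - r) * ((p r k m - p 0 k m) / r)) = (q m s - q m (s - r)) / r"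
    proof eventually_elim
      case (elim r)
      then show ?case using increment[of "s - r" r m] that by (simp add: sum_divide_distrib)
    qed
    ultimately show ?thesis by (rule Lim_transform_eventually)
  qed
  have right: "(q m has_real_derivative (\<Sum>k\<in>{1..m}. q k s * birth_rate lam k m)) (at_right s)"
    if "s \<ge> 0" "m \<ge> 1" for s m
  proof -
    have "((\<lambda>t. (q m t - q m s) / (t - s)) \<longlongrightarrow> (\<Sum>k\<in>{1..m}. q k s * birth_rate lam k m)) (at_right s)"
      by (subst filterlim_at_right_to_0) (use right_slope[OF that] in \<open>simp add: add.commute\<close>)
    then show ?thesis by (simp only: has_field_derivative_iff)
  qed
  have left: "(q m has_real_derivative (\<Sum>k\<in>{1..m}. q k s * birth_rate lam k m)) (at_left s)"
    if "s > 0" "m \<ge> 1" for s m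
  proof -
    have eq: "(q m (- (r + - s)) - q m s) / (- (r + - s) - s) = (q m s - q m (s - r)) / r" for r
      by (cases "r = 0") (simp_all add: field_simps)
    have "((\<lambda>t. (q m t - q m s) / (t - s)) \<longlongrightarrow> (\<Sum>k\<in>{1..m}. q k s * birth_rate lam k m)) (at_left s)"
      by (subst filterlim_at_left_to_right, subst filterlim_at_right_to_0) (simp only: eq left_slope[OF that])
    then show ?thesis by (simp only: has_field_derivative_iff)
  qed
  have deriv: "(q m has_real_derivative (\<Sum>k\<in>{1..m}. q k s * birth_rate lam k m)) (at s)"
    if "s > 0" "m \<ge> 1" for s m
    using left[OF that] right[OF less_imp_le[OF that(1)] that(2)]
    unfolding has_field_derivative_iff by (rule filterlim_split_at)
  \<comment> \<open>For m = 1 the inflow index 0 lies outside \<open>{1..m}\<close>, in agreement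
    with the coefficient \<open>real (m - 1)\<close> being 0.\<close>
  have rate: "(\<Sum>k\<in>{1..m}. q k s * birth_rate lam k m) = real (m - 1) * lam * q (m - 1) s - real m * lam * q m s"
    if "m \<ge> 1" for s m
  proof -
    have "(\<Sum>k\<in>{1..m}. q k s * birth_rate lam k m)
       = (\<Sum>k\<in>{1..m}. (if k = m - 1 then q k s * (real k * lam) else 0) - (if k = m then q k s * (real k * lam) else 0))"
      using that by (intro sum.cong) (auto simp: birth_rate_def)
    also have "\<dots> = (if m - 1 \<in> {1..m} then q (m - 1) s * (real (m - 1) * lam) else 0) - q m s * (real m * lam)"
      using that by (simp add: sum_subtractf sum.delta')
    finally show ?thesis using that by (cases "m = 1") auto
  qed
  have "q m t = yule_pmf lam t m" if "t \<ge> 0" for m t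
    using that
  proof (induction m arbitrary: t)
    case 0
    then have "{\<omega> \<in> space M. B t \<omega> = 0} = {}" using ge1 by force
    then show ?case by (simp only: q_def yule_pmf_def) simp
  next
    case (Suc m)
    \<comment> \<open>By the induction hypothesis both functions have the same inflow from state m.
      It cancels in the difference, leaving D' = - (m + 1) lam D.\<close>
    define D where "D t = q (Suc m) t - yule_pmf lam t (Suc m)" for t
    have "D t = 0"
    proof (rule linear_ode_zero[where D=D and T=t and k="\<lambda>_. - (real (Suc m) * lam)" and K="- (real (Suc m) * lam)"])
      have *: "(D has_real_derivative - (real (Suc m) * lam) * D s) (at s within S)"
        if "s \<ge> 0" and q': "(q (Suc m) has_real_derivative (\<Sum>k\<in>{1..Suc m}. q k s * birth_rate lam k (Suc m))) (at s within S)"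
        for s S
      proof -
        have "(\<Sum>k\<in>{1..Suc m}. q k s * birth_rate lam k (Suc m)) =
            real m * lam * yule_pmf lam s m - real (Suc m) * lam * q (Suc m) s"
          by (subst rate) (simp_all add: Suc.IH[OF \<open>s \<ge> 0\<close>])
        then have eq: "(\<Sum>k\<in>{1..Suc m}. q k s * birth_rate lam k (Suc m))
            - (real (Suc m - 1) * lam * yule_pmf lam s (Suc m - 1) - real (Suc m) * lam * yule_pmf lam s (Suc m))
            = - (real (Suc m) * lam) * D s"
          unfolding D_def diff_Suc_1 by (simp add: ring_distribs del: of_nat_Suc)
        show ?thesis
          unfolding eq[symmetric] unfolding D_def
          by (intro DERIV_diff q' DERIV_subset[OF yule_pmf_has_derivative subset_UNIV])
      qed
      show "(D has_real_derivative - (real (Suc m) * lam) * D s) (at s)" if "s > 0" for s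
        using *[OF _ deriv] that by simp
      \<comment> \<open>At 0 there is only a right derivative, hence the case distinction.\<close>
      have "continuous_on {0..} D"
        unfolding continuous_on_eq_continuous_within
      proof
        fix s :: real assume "s \<in> {0..}"
        show "continuous (at s within {0..}) D"
        proof (cases "s = 0")
          case True
          then have "continuous (at_right 0) D"
            using *[OF _ right, of 0] by (auto intro: DERIV_continuous)
          then show ?thesis using True at_within_Ici_at_right[of "0::real"] by simp
        next
          case False
          then have "continuous (at s) D"
            using *[OF _ deriv, of s] \<open>s \<in> {0..}\<close> by (auto intro: DERIV_continuous)
          then show ?thesis by (rule continuous_at_imp_continuous_at_within)
        qed
      qed
      then show "continuous_on {0..t} D"
        by (rule continuous_on_subset) auto
      have "q (Suc m) 0 = of_bool (m = 0)"
      proof -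
        have "{\<omega> \<in> space M. B 0 \<omega> = Suc m} = (if m = 0 then space M else {})"
          using B0 by auto
        then show ?thesis by (simp add: q_def prob_space)
      qed
      then show "D 0 = 0" by (simp add: D_def yule_pmf_def)
    qed (use Suc.prems in auto)
    then show ?case by (simp add: D_def)
  qed
  then show ?thesis using \<open>t \<ge> 0\<close> by (simp add: q_def)
qed

section \<open>Subordinators at an exponential time\<close>

locale subordinated =
  fixes S :: bernstein and P :: "'b measure" and A :: "real \<Rightarrow> 'b \<Rightarrow> real" and h :: "real \<Rightarrow> real \<Rightarrow> real"
  assumes wf: "wf_bernstein S"
    and subordinator: "subordinator P (bernstein_fun S) A"
    and density: "subordinator_density S P A h"
begin

abbreviation g :: "real \<Rightarrow> real" where "g \<equiv> bernstein_fun S"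

text \<open>The disintegration \<open>P (A s \<in> dy) ds = kernel y (ds) dy\<close>, which treats the trivial case,
  where \<open>A\<close> has no density, on the same footing as the others.\<close>

definition kernel :: "real \<Rightarrow> real measure" where
  "kernel y = (case S of Drift \<Rightarrow> return borel y
     | Levy N \<Rightarrow> Nonnegative_Lebesgue_Integration.density lborel (\<lambda>s. indicator {0<..} s * ennreal (h y s)))"

text \<open>\<open>moment a 0\<close> is the a-potential density of the subordinator; the higher
  moments are, up to sign, its derivatives in \<open>a\<close>.\<close>

definition moment :: "real \<Rightarrow> nat \<Rightarrow> real \<Rightarrow> real" where
  "moment a k y = (\<integral>s. s ^ k * exp (- a * s) \<partial>kernel y)"

lemma g_nonneg: "\<theta> \<ge> 0 \<Longrightarrow> g \<theta> \<ge> 0"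
proof (cases S)
  case (Levy N)
  assume "\<theta> \<ge> 0"
  have N: "levy_measure N" using wf Levy by simp
  have "AE s in N. s > 0"
    using N by (intro AE_I[of _ _ "{..0}"]) (auto simp: levy_measure_def not_less)
  then have "0 \<le> (\<integral>s. 1 - exp (- \<theta> * s) \<partial>N)"
    using \<open>\<theta> \<ge> 0\<close> by (intro integral_nonneg_AE) (auto elim!: eventually_mono)
  then show ?thesis by (simp add: Levy)
qed simp

lemma g_zero: "g 0 = 0"
  by (cases S) auto

lemma h_measurable:
  assumes "S = Levy N"
  shows "(\<lambda>p. indicator {0<..} (snd p) * ennreal (h (fst p) (snd p))) \<in> borel_measurable (borel \<Otimes>\<^sub>M borel)"
proof -
  have "(\<lambda>p. indicator (UNIV \<times> {0<..}) p *\<^sub>R (case p of (x, t) \<Rightarrow> h x t)) \<in> borel_measurable (borel \<Otimes>\<^sub>M borel)"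
    using density by (simp add: assms set_borel_measurable_def)
  from measurable_compose[OF this measurable_ennreal] show ?thesis
    by (rule measurable_cong[THEN iffD1, rotated]) (auto simp: indicator_def)
qed

lemma h_nonneg: "S = Levy N \<Longrightarrow> t > 0 \<Longrightarrow> h x t \<ge> 0"
  using density by simp

text \<open>The paths start at 0 and increase, so the law of \<open>A t\<close> does not charge the
  negative axis and the integral may be restricted to the half-line. At \<theta> = 0 the formula
  says that the total mass is 1.\<close>

lemma transform:
  assumes S: "S = Levy N" and "t > 0" "\<theta> \<ge> 0"
  shows "(\<integral>\<^sup>+y. indicator {0<..} y * ennreal (exp (- \<theta> * y)) * ennreal (h y t) \<partial>lborel) = ennreal (exp (- g \<theta> * t))"
proof -
  have "prob_space P" using subordinator by (simp add: subordinator_def)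
  then interpret P: prob_space P .
  have D: "distributed P lborel (A t) (\<lambda>x. ennreal (h x t))"
    using density \<open>t > 0\<close> by (simp add: S)
  have [measurable]: "A t \<in> borel_measurable P" "(\<lambda>x. ennreal (h x t)) \<in> borel_measurable borel"
    using D by (auto simp: distributed_def)
  have pos: "A t \<omega> \<ge> 0" if "\<omega> \<in> space P" for \<omega>
  proof -
    have "A 0 \<omega> = 0" "mono_on {0..} (\<lambda>t. A t \<omega>)"
      using subordinator that by (auto simp: subordinator_def)
    then show ?thesis using \<open>t > 0\<close> mono_onD[of "{0..}" "\<lambda>t. A t \<omega>" 0 t] by auto
  qed
  have exp: "P.expectation (\<lambda>\<omega>. exp (- \<theta> * A t \<omega>)) = exp (- g \<theta> * t)"
  proof (cases "\<theta> = 0")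
    case True
    then show ?thesis by (simp add: g_zero P.prob_space)
  next
    case False
    then show ?thesis using subordinator \<open>\<theta> \<ge> 0\<close> \<open>t > 0\<close> by (simp add: subordinator_def)
  qed
  have "(\<integral>\<^sup>+y. ennreal (h y t) * indicator {..<0} y \<partial>lborel) = (\<integral>\<^sup>+\<omega>. indicator {..<0} (A t \<omega>) \<partial>P)"
    by (rule distributed_nn_integral[OF D]) simp
  also have "\<dots> = 0"
    using pos by (intro nn_integral_zero') (auto simp: indicator_def intro!: AE_I2 dest: pos)
  finally have "AE y in lborel. ennreal (h y t) * indicator {..<0} y = 0"
    by (subst (asm) nn_integral_0_iff_AE) auto
  then have "AE y in lborel. indicator {0<..} y * ennreal (exp (- \<theta> * y)) * ennreal (h y t) = ennreal (h y t) * ennreal (exp (- \<theta> * y))"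
    using AE_lborel_singleton[of 0]
    by eventually_elim (auto simp: indicator_def mult.commute split: if_splits)
  then have "(\<integral>\<^sup>+y. indicator {0<..} y * ennreal (exp (- \<theta> * y)) * ennreal (h y t) \<partial>lborel)
      = (\<integral>\<^sup>+y. ennreal (h y t) * ennreal (exp (- \<theta> * y)) \<partial>lborel)"
    by (rule nn_integral_cong_AE)
  also have "\<dots> = (\<integral>\<^sup>+\<omega>. ennreal (exp (- \<theta> * A t \<omega>)) \<partial>P)"
    by (rule distributed_nn_integral[OF D]) simp
  also have "\<dots> = ennreal (exp (- g \<theta> * t))"
    unfolding exp[symmetric]
    by (intro nn_integral_eq_integral P.integrable_const_bound[of _ 1]) (use pos \<open>\<theta> \<ge> 0\<close> in auto)
  finally show ?thesis .
qed

lemma sets_kernel[simp, measurable_cong]: "sets (kernel y) = sets borel"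
  by (simp add: kernel_def split: bernstein.split)

lemma kernel_Drift: "S = Drift \<Longrightarrow> kernel y = return borel y"
  unfolding kernel_def by simp

lemma kernel_Levy:
  "S = Levy N \<Longrightarrow> kernel y = Nonnegative_Lebesgue_Integration.density lborel (\<lambda>s. indicator {0<..} s * ennreal (h y s))"
  unfolding kernel_def by simp

lemma h_measurable_time:
  assumes "S = Levy N"
  shows "(\<lambda>s. indicator {0<..} s * ennreal (h y s)) \<in> borel_measurable borel"
  using measurable_compose[OF measurable_Pair1' h_measurable[OF assms], of y] by simp

lemma nn_integral_kernel_Drift:
  assumes "S = Drift" "w \<in> borel_measurable borel"
  shows "(\<integral>\<^sup>+s. w s \<partial>kernel y) = w y"
  unfolding kernel_Drift[OF assms(1)] using assms(2) by (simp add: nn_integral_return)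

lemma nn_integral_kernel_Levy:
  assumes S: "S = Levy N" and [measurable]: "w \<in> borel_measurable borel"
  shows "(\<integral>\<^sup>+s. w s \<partial>kernel y) = (\<integral>\<^sup>+s. indicator {0<..} s * ennreal (h y s) * w s \<partial>lborel)"
  unfolding kernel_Levy[OF S] using h_measurable_time[OF S]
  by (subst nn_integral_density) simp_all

lemma nn_integral_kernel_measurable[measurable]:
  assumes [measurable]: "w \<in> borel_measurable borel"
  shows "(\<lambda>y. \<integral>\<^sup>+s. w s \<partial>kernel y) \<in> borel_measurable borel"
proof (cases S)
  case Drift
  show ?thesis unfolding nn_integral_kernel_Drift[OF Drift assms] by (rule assms)
next
  case (Levy N)
  note [measurable] = h_measurable[OF Levy]
  have "(\<lambda>p. indicator {0<..} (snd p) * ennreal (h (fst p) (snd p)) * w (snd p)) \<in> borel_measurable (borel \<Otimes>\<^sub>M lborel)"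
    by measurable
  then have "(\<lambda>(y, s). indicator {0<..} s * ennreal (h y s) * w s) \<in> borel_measurable (borel \<Otimes>\<^sub>M lborel)"
    by (simp add: split_beta')
  from lborel.borel_measurable_nn_integral[OF this]
  show ?thesis unfolding nn_integral_kernel_Levy[OF Levy assms] .
qed

lemma AE_kernel_pos:
  assumes "y > 0"
  shows "AE s in kernel y. s > 0"
proof (cases S)
  case Drift
  then show ?thesis unfolding kernel_Drift[OF Drift] using assms by (subst AE_return) auto
next
  case (Levy N)
  show ?thesis
    unfolding kernel_Levy[OF Levy] using h_measurable_time[OF Levy, of y]
    by (subst AE_density) (auto simp: indicator_def)
qed

text \<open>By Tonelli: for fixed time s, integrating over y produces the Laplace transform exp (- g
  \<theta> s) of \<open>A s\<close>. With a power times an exponential for \<open>w\<close> it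
  yields all transforms of moments.\<close>

lemma kernel_transform:
  assumes [measurable]: "w \<in> borel_measurable borel" and "\<theta> \<ge> 0"
  shows "(\<integral>\<^sup>+y. indicator {0<..} y * ennreal (exp (- \<theta> * y)) * (\<integral>\<^sup>+s. w s \<partial>kernel y) \<partial>lborel)
    = (\<integral>\<^sup>+s. indicator {0<..} s * ennreal (exp (- g \<theta> * s)) * w s \<partial>lborel)"
proof (cases S)
  case Drift
  show ?thesis
    unfolding nn_integral_kernel_Drift[OF Drift assms(1)] by (simp add: Drift)
next
  case (Levy N)
  note [measurable] = h_measurable[OF Levy]
  have [measurable]: "(\<lambda>y. ennreal (h y s)) \<in> borel_measurable borel" if "s > 0" for s
    using measurable_compose[OF measurable_Pair2' h_measurable[OF Levy], of s] that by simp
  have [measurable]: "(\<lambda>s. indicator {0<..} s * ennreal (h y s)) \<in> borel_measurable borel" for y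
    by (rule h_measurable_time[OF Levy])
  have "(\<integral>\<^sup>+y. indicator {0<..} y * ennreal (exp (- \<theta> * y)) * (\<integral>\<^sup>+s. w s \<partial>kernel y) \<partial>lborel)
    = (\<integral>\<^sup>+y. (\<integral>\<^sup>+s. indicator {0<..} y * ennreal (exp (- \<theta> * y)) * (indicator {0<..} s * ennreal (h y s) * w s) \<partial>lborel) \<partial>lborel)"
    unfolding nn_integral_kernel_Levy[OF Levy assms(1)] by (simp add: nn_integral_cmult)
  also have "\<dots> = (\<integral>\<^sup>+s. (\<integral>\<^sup>+y. indicator {0<..} y * ennreal (exp (- \<theta> * y)) * (indicator {0<..} s * ennreal (h y s) * w s) \<partial>lborel) \<partial>lborel)"
  proof (rule lborel_pair.Fubini'[symmetric])
    have "(\<lambda>p. indicator {0<..} (fst p) * ennreal (exp (- \<theta> * fst p)) * (indicator {0<..} (snd p) * ennreal (h (fst p) (snd p)) * w (snd p)))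
      \<in> borel_measurable (lborel \<Otimes>\<^sub>M lborel)"
      by measurable
    then show "(\<lambda>(y, s). indicator {0<..} y * ennreal (exp (- \<theta> * y)) * (indicator {0<..} s * ennreal (h y s) * w s))
      \<in> borel_measurable (lborel \<Otimes>\<^sub>M lborel)"
      by (simp add: split_beta')
  qed
  also have "\<dots> = (\<integral>\<^sup>+s. indicator {0<..} s * ennreal (exp (- g \<theta> * s)) * w s \<partial>lborel)"
  proof (rule nn_integral_cong)
    fix s :: real
    show "(\<integral>\<^sup>+y. indicator {0<..} y * ennreal (exp (- \<theta> * y)) * (indicator {0<..} s * ennreal (h y s) * w s) \<partial>lborel)
      = indicator {0<..} s * ennreal (exp (- g \<theta> * s)) * w s"
    proof (cases "s > 0")
      case True
      have "(\<integral>\<^sup>+y. indicator {0<..} y * ennreal (exp (- \<theta> * y)) * (indicator {0<..} s * ennreal (h y s) * w s) \<partial>lborel)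
        = (\<integral>\<^sup>+y. (indicator {0<..} y * ennreal (exp (- \<theta> * y)) * ennreal (h y s)) * w s \<partial>lborel)"
        using True by (intro nn_integral_cong) (simp add: ac_simps)
      also have "\<dots> = ennreal (exp (- g \<theta> * s)) * w s"
        using True by (subst nn_integral_multc) (simp_all only: transform[OF Levy True \<open>\<theta> \<ge> 0\<close>], measurable)
      finally show ?thesis using True by simp
    qed simp
  qed
  finally show ?thesis .
qed

text \<open>At \<theta> = 0, where \<open>g\<close> vanishes, \<open>kernel_transform\<close> shows
  that the integral over y is finite, hence so is the integrand a.e., for each \<open>k\<close> and
  each a = 1/(n+1). The union of these countably many null sets serves every a > 0, because the
  integrand decreases in a.\<close>

lemma AE_kernel_integrable:
  "AE y in lborel. y > 0 \<longrightarrow> (\<forall>a>0. \<forall>k. integrable (kernel y) (\<lambda>s. s ^ k * exp (- a * s)))"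
proof -
  have "AE y in lborel. \<forall>k::nat. \<forall>n::nat. y > 0 \<longrightarrow>
      (\<integral>\<^sup>+s. ennreal (s ^ k * exp (- (1 / real (Suc n)) * s)) \<partial>kernel y) < \<infinity>"
  proof (intro AE_all_countable[THEN iffD2] allI)
    fix k n :: nat
    have "(\<integral>\<^sup>+y. indicator {0<..} y * ennreal (exp (- 0 * y)) * (\<integral>\<^sup>+s. ennreal (s ^ k * exp (- (1 / real (Suc n)) * s)) \<partial>kernel y) \<partial>lborel)
      = (\<integral>\<^sup>+s. indicator {0<..} s * ennreal (exp (- g 0 * s)) * ennreal (s ^ k * exp (- (1 / real (Suc n)) * s)) \<partial>lborel)"
      by (rule kernel_transform) auto
    also have "\<dots> = (\<integral>\<^sup>+s. indicator {0<..} s * ennreal (s ^ k * exp (- (1 / real (Suc n)) * s)) \<partial>lborel)"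
      by (simp add: g_zero)
    also have "\<dots> = ennreal (fact k / (1 / real (Suc n)) ^ Suc k)"
      by (rule nn_integral_power_exp) simp
    finally have "(\<integral>\<^sup>+y. indicator {0<..} y * ennreal (exp (- 0 * y)) * (\<integral>\<^sup>+s. ennreal (s ^ k * exp (- (1 / real (Suc n)) * s)) \<partial>kernel y) \<partial>lborel) \<noteq> \<infinity>"
      by simp
    then have "AE y in lborel. indicator {0<..} y * ennreal (exp (- 0 * y)) * (\<integral>\<^sup>+s. ennreal (s ^ k * exp (- (1 / real (Suc n)) * s)) \<partial>kernel y) \<noteq> \<infinity>"
      by (intro nn_integral_PInf_AE) auto
    then show "AE y in lborel. y > 0 \<longrightarrow> (\<integral>\<^sup>+s. ennreal (s ^ k * exp (- (1 / real (Suc n)) * s)) \<partial>kernel y) < \<infinity>"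
      by eventually_elim (auto simp: less_top)
  qed
  then show ?thesis
  proof eventually_elim
    case (elim y)
    show ?case
    proof (intro impI allI)
      fix a :: real and k :: nat assume "y > 0" "a > 0"
      obtain n :: nat where n: "1 / real (Suc n) < a"
        using \<open>a > 0\<close> nat_approx_posE by blast
      have fin: "(\<integral>\<^sup>+s. ennreal (s ^ k * exp (- (1 / real (Suc n)) * s)) \<partial>kernel y) < \<infinity>"
        using elim \<open>y > 0\<close> by blast
      have "integrable (kernel y) (\<lambda>s. s ^ k * exp (- (1 / real (Suc n)) * s))"
        using AE_kernel_pos[OF \<open>y > 0\<close>] fin
        by (intro integrableI_nonneg) (auto elim!: eventually_mono simp: measurable_cong_sets[OF sets_kernel refl])
      then show "integrable (kernel y) (\<lambda>s. s ^ k * exp (- a * s))"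
      proof (rule Bochner_Integration.integrable_bound)
        show "AE s in kernel y. norm (s ^ k * exp (- a * s)) \<le> norm (s ^ k * exp (- (1 / real (Suc n)) * s))"
          using AE_kernel_pos[OF \<open>y > 0\<close>]
        proof eventually_elim
          case (elim s)
          then have "1 / real (Suc n) * s \<le> a * s" using n by (intro mult_right_mono) auto
          then show ?case using elim by (simp add: abs_mult mult_left_mono)
        qed
      qed (simp add: measurable_cong_sets[OF sets_kernel refl])
    qed
  qed
qed

lemma moment_eq_enn2real:
  assumes "y > 0"
  shows "moment a k y = enn2real (\<integral>\<^sup>+s. ennreal (s ^ k * exp (- a * s)) \<partial>kernel y)"
  unfolding moment_def using AE_kernel_pos[OF assms]
  by (intro integral_eq_nn_integral) (auto elim!: eventually_mono simp: measurable_cong_sets[OF sets_kernel refl])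

lemma moment_nonneg: "y > 0 \<Longrightarrow> moment a k y \<ge> 0"
  by (simp add: moment_eq_enn2real)

lemma moment_measurable: "(\<lambda>y. indicator {0<..} y * moment a k y) \<in> borel_measurable borel"
proof -
  have "(\<lambda>y. indicator {0<..} y * enn2real (\<integral>\<^sup>+s. ennreal (s ^ k * exp (- a * s)) \<partial>kernel y)) \<in> borel_measurable borel"
    by measurable
  also have "(\<lambda>y. indicator {0<..} y * enn2real (\<integral>\<^sup>+s. ennreal (s ^ k * exp (- a * s)) \<partial>kernel y))
      = (\<lambda>y. indicator {0<..} y * moment a k y)"
    by (auto simp: fun_eq_iff indicator_def moment_eq_enn2real)
  finally show ?thesis .
qed

text \<open>A Gamma integral, once \<open>kernel_transform\<close> has moved it to the time
  variable. The case \<theta> = 0 is integrability on the half-line itself, as the class of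
  solutions demands.\<close>

lemma laplace_moment:
  assumes "a > 0" "\<theta> \<ge> 0"
  shows "set_integrable lborel {0<..} (\<lambda>y. exp (- \<theta> * y) * moment a k y)"
    and "laplace (moment a k) \<theta> = fact k / (a + g \<theta>) ^ Suc k"
proof -
  have ag: "a + g \<theta> > 0" using g_nonneg[OF assms(2)] assms(1) by simp
  have "(\<integral>\<^sup>+y. indicator {0<..} y * ennreal (exp (- \<theta> * y) * moment a k y) \<partial>lborel)
    = (\<integral>\<^sup>+y. indicator {0<..} y * ennreal (exp (- \<theta> * y)) * (\<integral>\<^sup>+s. ennreal (s ^ k * exp (- a * s)) \<partial>kernel y) \<partial>lborel)"
  proof (rule nn_integral_cong_AE)
    show "AE y in lborel. indicator {0<..} y * ennreal (exp (- \<theta> * y) * moment a k y)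
      = indicator {0<..} y * ennreal (exp (- \<theta> * y)) * (\<integral>\<^sup>+s. ennreal (s ^ k * exp (- a * s)) \<partial>kernel y)"
      using AE_kernel_integrable
    proof eventually_elim
      case (elim y)
      show ?case
      proof (cases "y > 0")
        case True
        then have "(\<integral>\<^sup>+s. ennreal (s ^ k * exp (- a * s)) \<partial>kernel y) = ennreal (moment a k y)"
          unfolding moment_def using AE_kernel_pos[OF True] elim assms
          by (intro nn_integral_eq_integral) (auto elim!: eventually_mono)
        then show ?thesis using True by (simp add: ennreal_mult')
      qed simp
    qed
  qed
  also have "\<dots> = (\<integral>\<^sup>+s. indicator {0<..} s * ennreal (exp (- g \<theta> * s)) * ennreal (s ^ k * exp (- a * s)) \<partial>lborel)"
    by (rule kernel_transform) (use assms in auto)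
  also have "\<dots> = (\<integral>\<^sup>+s. indicator {0<..} s * ennreal (s ^ k * exp (- (a + g \<theta>) * s)) \<partial>lborel)"
    by (intro nn_integral_cong) (auto simp: indicator_def ennreal_mult'[symmetric] exp_add[symmetric] algebra_simps)
  also have "\<dots> = ennreal (fact k / (a + g \<theta>) ^ Suc k)"
    by (rule nn_integral_power_exp[OF ag])
  finally have eq: "(\<integral>\<^sup>+y. indicator {0<..} y * ennreal (exp (- \<theta> * y) * moment a k y) \<partial>lborel)
    = ennreal (fact k / (a + g \<theta>) ^ Suc k)" .
  have "fact k / (a + g \<theta>) ^ Suc k \<ge> 0" using ag by simp
  from laplace_nn[OF moment_measurable moment_nonneg this eq]
  show "set_integrable lborel {0<..} (\<lambda>y. exp (- \<theta> * y) * moment a k y)"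
    "laplace (moment a k) \<theta> = fact k / (a + g \<theta>) ^ Suc k" by auto
qed

lemma laplace_integrable_moment: "a > 0 \<Longrightarrow> laplace_integrable (moment a k)"
  unfolding laplace_integrable_def using laplace_moment(1) by auto

lemma moment_has_derivative:
  assumes int: "\<forall>a>0. \<forall>k. integrable (kernel y) (\<lambda>s. s ^ k * exp (- a * s))"
    and "y > 0" "a > 0"
  shows "((\<lambda>a. moment a 0 y) has_real_derivative - moment a 1 y) (at a)"
proof -
  have "((\<lambda>a. \<integral>s. s ^ 0 * exp (- a * s) \<partial>kernel y) has_real_derivative (\<integral>s. - (s ^ 1 * exp (- a * s)) \<partial>kernel y)) (at a)"
  \<comment> \<open>Within distance a/2 of \<open>a\<close> the parameter stays above a/2, where the
    derivative of the integrand is at most s exp (- (a/2) s) in absolute value; hence this radius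
    and this bound.\<close>
  proof (rule has_real_derivative_lebesgue_integral[where \<epsilon>="a / 2" and G="\<lambda>s. s ^ 1 * exp (- (a / 2) * s)"])
    show "integrable (kernel y) (\<lambda>s. s ^ 0 * exp (- t * s))" if "\<bar>t - a\<bar> < a / 2" for t
    proof -
      have "t > 0" using that \<open>a > 0\<close> by linarith
      then show ?thesis using int by blast
    qed
    show "AE s in kernel y. \<forall>t. \<bar>t - a\<bar> < a / 2 \<longrightarrow>
        \<bar>s ^ 0 * exp (- t * s) - s ^ 0 * exp (- a * s)\<bar> \<le> s ^ 1 * exp (- (a / 2) * s) * \<bar>t - a\<bar>"
      using AE_kernel_pos[OF \<open>y > 0\<close>]
    proof (eventually_elim, intro allI impI)
      fix s t :: real assume "s > 0" and t: "\<bar>t - a\<bar> < a / 2"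
      have "norm (exp (- t * s) - exp (- a * s)) \<le> s * exp (- (a / 2) * s) * norm (t - a)"
      proof (rule field_differentiable_bound[where S="{a / 2..}" and f="\<lambda>t. exp (- t * s)" and f'="\<lambda>t. - s * exp (- t * s)"])
        show "((\<lambda>t. exp (- t * s)) has_field_derivative - s * exp (- z * s)) (at z within {a / 2..})" for z
          by (auto intro!: derivative_eq_intros)
        show "norm (- s * exp (- z * s)) \<le> s * exp (- (a / 2) * s)" if "z \<in> {a / 2..}" for z
        proof -
          have "a / 2 * s \<le> z * s" using that \<open>s > 0\<close> by (intro mult_right_mono) auto
          then show ?thesis using \<open>s > 0\<close> by (simp add: abs_mult)
        qed
        show "t \<in> {a / 2..}" "a \<in> {a / 2..}" using t \<open>a > 0\<close> unfolding atLeast_iff by linarith+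
      qed simp
      then show "\<bar>s ^ 0 * exp (- t * s) - s ^ 0 * exp (- a * s)\<bar> \<le> s ^ 1 * exp (- (a / 2) * s) * \<bar>t - a\<bar>"
        by simp
    qed
    show "integrable (kernel y) (\<lambda>s. s ^ 1 * exp (- (a / 2) * s))"
      using int half_gt_zero[OF \<open>a > 0\<close>] by blast
    show "AE s in kernel y. ((\<lambda>t. s ^ 0 * exp (- t * s)) has_real_derivative - (s ^ 1 * exp (- a * s))) (at a)"
      by (intro AE_I2) (auto intro!: derivative_eq_intros)
  qed (use \<open>a > 0\<close> in \<open>simp_all add: measurable_cong_sets[OF sets_kernel refl]\<close>)
  then show ?thesis by (simp add: moment_def)
qed

text \<open>Holds at every y > 0: where the time integral diverges, both sides are 0, the default
  value of the Bochner integral.\<close>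

lemma addend_density_eq:
  assumes "y > 0"
  shows "addend_density S a h y = a * moment a 0 y"
proof (cases S)
  case Drift
  then show ?thesis
    unfolding moment_def kernel_Drift[OF Drift] using assms by (simp add: addend_density_def integral_return)
next
  case (Levy N)
  have m: "(\<lambda>s. indicator {0<..} s * h y s) \<in> borel_measurable borel"
  proof -
    have "(\<lambda>s. enn2real (indicator {0<..} s * ennreal (h y s))) \<in> borel_measurable borel"
      using h_measurable_time[OF Levy, of y] by measurable
    also have "(\<lambda>s. enn2real (indicator {0<..} s * ennreal (h y s))) = (\<lambda>s. indicator {0<..} s * h y s)"
      using h_nonneg[OF Levy, of _ y] by (auto simp: fun_eq_iff indicator_def)
    finally show ?thesis .
  qed
  have k: "kernel y = Nonnegative_Lebesgue_Integration.density lborel (\<lambda>s. ennreal (indicator {0<..} s * h y s))"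
    unfolding kernel_Levy[OF Levy] by (intro arg_cong[where f="Nonnegative_Lebesgue_Integration.density lborel"]) (auto simp: indicator_def)
  show ?thesis
    unfolding moment_def k
    using m h_nonneg[OF Levy, of _ y] assms
    by (subst integral_density) (auto simp: addend_density_def Levy set_lebesgue_integral_def indicator_def ac_simps intro!: Bochner_Integration.integral_cong)
qed

lemma addend_density_nonpos: "y \<le> 0 \<Longrightarrow> addend_density S a h y = 0"
  by (simp add: addend_density_def)

end

section \<open>Random sums\<close>

text \<open>The sigma-algebra generated by \<open>f\<close> is contained in \<open>sets U\<close>,
  and that of \<open>g\<close> in \<open>sets V\<close>; the equality of spaces makes the preimages
  agree.\<close>

lemma (in prob_space) indep_var_of_indep_set:
  assumes indep: "indep_set (sets U) (sets V)" and space: "space U = space M" "space V = space M"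
    and f: "f \<in> measurable U N" and g: "g \<in> measurable V N'"
  shows "indep_var N f N' g"
proof -
  have sub: "sets U \<subseteq> events" "sets V \<subseteq> events"
    and ind: "\<And>a b. a \<in> sets U \<Longrightarrow> b \<in> sets V \<Longrightarrow> prob (a \<inter> b) = prob a * prob b"
    using indep unfolding indep_sets2_eq by auto
  have generated: "sigma_sets (space M) {f -` A \<inter> space M |A. A \<in> sets N} \<subseteq> sets U"
    if "space U = space M" "f \<in> measurable U N" for f :: "'a \<Rightarrow> 'c" and U N
    unfolding that(1)[symmetric] using measurable_sets[OF that(2)]
    by (intro sets.sigma_sets_subset) auto
  note sf = generated[OF space(1) f] and sg = generated[OF space(2) g]
  show ?thesis
    unfolding indep_var_eq
  proof (intro conjI)
    show "random_variable N f" "random_variable N' g"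
      using measurable_mono[OF subset_refl refl sub(1), of N] measurable_mono[OF subset_refl refl sub(2), of N']
        f g space by auto
    show "indep_set (sigma_sets (space M) {f -` A \<inter> space M |A. A \<in> sets N})
        (sigma_sets (space M) {g -` A \<inter> space M |A. A \<in> sets N'})"
      unfolding indep_sets2_eq using sub sf sg by (auto intro!: ind)
  qed
qed

text \<open>Partition by the value of \<open>K\<close>. The product \<open>W n\<close> is a function
  of the addends and the event K = n belongs to \<open>V\<close>, so expectations factor;
  independence among the addends then gives the power of \<open>\<phi>\<close>.\<close>

lemma nn_integral_exp_random_sum:
  fixes X :: "nat \<Rightarrow> 'a \<Rightarrow> real" and K :: "'a \<Rightarrow> nat"
  assumes "prob_space M" and X: "prob_space.indep_vars M (\<lambda>_. borel) X {1..}"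
    and K: "K \<in> measurable V (count_space UNIV)" and V: "space V = space M"
    and indep: "prob_space.indep_set M
       (sets (vimage_algebra (space M) (\<lambda>\<omega>. \<lambda>j\<in>{1..}. X j \<omega>) (PiM {1..} (\<lambda>_. borel)))) (sets V)"
    and pos: "\<And>j. j \<ge> 1 \<Longrightarrow> AE \<omega> in M. X j \<omega> \<ge> 0" and "\<theta> > 0"
    and transform: "\<And>j. j \<ge> 1 \<Longrightarrow> (\<integral>\<omega>. exp (- \<theta> * X j \<omega>) \<partial>M) = \<phi>"
  shows "(\<integral>\<^sup>+\<omega>. ennreal (exp (- \<theta> * (\<Sum>j = 1..K \<omega>. X j \<omega>))) \<partial>M)
    = (\<Sum>n. ennreal (measure M {\<omega> \<in> space M. K \<omega> = n} * \<phi> ^ n))"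
proof -
  interpret prob_space M by fact
  have X_meas[measurable]: "X j \<in> borel_measurable M" if "j \<ge> 1" for j
    using X that by (auto simp: indep_vars_def)
  have "sets V \<subseteq> events"
    using indep unfolding indep_sets2_eq by auto
  then have [measurable]: "K \<in> measurable M (count_space UNIV)"
    using measurable_mono[OF subset_refl refl, of V M "count_space UNIV"] K V by auto
  define W where "W n \<omega> = (\<Prod>j = 1..n. exp (- \<theta> * X j \<omega>))" for n \<omega>
  have W_eq: "W n \<omega> = exp (- \<theta> * (\<Sum>j = 1..n. X j \<omega>))" for n \<omega>
    by (simp add: W_def exp_sum[symmetric] sum_distrib_left sum_negf)
  have W_nonneg: "W n \<omega> \<ge> 0" for n \<omega>
    by (simp add: W_eq)
  have bounded: "integrable M (\<lambda>\<omega>. exp (- \<theta> * X j \<omega>))" if "j \<ge> 1" for j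
  proof (rule integrable_const_bound[of _ 1])
    show "AE \<omega> in M. norm (exp (- \<theta> * X j \<omega>)) \<le> 1"
      using pos[OF that] by eventually_elim (use \<open>\<theta> > 0\<close> in simp)
  qed (use X_meas[OF that] in measurable)
  have indep_exp: "indep_vars (\<lambda>_. borel) (\<lambda>j \<omega>. exp (- \<theta> * X j \<omega>)) {1..n}" for n
    using indep_vars_compose2[OF indep_vars_subset[OF X, of "{1..n}"], of "\<lambda>_ x. exp (- \<theta> * x)" "\<lambda>_. borel"]
    by auto
  have bounded': "integrable M (\<lambda>\<omega>. exp (- \<theta> * X j \<omega>))" if "j \<in> {1..n}" for j n
    using that by (intro bounded) simp
  have E_W: "(\<integral>\<omega>. W n \<omega> \<partial>M) = \<phi> ^ n" for n
  proof -
    have "(\<integral>\<omega>. W n \<omega> \<partial>M) = (\<Prod>j = 1..n. (\<integral>\<omega>. exp (- \<theta> * X j \<omega>) \<partial>M))"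
      unfolding W_def by (rule indep_vars_lebesgue_integral[OF _ indep_exp bounded']) auto
    also have "\<dots> = (\<Prod>j = 1..n. \<phi>)"
      by (intro prod.cong transform) auto
    finally show ?thesis by simp
  qed
  have i_W: "integrable M (W n)" for n
    unfolding W_def by (rule indep_vars_integrable[OF _ indep_exp bounded']) auto
  have part: "(\<integral>\<^sup>+\<omega>. ennreal (W n \<omega> * indicator {\<omega> \<in> space M. K \<omega> = n} \<omega>) \<partial>M)
      = ennreal (measure M {\<omega> \<in> space M. K \<omega> = n} * \<phi> ^ n)" for n
  proof -
    let ?U = "vimage_algebra (space M) (\<lambda>\<omega>. \<lambda>j\<in>{1..}. X j \<omega>) (PiM {1..} (\<lambda>_. borel))"
    let ?I = "\<lambda>\<omega>. indicat_real {\<omega> \<in> space M. K \<omega> = n} \<omega>"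
    \<comment> \<open>Factoring \<open>W n\<close> through the whole sequence of addends makes it
      measurable for the sigma-algebra of which independence is assumed.\<close>
    have "(\<lambda>\<omega>. \<lambda>j\<in>{1..}. X j \<omega>) \<in> measurable ?U (PiM {1..} (\<lambda>_. borel))"
      by (rule measurable_vimage_algebra1) (auto simp: space_PiM)
    moreover have "(\<lambda>x. \<Prod>j = 1..n. exp (- \<theta> * x j)) \<in> borel_measurable (PiM {1..} (\<lambda>_. borel))"
      by measurable
    ultimately have "(\<lambda>\<omega>. \<Prod>j = 1..n. exp (- \<theta> * (\<lambda>j\<in>{1..}. X j \<omega>) j)) \<in> borel_measurable ?U"
      by (rule measurable_compose)
    also have "(\<lambda>\<omega>. \<Prod>j = 1..n. exp (- \<theta> * (\<lambda>j\<in>{1..}. X j \<omega>) j)) = W n"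
      by (auto simp: W_def fun_eq_iff intro!: prod.cong)
    finally have W_U: "W n \<in> borel_measurable ?U" .
    have I_V: "?I \<in> borel_measurable V"
      unfolding V[symmetric] using K by measurable
    have iv: "indep_var borel (W n) borel ?I"
      by (rule indep_var_of_indep_set[OF indep _ V W_U I_V]) simp
    have i_I: "integrable M ?I" by (auto simp: emeasure_eq_measure)
    have "(\<integral>\<omega>. W n \<omega> * ?I \<omega> \<partial>M) = (\<integral>\<omega>. W n \<omega> \<partial>M) * (\<integral>\<omega>. ?I \<omega> \<partial>M)" "integrable M (\<lambda>\<omega>. W n \<omega> * ?I \<omega>)"
      by (rule indep_var_lebesgue_integral[OF iv i_W i_I] indep_var_integrable[OF iv i_W i_I])+
    then show ?thesis
      using W_nonneg by (subst nn_integral_eq_integral) (auto simp: E_W mult.commute)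
  qed
  have "(\<integral>\<^sup>+\<omega>. ennreal (exp (- \<theta> * (\<Sum>j = 1..K \<omega>. X j \<omega>))) \<partial>M)
      = (\<integral>\<^sup>+\<omega>. (\<Sum>n. ennreal (W n \<omega> * indicator {\<omega> \<in> space M. K \<omega> = n} \<omega>)) \<partial>M)"
  proof (rule nn_integral_cong)
    fix \<omega> assume "\<omega> \<in> space M"
    have "(\<Sum>n. ennreal (W n \<omega> * indicator {\<omega> \<in> space M. K \<omega> = n} \<omega>))
        = (\<Sum>n\<in>{K \<omega>}. ennreal (W n \<omega> * indicator {\<omega> \<in> space M. K \<omega> = n} \<omega>))"
      by (rule suminf_finite) auto
    then show "ennreal (exp (- \<theta> * (\<Sum>j = 1..K \<omega>. X j \<omega>))) = (\<Sum>n. ennreal (W n \<omega> * indicator {\<omega> \<in> space M. K \<omega> = n} \<omega>))"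
      using \<open>\<omega> \<in> space M\<close> by (simp add: W_eq)
  qed
  also have "\<dots> = (\<Sum>n. \<integral>\<^sup>+\<omega>. ennreal (W n \<omega> * indicator {\<omega> \<in> space M. K \<omega> = n} \<omega>) \<partial>M)"
  proof (rule nn_integral_suminf)
    have [measurable]: "W n \<in> borel_measurable M" for n
      using i_W by auto
    show "(\<lambda>\<omega>. ennreal (W n \<omega> * indicator {\<omega> \<in> space M. K \<omega> = n} \<omega>)) \<in> borel_measurable M" for n
      by measurable
  qed
  finally show ?thesis unfolding part .
qed

lemma yule_generating_function:
  assumes "lam > 0" "t \<ge> 0" "\<phi> \<ge> 0" "\<phi> \<le> 1"
  shows "(\<Sum>n. ennreal (yule_pmf lam t n * \<phi> ^ n)) = ennreal (exp (- lam * t) * \<phi> / (1 - (1 - exp (- lam * t)) * \<phi>))"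
proof -
  define x where "x = exp (- lam * t)"
  have x: "0 < x" "x \<le> 1" using assms by (auto simp: x_def)
  have yule: "yule_pmf lam t (Suc n) = x * (1 - x) ^ n" for n
    by (simp add: yule_pmf_def x_def)
  have r: "0 \<le> (1 - x) * \<phi>" "(1 - x) * \<phi> < 1"
    using x assms mult_left_le[of \<phi> "1 - x"] by auto
  have "(\<lambda>n. yule_pmf lam t (Suc n) * \<phi> ^ Suc n) sums (x * \<phi> * (1 / (1 - (1 - x) * \<phi>)))"
    using sums_mult[OF geometric_sums[of "(1 - x) * \<phi>"], of "x * \<phi>"] r
    by (simp add: yule power_mult_distrib ac_simps)
  \<comment> \<open>The term n = 0 vanishes, so the index shift leaves the sum unchanged.\<close>
  then have "(\<lambda>n. yule_pmf lam t n * \<phi> ^ n) sums (x * \<phi> * (1 / (1 - (1 - x) * \<phi>)))"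
    by (subst (asm) sums_Suc_iff) (simp add: yule_pmf_def)
  moreover have "yule_pmf lam t n * \<phi> ^ n \<ge> 0" for n
    using x assms by (auto simp: yule_pmf_def x_def[symmetric])
  ultimately show ?thesis
    unfolding x_def by (subst suminf_ennreal_eq) (auto simp: ac_simps)
qed

context subordinated
begin

lemma addend_density_transform:
  assumes "a > 0" "\<theta> \<ge> 0"
  shows "(\<integral>\<^sup>+y. ennreal (addend_density S a h y) * ennreal (exp (- \<theta> * y)) \<partial>lborel) = ennreal (a / (a + g \<theta>))"
proof -
  have ag: "a + g \<theta> > 0" using g_nonneg[OF assms(2)] assms(1) by simp
  have i: "integrable lborel (\<lambda>y. indicator {0<..} y *\<^sub>R (exp (- \<theta> * y) * moment a 0 y))"
    using laplace_moment(1)[OF assms, of 0] by (simp add: set_integrable_def)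
  have "(\<integral>\<^sup>+y. ennreal (addend_density S a h y) * ennreal (exp (- \<theta> * y)) \<partial>lborel)
    = (\<integral>\<^sup>+y. ennreal a * ennreal (indicator {0<..} y *\<^sub>R (exp (- \<theta> * y) * moment a 0 y)) \<partial>lborel)"
  proof (rule nn_integral_cong)
    fix y :: real
    show "ennreal (addend_density S a h y) * ennreal (exp (- \<theta> * y)) = ennreal a * ennreal (indicator {0<..} y *\<^sub>R (exp (- \<theta> * y) * moment a 0 y))"
      using assms(1) moment_nonneg[of y a 0]
      by (cases "y > 0") (auto simp: addend_density_eq addend_density_nonpos ennreal_mult[symmetric] ac_simps)
  qed
  also have "\<dots> = ennreal a * ennreal (\<integral>y. indicator {0<..} y *\<^sub>R (exp (- \<theta> * y) * moment a 0 y) \<partial>lborel)"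
    using i moment_nonneg
    by (subst nn_integral_cmult) (auto intro!: arg_cong2[where f="(*)"] nn_integral_eq_integral simp: indicator_def)
  also have "(\<integral>y. indicator {0<..} y *\<^sub>R (exp (- \<theta> * y) * moment a 0 y) \<partial>lborel) = 1 / (a + g \<theta>)"
    using laplace_moment(2)[OF assms, of 0] by (simp add: laplace_def set_lebesgue_integral_def)
  finally show ?thesis using assms ag by (simp add: ennreal_mult[symmetric])
qed

lemma addend_density_measurable[measurable]: "addend_density S a h \<in> borel_measurable borel"
proof -
  have "(\<lambda>y. a * (indicator {0<..} y * moment a 0 y)) \<in> borel_measurable borel"
    using moment_measurable by measurable
  also have "(\<lambda>y. a * (indicator {0<..} y * moment a 0 y)) = addend_density S a h"
    by (auto simp: fun_eq_iff indicator_def addend_density_eq addend_density_nonpos)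
  finally show ?thesis .
qed

lemma addend_density_nonneg: "a > 0 \<Longrightarrow> addend_density S a h y \<ge> 0"
  by (cases "y > 0") (auto simp: addend_density_eq addend_density_nonpos moment_nonneg)

lemma random_sum_distributed:
  fixes X :: "nat \<Rightarrow> 'a \<Rightarrow> real" and B :: "real \<Rightarrow> 'a \<Rightarrow> nat"
  assumes "lam > 0" "\<xi> > 0" "t \<ge> 0" and B: "linear_birth_process M lam B"
    and X: "prob_space.indep_vars M (\<lambda>_. borel) X {1..}"
    and X_density: "\<And>j. j \<ge> 1 \<Longrightarrow> distributed M lborel (X j) (\<lambda>x. ennreal (addend_density S \<xi> h x))"
    and indep: "prob_space.indep_set M
      (sets (vimage_algebra (space M) (\<lambda>\<omega>. \<lambda>j\<in>{1..}. X j \<omega>) (PiM {1..} (\<lambda>_. borel))))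
      (sets (vimage_algebra (space M) (\<lambda>\<omega>. \<lambda>t\<in>{0::real..}. B t \<omega>)
        (PiM {0::real..} (\<lambda>_. count_space UNIV))))"
  shows "distributed M lborel (\<lambda>\<omega>. \<Sum>j = 1..B t \<omega>. X j \<omega>)
    (\<lambda>y. ennreal (addend_density S (\<xi> * exp (- lam * t)) h y))"
proof -
  have "prob_space M" using B by (simp add: linear_birth_process_def)
  then interpret prob_space M .
  let ?V = "vimage_algebra (space M) (\<lambda>\<omega>. \<lambda>t\<in>{0::real..}. B t \<omega>) (PiM {0::real..} (\<lambda>_. count_space UNIV))"
  define Y where "Y \<omega> = (\<Sum>j = 1..B t \<omega>. X j \<omega>)" for \<omega>
  define a where "a = \<xi> * exp (- lam * t)"
  have "a > 0" using \<open>\<xi> > 0\<close> by (simp add: a_def)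
  have [measurable]: "B t \<in> measurable M (count_space UNIV)"
    using B \<open>t \<ge> 0\<close> by (simp add: linear_birth_process_def)
  \<comment> \<open>Independence is assumed for the sigma-algebra of the entire path, of which
    \<open>B t\<close> is one coordinate.\<close>
  have B_V: "B t \<in> measurable ?V (count_space UNIV)"
  proof -
    have "(\<lambda>\<omega>. \<lambda>t\<in>{0::real..}. B t \<omega>) \<in> measurable ?V (PiM {0::real..} (\<lambda>_. count_space UNIV))"
      by (rule measurable_vimage_algebra1) (auto simp: space_PiM)
    from measurable_compose[OF this measurable_component_singleton[of t]] \<open>t \<ge> 0\<close> show ?thesis by simp
  qed
  have X_meas: "X j \<in> borel_measurable M" if "j \<ge> 1" for j
    using X_density[OF that] by (simp add: distributed_def)
  have pos: "AE \<omega> in M. X j \<omega> \<ge> 0" if "j \<ge> 1" for j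
    by (subst distributed_AE2[OF X_density[OF that]])
      (auto simp: addend_density_nonpos not_le intro!: AE_I2 less_imp_le elim: contrapos_pp)
  have Y_meas[measurable]: "Y \<in> borel_measurable M"
  proof -
    have "(\<lambda>\<omega>. \<Sum>j = 1..n. X j \<omega>) \<in> borel_measurable M" for n
      by (intro borel_measurable_sum X_meas) simp
    then show ?thesis unfolding Y_def by (rule measurable_compose_countable) measurable
  qed
  have Y_pos: "AE \<omega> in M. Y \<omega> \<ge> 0"
  proof -
    \<comment> \<open>The number of summands is random, so one null set has to serve all
      \<open>j\<close>.\<close>
    have "AE \<omega> in M. \<forall>j. j \<ge> 1 \<longrightarrow> X j \<omega> \<ge> 0"
      using pos by (intro AE_all_countable[THEN iffD2] allI) (auto intro: AE_impI)
    then show ?thesis by eventually_elim (auto simp: Y_def intro: sum_nonneg)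
  qed
  have Y_transform: "(\<integral>\<^sup>+\<omega>. ennreal (exp (- \<theta> * Y \<omega>)) \<partial>M) = ennreal (a / (a + g \<theta>))" if "\<theta> > 0" for \<theta>
  proof -
    have g: "g \<theta> \<ge> 0" using g_nonneg that by simp
    have X_transform: "(\<integral>\<omega>. exp (- \<theta> * X j \<omega>) \<partial>M) = \<xi> / (\<xi> + g \<theta>)" if "j \<ge> 1" for j
    proof -
      have "(\<integral>\<omega>. exp (- \<theta> * X j \<omega>) \<partial>M) = enn2real (\<integral>\<^sup>+\<omega>. ennreal (exp (- \<theta> * X j \<omega>)) \<partial>M)"
        using X_meas[OF that] by (intro integral_eq_nn_integral) auto
      also have "(\<integral>\<^sup>+\<omega>. ennreal (exp (- \<theta> * X j \<omega>)) \<partial>M) = ennreal (\<xi> / (\<xi> + g \<theta>))"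
        using addend_density_transform[OF \<open>\<xi> > 0\<close>, of \<theta>] \<open>\<theta> > 0\<close>
        by (subst distributed_nn_integral[OF X_density[OF that], symmetric]) auto
      finally show ?thesis using g \<open>\<xi> > 0\<close> by simp
    qed
    have "(\<integral>\<^sup>+\<omega>. ennreal (exp (- \<theta> * Y \<omega>)) \<partial>M) = (\<Sum>n. ennreal (measure M {\<omega> \<in> space M. B t \<omega> = n} * (\<xi> / (\<xi> + g \<theta>)) ^ n))"
      unfolding Y_def
      by (rule nn_integral_exp_random_sum[OF \<open>prob_space M\<close> X B_V _ indep pos that X_transform]) simp_all
    also have "\<dots> = (\<Sum>n. ennreal (yule_pmf lam t n * (\<xi> / (\<xi> + g \<theta>)) ^ n))"
      by (simp add: linear_birth_process_law[OF B \<open>t \<ge> 0\<close>])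
    also have "\<dots> = ennreal (exp (- lam * t) * (\<xi> / (\<xi> + g \<theta>)) / (1 - (1 - exp (- lam * t)) * (\<xi> / (\<xi> + g \<theta>))))"
      using g \<open>\<xi> > 0\<close> assms by (intro yule_generating_function) (auto simp: field_simps)
    also have "exp (- lam * t) * (\<xi> / (\<xi> + g \<theta>)) / (1 - (1 - exp (- lam * t)) * (\<xi> / (\<xi> + g \<theta>))) = a / (a + g \<theta>)"
    proof -
      have "1 - (1 - exp (- lam * t)) * (\<xi> / (\<xi> + g \<theta>)) = (a + g \<theta>) / (\<xi> + g \<theta>)"
        using g \<open>\<xi> > 0\<close> by (simp add: a_def field_simps)
      then show ?thesis using g \<open>\<xi> > 0\<close> by (simp add: a_def)
    qed
    finally show ?thesis .
  qed
  have "distr M borel Y = Nonnegative_Lebesgue_Integration.density lborel (\<lambda>y. ennreal (addend_density S a h y))"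
  proof (rule measure_eqI_laplace)
    show "AE x in distr M borel Y. 0 \<le> x"
      using Y_pos by (subst AE_distr_iff) auto
    show "AE x in Nonnegative_Lebesgue_Integration.density lborel (\<lambda>y. ennreal (addend_density S a h y)). 0 \<le> x"
      by (subst AE_density) (auto simp: addend_density_nonpos not_le intro!: AE_I2 elim: contrapos_pp)
    fix \<theta> :: real assume "\<theta> > 0"
    have 1: "(\<integral>\<^sup>+x. ennreal (exp (- \<theta> * x)) \<partial>distr M borel Y) = ennreal (a / (a + g \<theta>))"
      by (subst nn_integral_distr) (auto simp: Y_transform[OF \<open>\<theta> > 0\<close>, simplified])
    then show "(\<integral>\<^sup>+x. ennreal (exp (- \<theta> * x)) \<partial>distr M borel Y) < \<infinity>" by simp
    show "(\<integral>\<^sup>+x. ennreal (exp (- \<theta> * x)) \<partial>distr M borel Y)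
      = (\<integral>\<^sup>+x. ennreal (exp (- \<theta> * x)) \<partial>Nonnegative_Lebesgue_Integration.density lborel (\<lambda>y. ennreal (addend_density S a h y)))"
      unfolding 1 using addend_density_transform[OF \<open>a > 0\<close>, of \<theta>] \<open>\<theta> > 0\<close>
      by (subst nn_integral_density) auto
  qed simp_all
  moreover have "distr M lborel Y = distr M borel Y"
    by (intro distr_cong) auto
  ultimately show ?thesis
    unfolding Y_def[symmetric, abs_def] by (auto simp: distributed_def a_def)
qed

end

section \<open>The equation\<close>

text \<open>The mass may accumulate to infinity at 0, but the sets above 1/(n+1) have finite mass
  and exhaust the positive axis. This licenses Tonelli in \<open>laplace_levy_tail\<close>.\<close>

lemma levy_measure_sigma_finite:
  assumes N: "levy_measure N"
  shows "sigma_finite_measure N"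
proof
  let ?C = "insert {..0} (range (\<lambda>n. {inverse (real (Suc n))<..}))"
  have sets: "sets N = sets borel" using N by (simp add: levy_measure_def)
  have "x \<in> \<Union> ?C" for x :: real
    using reals_Archimedean[of x] by (cases "x \<le> 0") (auto simp: not_le)
  then have "\<Union> ?C = space N"
    using sets_eq_imp_space_eq[OF sets] by auto
  moreover have "emeasure N c < top" if "c \<in> ?C" for c
    using that N
    by (auto simp: levy_measure_def simp del: of_nat_Suc
      intro!: levy_measure_tail_finite[OF N, unfolded infinity_ennreal_def])
  moreover have "?C \<subseteq> sets N"
    unfolding sets by (auto simp del: of_nat_Suc)
  ultimately show "\<exists>C. countable C \<and> C \<subseteq> sets N \<and> \<Union> C = space N \<and> (\<forall>c\<in>C. emeasure N c \<noteq> \<infinity>)"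
    by (intro exI[of _ ?C] conjI ballI) (auto simp: less_top)
qed

lemma levy_tail_nonneg: "levy_tail N s \<ge> 0"
  by (simp add: levy_tail_def)

lemma levy_tail_measurable_Ioi:
  assumes N: "levy_measure N"
  shows "(\<lambda>s. indicator {0<..} s * levy_tail N s) \<in> borel_measurable borel"
proof -
  have "(\<lambda>s. - levy_tail N s) \<in> borel_measurable (restrict_space borel {0<..})"
    using levy_tail_antimono[OF N]
    by (intro borel_measurable_mono_on_fnc) (auto simp: mono_on_def)
  from borel_measurable_uminus[OF this] show ?thesis
    by (subst (asm) borel_measurable_restrict_space_iff) (auto simp: mult.commute)
qed

lemma nn_integral_exp_Ioo:
  assumes "\<theta> > 0" "x > 0"
  shows "(\<integral>\<^sup>+s. ennreal (exp (- \<theta> * s)) * indicator {0<..<x} s \<partial>lborel) = ennreal ((1 - exp (- \<theta> * x)) / \<theta>)"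
proof -
  have "(\<integral>\<^sup>+s. ennreal (exp (- \<theta> * s)) * indicator {0<..<x} s \<partial>lborel)
      = (\<integral>\<^sup>+s. ennreal (exp (- \<theta> * s)) * indicator {0..x} s \<partial>lborel)"
    using AE_lborel_singleton[of 0] AE_lborel_singleton[of x]
    by (intro nn_integral_cong_AE, eventually_elim) (auto simp: indicator_def)
  also have "\<dots> = ennreal (- exp (- \<theta> * x) / \<theta> - - exp (- \<theta> * 0) / \<theta>)"
    using assms by (intro nn_integral_FTC_Icc) (auto intro!: derivative_eq_intros)
  finally show ?thesis by (simp add: diff_divide_distrib)
qed

text \<open>Tonelli on the region 0 < s < x: the tail at s is the mass of all x > s, and integrating
  exp (- \<theta> s) over s < x first leaves (1 - exp (- \<theta> x)) / \<theta>.\<close>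

lemma laplace_levy_tail:
  assumes N: "levy_measure N"
  shows "laplace_integrable (levy_tail N)"
    and "\<theta> > 0 \<Longrightarrow> laplace (levy_tail N) \<theta> = bernstein_fun (Levy N) \<theta> / \<theta>"
proof -
  have sets[measurable_cong]: "sets N = sets borel" and fin: "(\<integral>\<^sup>+s. ennreal (min s 1) \<partial>N) < \<infinity>"
    using N by (auto simp: levy_measure_def)
  interpret N: sigma_finite_measure N by (rule levy_measure_sigma_finite[OF N])
  interpret pair_sigma_finite lborel N ..
  have pos: "AE x in N. x > 0"
    using N by (intro AE_I[of _ _ "{..0}"]) (auto simp: levy_measure_def not_less)
  have *: "set_integrable lborel {0<..} (\<lambda>x. exp (- \<theta> * x) * levy_tail N x) \<and>
      laplace (levy_tail N) \<theta> = bernstein_fun (Levy N) \<theta> / \<theta>" if "\<theta> > 0" for \<theta>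
  proof -
    have nn: "(\<integral>\<^sup>+x. ennreal (1 - exp (- \<theta> * x)) \<partial>N) = ennreal (bernstein_fun (Levy N) \<theta>)"
    proof -
      \<comment> \<open>Up to 1 this is 1 - exp (- z) \<le> z, beyond 1 it is the trivial bound 1.
        It makes the integral finite, so that the Bochner integral in \<open>bernstein_fun\<close>
        agrees with the nonnegative one instead of defaulting to 0.\<close>
      have bound: "1 - exp (- \<theta> * x) \<le> max \<theta> 1 * min x 1" if "x > 0" for x
      proof (cases "x \<le> 1")
        case True
        have "1 - exp (- \<theta> * x) \<le> \<theta> * x" using exp_ge_add_one_self[of "- \<theta> * x"] by simp
        also have "\<dots> \<le> max \<theta> 1 * x" using that by (intro mult_right_mono) auto
        finally show ?thesis using True by simp
      next
        case False
        then show ?thesis by (auto simp: max_def intro: order_trans[of _ 1])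
      qed
      have "(\<integral>\<^sup>+x. ennreal (1 - exp (- \<theta> * x)) \<partial>N) \<le> (\<integral>\<^sup>+x. ennreal (max \<theta> 1) * ennreal (min x 1) \<partial>N)"
      proof (rule nn_integral_mono_AE)
        show "AE x in N. ennreal (1 - exp (- \<theta> * x)) \<le> ennreal (max \<theta> 1) * ennreal (min x 1)"
          using pos
        proof eventually_elim
          case (elim x)
          then show ?case using bound[OF elim] \<open>\<theta> > 0\<close> by (subst ennreal_mult[symmetric]) (auto intro: ennreal_leI)
        qed
      qed
      also have "\<dots> = ennreal (max \<theta> 1) * (\<integral>\<^sup>+x. ennreal (min x 1) \<partial>N)"
        by (rule nn_integral_cmult) measurable
      also have "\<dots> < \<infinity>" using fin by (simp add: ennreal_mult_less_top)
      finally have "(\<integral>\<^sup>+x. ennreal (1 - exp (- \<theta> * x)) \<partial>N) < \<infinity>" .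
      moreover have "bernstein_fun (Levy N) \<theta> = enn2real (\<integral>\<^sup>+x. ennreal (1 - exp (- \<theta> * x)) \<partial>N)"
        unfolding bernstein_fun.simps using pos \<open>\<theta> > 0\<close>
        by (intro integral_eq_nn_integral) (auto elim!: eventually_mono)
      ultimately show ?thesis by simp
    qed
    have g: "bernstein_fun (Levy N) \<theta> \<ge> 0"
      unfolding bernstein_fun.simps using pos \<open>\<theta> > 0\<close>
      by (intro integral_nonneg_AE) (auto elim!: eventually_mono)
    have "(\<integral>\<^sup>+s. indicator {0<..} s * ennreal (exp (- \<theta> * s) * levy_tail N s) \<partial>lborel)
        = (\<integral>\<^sup>+s. (\<integral>\<^sup>+x. indicator {0<..} s * ennreal (exp (- \<theta> * s)) * indicator {s<..} x \<partial>N) \<partial>lborel)"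
    proof (rule nn_integral_cong)
      fix s :: real
      show "indicator {0<..} s * ennreal (exp (- \<theta> * s) * levy_tail N s)
        = (\<integral>\<^sup>+x. indicator {0<..} s * ennreal (exp (- \<theta> * s)) * indicator {s<..} x \<partial>N)"
        by (cases "s > 0") (simp_all add: ennreal_mult' levy_tail_eq[OF N] nn_integral_cmult sets)
    qed
    also have "\<dots> = (\<integral>\<^sup>+x. (\<integral>\<^sup>+s. indicator {0<..} s * ennreal (exp (- \<theta> * s)) * indicator {s<..} x \<partial>lborel) \<partial>N)"
    proof (rule Fubini'[symmetric])
      have "(\<lambda>p. indicator {0<..} (fst p) * ennreal (exp (- \<theta> * fst p)) * indicator {p. fst p < snd p} p) \<in> borel_measurable (lborel \<Otimes>\<^sub>M N)"
        by measurable
      also have "(\<lambda>p. indicator {0<..} (fst p) * ennreal (exp (- \<theta> * fst p)) * indicator {p. fst p < snd p} p)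
          = (\<lambda>(s, x). indicator {0<..} s * ennreal (exp (- \<theta> * s)) * indicator {s<..} x)"
        by (auto simp: indicator_def fun_eq_iff)
      finally show "(\<lambda>(s, x). indicator {0<..} s * ennreal (exp (- \<theta> * s)) * indicator {s<..} x) \<in> borel_measurable (lborel \<Otimes>\<^sub>M N)" .
    qed
    also have "\<dots> = (\<integral>\<^sup>+x. ennreal (1 / \<theta>) * ennreal (1 - exp (- \<theta> * x)) \<partial>N)"
    proof (rule nn_integral_cong_AE)
      show "AE x in N. (\<integral>\<^sup>+s. indicator {0<..} s * ennreal (exp (- \<theta> * s)) * indicator {s<..} x \<partial>lborel)
          = ennreal (1 / \<theta>) * ennreal (1 - exp (- \<theta> * x))"
        using pos
      proof eventually_elim
        case (elim x)
        have "(\<integral>\<^sup>+s. indicator {0<..} s * ennreal (exp (- \<theta> * s)) * indicator {s<..} x \<partial>lborel)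
            = (\<integral>\<^sup>+s. ennreal (exp (- \<theta> * s)) * indicator {0<..<x} s \<partial>lborel)"
          by (intro nn_integral_cong) (auto simp: indicator_def)
        then show ?case
          using nn_integral_exp_Ioo[OF \<open>\<theta> > 0\<close> elim] elim \<open>\<theta> > 0\<close> by (simp add: ennreal_mult[symmetric])
      qed
    qed
    also have "\<dots> = ennreal (1 / \<theta>) * (\<integral>\<^sup>+x. ennreal (1 - exp (- \<theta> * x)) \<partial>N)"
      by (rule nn_integral_cmult) measurable
    also have "\<dots> = ennreal (bernstein_fun (Levy N) \<theta> / \<theta>)"
      unfolding nn using \<open>\<theta> > 0\<close> by (simp add: ennreal_mult'[symmetric] del: bernstein_fun.simps)
    finally have eq: "(\<integral>\<^sup>+s. indicator {0<..} s * ennreal (exp (- \<theta> * s) * levy_tail N s) \<partial>lborel)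
        = ennreal (bernstein_fun (Levy N) \<theta> / \<theta>)" .
    have "bernstein_fun (Levy N) \<theta> / \<theta> \<ge> 0" using g \<open>\<theta> > 0\<close> by simp
    from laplace_nn[OF levy_tail_measurable_Ioi[OF N] levy_tail_nonneg this eq] show ?thesis
      by blast
  qed
  show "laplace_integrable (levy_tail N)"
    unfolding laplace_integrable_def using * by blast
  show "laplace (levy_tail N) \<theta> = bernstein_fun (Levy N) \<theta> / \<theta>" if "\<theta> > 0"
    using *[OF that] by blast
qed

section \<open>Integrability, primitives and the Caputo-type derivative\<close>

lemma set_integrable_imp_laplace_integrable:
  assumes "set_integrable lborel {0<..} p"
  shows "laplace_integrable p"
  unfolding laplace_integrable_def set_integrable_def
proof (intro allI impI)
  fix \<theta> :: real assume "\<theta> > 0"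
  have i: "integrable lborel (\<lambda>x. indicator {0<..} x *\<^sub>R p x)"
    using assms by (simp add: set_integrable_def)
  show "integrable lborel (\<lambda>x. indicator {0<..} x *\<^sub>R (exp (- \<theta> * x) * p x))"
  proof (rule Bochner_Integration.integrable_bound[OF i])
    have "(\<lambda>x. exp (- \<theta> * x) * (indicator {0<..} x *\<^sub>R p x)) \<in> borel_measurable lborel"
      by (rule borel_measurable_times[OF _ borel_measurable_integrable[OF i]]) measurable
    then show "(\<lambda>x. indicator {0<..} x *\<^sub>R (exp (- \<theta> * x) * p x)) \<in> borel_measurable lborel"
      by (simp add: mult.left_commute)
    show "AE x in lborel. norm (indicator {0<..} x *\<^sub>R (exp (- \<theta> * x) * p x)) \<le> norm (indicator {0<..} x *\<^sub>R p x)"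
      using \<open>\<theta> > 0\<close> by (intro AE_I2) (auto simp: indicator_def abs_mult intro!: mult_left_le_one_le)
  qed
qed

lemma laplace_integrable_imp_set_integrable:
  assumes "laplace_integrable p"
  shows "set_integrable lborel {0<..<y} p"
  unfolding set_integrable_def
proof (rule Bochner_Integration.integrable_bound)
  \<comment> \<open>For x < y the factor exp (y - x) exceeds 1, so the function tilted with \<theta>
    = 1 and rescaled by exp y is a majorant.\<close>
  show "integrable lborel (\<lambda>x. exp y * (indicator {0<..} x * (exp (- 1 * x) * p x)))"
    using laplace_integrableD[OF assms, of 1] by simp
  have "(\<lambda>x. indicator {..<y} x * (indicator {0<..} x * p x)) \<in> borel_measurable lborel"
    by (rule borel_measurable_times) (use laplace_integrable_measurable[OF assms] in auto)
  also have "(\<lambda>x. indicator {..<y} x * (indicator {0<..} x * p x)) = (\<lambda>x. indicator {0<..<y} x *\<^sub>R p x)"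
    by (auto simp: indicator_def fun_eq_iff)
  finally show "(\<lambda>x. indicator {0<..<y} x *\<^sub>R p x) \<in> borel_measurable lborel" .
  have "\<bar>p x\<bar> \<le> exp y * (exp (- x) * \<bar>p x\<bar>)" if "x < y" for x
    unfolding mult.assoc[symmetric] exp_add[symmetric] using that by (simp add: mult_le_cancel_right1)
  then show "AE x in lborel. norm (indicator {0<..<y} x *\<^sub>R p x) \<le> norm (exp y * (indicator {0<..} x * (exp (- 1 * x) * p x)))"
    by (intro AE_I2) (auto simp: indicator_def abs_mult)
qed

lemma laplace_cong: "(\<And>x. x > 0 \<Longrightarrow> f x = g x) \<Longrightarrow> laplace f \<theta> = laplace g \<theta>"
  unfolding laplace_def by (intro set_lebesgue_integral_cong) auto

lemma conv_reflect: "conv p q y = conv q p y"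
  unfolding conv_def set_lebesgue_integral_def
  by (subst lborel_integral_real_affine[of "-1" _ y]) (auto intro!: Bochner_Integration.integral_cong simp: indicator_def)

text \<open>A primitive is the convolution with 1, whose transform 1/\<theta> can be cancelled. The
  functions are only locally integrable and may have no transform, so they are first cut off at each
  natural number n; the primitives of the truncations still agree.\<close>

lemma AE_eq_if_primitive_eq:
  fixes v w :: "real \<Rightarrow> real"
  assumes v: "\<And>y. y > 0 \<Longrightarrow> set_integrable lborel {0<..<y} v"
    and w: "\<And>y. y > 0 \<Longrightarrow> set_integrable lborel {0<..<y} w"
    and eq: "\<And>y. y > 0 \<Longrightarrow> (LBINT z:{0<..<y}. v z) = (LBINT z:{0<..<y}. w z)"
  shows "AE y in lborel. y > 0 \<longrightarrow> v y = w y"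
proof -
  have "AE y in lborel. \<forall>n::nat. y > 0 \<longrightarrow> y < real n \<longrightarrow> v y = w y"
  proof (intro AE_all_countable[THEN iffD2] allI)
    fix n :: nat
    show "AE y in lborel. y > 0 \<longrightarrow> y < real n \<longrightarrow> v y = w y"
    proof (cases "n = 0")
      case False
      define q where "q p y = indicator {0<..<real n} y * p y" for p :: "real \<Rightarrow> real" and y
      have li: "laplace_integrable (q p)" if "set_integrable lborel {0<..<real n} p" for p
      proof (rule set_integrable_imp_laplace_integrable)
        have "(\<lambda>x. indicator {0<..} x *\<^sub>R q p x) = (\<lambda>x. indicator {0<..<real n} x *\<^sub>R p x)"
          by (auto simp: q_def indicator_def)
        then show "set_integrable lborel {0<..} (q p)"
          using that by (simp add: set_integrable_def)
      qed
      have trunc: "conv (\<lambda>_. 1) (q p) y = (LBINT z:{0<..<min y (real n)}. p z)" for p y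
        unfolding conv_def set_lebesgue_integral_def q_def
        by (intro Bochner_Integration.integral_cong) (auto simp: indicator_def)
      have "laplace (q v) \<theta> = laplace (q w) \<theta>" if "\<theta> > 0" for \<theta>
      proof -
        have "laplace (conv (\<lambda>_. 1) (q v)) \<theta> = laplace (conv (\<lambda>_. 1) (q w)) \<theta>"
          using False by (intro laplace_cong) (simp add: trunc eq)
        then show ?thesis
          using that v[of "real n"] w[of "real n"] False
          by (simp add: laplace_conv(3) laplace_integrable_const li laplace_const)
      qed
      then have "AE y in lborel. y > 0 \<longrightarrow> q v y = q w y"
        using v[of "real n"] w[of "real n"] False by (intro laplace_eq_imp_AE_eq li) auto
      then show ?thesis
        by eventually_elim (auto simp: q_def)
    qed simp
  qed
  then show ?thesis
  proof eventually_elim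
    case (elim y)
    obtain n :: nat where "y < real n" using reals_Archimedean2 by blast
    with elim show ?case by blast
  qed
qed

lemma conv_caputo_primitiveD:
  assumes "conv_caputo_primitive S u v" "y > 0"
  shows "set_integrable lborel {0<..<y} v"
    and "(LBINT z:{0<..<y}. v z) = (case S of Drift \<Rightarrow> u y - u 0
      | Levy N \<Rightarrow> (LBINT s:{0<..<y}. (u (y - s) - u 0) * levy_tail N s))"
  using assms by (simp_all add: conv_caputo_primitive_def split: bernstein.splits)

text \<open>Functions with equal primitives agree a.e., so checking the primitive settles both
  branches of \<open>conv_caputo_of\<close>, without deciding whether \<open>u\<close> is locally
  absolutely continuous.\<close>

lemma conv_caputo_of_primitive:
  assumes "wf_bernstein S" and v: "conv_caputo_primitive S u v"
  shows "conv_caputo_of S u v"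
proof (cases "locally_ac u")
  case True
  have w: "conv_caputo_primitive S u (conv_caputo S u)"
    using conv_caputo_primitive_of_ac assms(1) True .
  have "AE y in lborel. y > 0 \<longrightarrow> v y = conv_caputo S u y"
    by (rule AE_eq_if_primitive_eq) (simp_all add: conv_caputo_primitiveD[OF v] conv_caputo_primitiveD[OF w])
  then show ?thesis using True by (simp add: conv_caputo_of_def)
qed (use v in \<open>simp add: conv_caputo_of_def\<close>)

text \<open>If \<open>u\<close> is locally absolutely continuous, \<open>v\<close> is merely a.e. equal to a Borel function and need
  not be Borel measurable itself, whence the passage to \<open>w\<close>.\<close>

lemma conv_caputo_ofD:
  assumes "wf_bernstein S" and v: "conv_caputo_of S u v"
  obtains w where "conv_caputo_primitive S u w" "AE y in lborel. y > 0 \<longrightarrow> v y = w y"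
proof (cases "locally_ac u")
  case True
  show ?thesis
    by (rule that[OF conv_caputo_primitive_of_ac[OF assms(1) True]])
      (use v True in \<open>simp add: conv_caputo_of_def\<close>)
next
  case False
  show ?thesis
    by (rule that[of v]) (use v False in \<open>simp_all add: conv_caputo_of_def\<close>)
qed

section \<open>Pointwise passage between real and [0,\<infinity>]-valued convolutions\<close>

definition pos_part :: "(real \<Rightarrow> real) \<Rightarrow> real \<Rightarrow> ennreal" where
  "pos_part p x = indicator {0<..} x * ennreal (p x)"

lemma pos_part_measurable:
  assumes "(\<lambda>x. indicator {0<..} x * p x) \<in> borel_measurable borel"
  shows "pos_part p \<in> borel_measurable borel"
proof -
  have "(\<lambda>x. ennreal (indicator {0<..} x * p x)) \<in> borel_measurable borel"
    using assms by measurable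
  also have "(\<lambda>x. ennreal (indicator {0<..} x * p x)) = pos_part p"
    by (auto simp: pos_part_def indicator_def fun_eq_iff)
  finally show ?thesis .
qed

lemma nnconv_pos_part:
  assumes "\<And>x. x > 0 \<Longrightarrow> p x \<ge> 0" "\<And>x. x > 0 \<Longrightarrow> q x \<ge> 0"
  shows "nnconv (pos_part p) (pos_part q) y = (\<integral>\<^sup>+z. ennreal (indicator {0<..<y} z * (p (y - z) * q z)) \<partial>lborel)"
  unfolding nnconv_def pos_part_def
  by (intro nn_integral_cong) (auto simp: indicator_def assms ennreal_mult)

lemma conv_integrand_measurable:
  fixes p q :: "real \<Rightarrow> real"
  assumes "(\<lambda>x. indicator {0<..} x * p x) \<in> borel_measurable borel"
    "(\<lambda>x. indicator {0<..} x * q x) \<in> borel_measurable borel"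
  shows "(\<lambda>z. indicator {0<..<y} z * (p (y - z) * q z)) \<in> borel_measurable borel"
proof -
  have "(\<lambda>z. (indicator {0<..} (y - z) * p (y - z)) * (indicator {0<..} z * q z)) \<in> borel_measurable borel"
    by (rule borel_measurable_times[OF measurable_compose[OF _ assms(1)] assms(2)]) measurable
  also have "(\<lambda>z. (indicator {0<..} (y - z) * p (y - z)) * (indicator {0<..} z * q z))
      = (\<lambda>z. indicator {0<..<y} z * (p (y - z) * q z))"
    by (auto simp: indicator_def fun_eq_iff)
  finally show ?thesis .
qed

text \<open>A statement about one given \<open>y\<close>. Finiteness excludes a divergent integral,
  for which \<open>conv\<close> would be 0 by default.\<close>

lemma conv_eq_if_nnconv_finite:
  assumes nonneg: "\<And>x. x > 0 \<Longrightarrow> p x \<ge> 0" "\<And>x. x > 0 \<Longrightarrow> q x \<ge> 0"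
    and meas: "(\<lambda>x. indicator {0<..} x * p x) \<in> borel_measurable borel"
      "(\<lambda>x. indicator {0<..} x * q x) \<in> borel_measurable borel"
    and fin: "nnconv (pos_part p) (pos_part q) y < \<infinity>"
  shows "set_integrable lborel {0<..<y} (\<lambda>z. p (y - z) * q z)"
    and "ennreal (conv p q y) = nnconv (pos_part p) (pos_part q) y"
proof -
  have eq: "nnconv (pos_part p) (pos_part q) y = (\<integral>\<^sup>+z. ennreal (indicator {0<..<y} z * (p (y - z) * q z)) \<partial>lborel)"
    by (rule nnconv_pos_part) (auto simp: nonneg)
  have nn: "indicator {0<..<y} z * (p (y - z) * q z) \<ge> 0" for z
    by (auto simp: indicator_def nonneg)
  have i: "integrable lborel (\<lambda>z. indicator {0<..<y} z * (p (y - z) * q z))"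
    using fin conv_integrand_measurable[OF meas, of y] nn unfolding eq
    by (intro integrableI_nonneg) auto
  then show "set_integrable lborel {0<..<y} (\<lambda>z. p (y - z) * q z)"
    by (simp add: set_integrable_def)
  show "ennreal (conv p q y) = nnconv (pos_part p) (pos_part q) y"
    unfolding eq conv_def set_lebesgue_integral_def real_scaleR_def
    by (rule nn_integral_eq_integral[OF i, symmetric]) (intro AE_I2 nn)
qed

lemma nnconv_eq_conv:
  assumes nonneg: "\<And>x. x > 0 \<Longrightarrow> p x \<ge> 0" "\<And>x. x > 0 \<Longrightarrow> q x \<ge> 0"
    and i: "set_integrable lborel {0<..<y} (\<lambda>z. p (y - z) * q z)"
  shows "nnconv (pos_part p) (pos_part q) y = ennreal (conv p q y)"
proof -
  have eq: "nnconv (pos_part p) (pos_part q) y = (\<integral>\<^sup>+z. ennreal (indicator {0<..<y} z * (p (y - z) * q z)) \<partial>lborel)"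
    by (rule nnconv_pos_part) (auto simp: nonneg)
  show ?thesis
    unfolding eq conv_def set_lebesgue_integral_def real_scaleR_def
    by (rule nn_integral_eq_integral)
      (use i in \<open>auto simp: indicator_def nonneg set_integrable_def\<close>)
qed

text \<open>\<open>laplace_conv\<close> grants convergence of the integral for almost every y. Where
  it diverges, \<open>nnconv\<close> is infinite while \<open>conv\<close> is 0 by default. For y
  \<le> 0 both sides vanish.\<close>

lemma AE_nnconv_eq_pos_part_conv:
  assumes nonneg: "\<And>x. x > 0 \<Longrightarrow> p x \<ge> 0" "\<And>x. x > 0 \<Longrightarrow> q x \<ge> 0"
    and "laplace_integrable p" "laplace_integrable q"
  shows "AE y in lborel. nnconv (pos_part p) (pos_part q) y = pos_part (conv p q) y"
  using laplace_conv(1)[OF assms(3,4)]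
proof eventually_elim
  case (elim y)
  show ?case
  proof (cases "y > 0")
    case True
    have "nnconv (pos_part p) (pos_part q) y = ennreal (conv p q y)"
      by (rule nnconv_eq_conv) (use nonneg elim True in auto)
    then show ?thesis using True by (simp add: pos_part_def)
  next
    case False
    have "nnconv (pos_part p) (pos_part q) y = (\<integral>\<^sup>+(z::real). 0 \<partial>lborel)"
      unfolding nnconv_def
      by (rule nn_integral_cong) (use False in \<open>auto simp: pos_part_def indicator_def\<close>)
    then show ?thesis using False by (simp add: pos_part_def)
  qed
qed

lemma conv_nonneg:
  "(\<And>x. x > 0 \<Longrightarrow> p x \<ge> 0) \<Longrightarrow> (\<And>x. x > 0 \<Longrightarrow> q x \<ge> 0) \<Longrightarrow> conv p q y \<ge> 0"
  unfolding conv_def set_lebesgue_integral_def by (intro Bochner_Integration.integral_nonneg) (auto simp: indicator_def)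

lemma conv_one: "conv p (\<lambda>_. 1) y = (LBINT z:{0<..<y}. p z)"
  by (subst conv_reflect) (simp add: conv_def)

section \<open>Existence: the density solves the equation\<close>

context subordinated
begin

lemma addend_density_laplace:
  assumes "a > 0"
  shows "laplace_integrable (addend_density S a h)"
    and "\<theta> > 0 \<Longrightarrow> laplace (addend_density S a h) \<theta> = a / (a + g \<theta>)"
proof -
  have i: "laplace_integrable (\<lambda>y. a * moment a 0 y)"
    by (intro laplace_integrable_cmult laplace_integrable_moment assms)
  have m: "(\<lambda>y. indicator {0<..} y * addend_density S a h y) \<in> borel_measurable borel"
    by measurable
  show "laplace_integrable (addend_density S a h)"
    by (rule laplace_integrable_cong_AE[OF i m]) (simp add: addend_density_eq)
  have "laplace (addend_density S a h) \<theta> = laplace (\<lambda>y. a * moment a 0 y) \<theta>"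
    by (rule laplace_cong) (simp add: addend_density_eq)
  then show "\<theta> > 0 \<Longrightarrow> laplace (addend_density S a h) \<theta> = a / (a + g \<theta>)"
    using laplace_moment(2)[OF assms, of \<theta> 0] by (simp add: laplace_cmult)
qed

text \<open>Both sides have transform (a / (a + g \<theta>))^2. This is the resolvent equation in
  integrated form: it identifies the derivative of the potential density in \<open>a\<close> with a
  self-convolution.\<close>

lemma AE_self_convolution:
  assumes "a > 0"
  shows "AE y in lborel. y > 0 \<longrightarrow>
    conv (addend_density S a h) (addend_density S a h) y = a\<^sup>2 * moment a 1 y"
proof (rule laplace_eq_imp_AE_eq)
  note f = addend_density_laplace[OF assms]
  show "laplace_integrable (conv (addend_density S a h) (addend_density S a h))"
    by (rule laplace_conv(2)[OF f(1) f(1)])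
  show "laplace_integrable (\<lambda>y. a\<^sup>2 * moment a 1 y)"
    by (intro laplace_integrable_cmult laplace_integrable_moment assms)
  show "laplace (conv (addend_density S a h) (addend_density S a h)) \<theta> = laplace (\<lambda>y. a\<^sup>2 * moment a 1 y) \<theta>"
    if "\<theta> > 0" for \<theta>
    using laplace_conv(3)[OF f(1) f(1) that] f(2)[OF that] laplace_moment(2)[OF assms, of \<theta> 1] that
    by (simp add: laplace_cmult power2_eq_square)
qed

text \<open>The trivial case corresponds to a unit point mass at \<open>0\<close> in place of the tail \<open>\<nu>\<close>.\<close>

definition tail_conv :: "real \<Rightarrow> real \<Rightarrow> real" where
  "tail_conv a = (case S of Drift \<Rightarrow> addend_density S a h | Levy N \<Rightarrow> conv (addend_density S a h) (levy_tail N))"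

lemma tail_conv_laplace:
  assumes "a > 0"
  shows "laplace_integrable (tail_conv a)"
    and "\<theta> > 0 \<Longrightarrow> laplace (tail_conv a) \<theta> = a / (a + g \<theta>) * g \<theta> / \<theta>"
proof -
  note f = addend_density_laplace[OF assms]
  have "laplace_integrable (tail_conv a) \<and> (\<theta> > 0 \<longrightarrow> laplace (tail_conv a) \<theta> = a / (a + g \<theta>) * g \<theta> / \<theta>)"
  proof (cases S)
    case Drift
    have "g \<theta> = \<theta>" for \<theta> by (simp add: Drift)
    moreover have "tail_conv a = addend_density S a h" unfolding tail_conv_def by (simp add: Drift)
    ultimately show ?thesis using f by simp
  next
    case (Levy N)
    then have N: "levy_measure N" using wf by simp
    have g: "g \<theta> = bernstein_fun (Levy N) \<theta>" for \<theta> by (simp only: Levy)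
    have "tail_conv a = conv (addend_density S a h) (levy_tail N)" unfolding tail_conv_def by (simp add: Levy)
    then show ?thesis
      using laplace_conv(2,3)[OF f(1) laplace_levy_tail(1)[OF N]] f(2) laplace_levy_tail(2)[OF N] g
      by simp
  qed
  then show "laplace_integrable (tail_conv a)"
    "\<theta> > 0 \<Longrightarrow> laplace (tail_conv a) \<theta> = a / (a + g \<theta>) * g \<theta> / \<theta>" by auto
qed

text \<open>The renewal-type identity. The left side has the transform a / (a + g \<theta>) times (g
  \<theta> + a) / \<theta>, which collapses to a / \<theta>.\<close>

lemma AE_tail_conv:
  assumes "a > 0"
  shows "AE y in lborel. y > 0 \<longrightarrow> tail_conv a y + a * conv (addend_density S a h) (\<lambda>_. 1) y = a"
proof (rule laplace_eq_imp_AE_eq)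
  note f = addend_density_laplace[OF assms] and t = tail_conv_laplace[OF assms]
  note c = laplace_conv(2,3)[OF f(1) laplace_integrable_const[of 1]]
  note ci = laplace_integrable_cmult[OF c(1), of a]
  show "laplace_integrable (\<lambda>y. tail_conv a y + a * conv (addend_density S a h) (\<lambda>_. 1) y)"
    by (intro laplace_integrable_add t ci)
  show "laplace_integrable (\<lambda>_. a)" by (rule laplace_integrable_const)
  fix \<theta> :: real assume "\<theta> > 0"
  then have "a + g \<theta> > 0" using g_nonneg[of \<theta>] assms by simp
  have "laplace (\<lambda>y. tail_conv a y + a * conv (addend_density S a h) (\<lambda>_. 1) y) \<theta>
    = a / (a + g \<theta>) * g \<theta> / \<theta> + a * (a / (a + g \<theta>) * (1 / \<theta>))"
    using \<open>\<theta> > 0\<close> by (subst laplace_add[OF t(1) ci]) (simp_all add: laplace_cmult t(2) c(2) f(2) laplace_const)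
  also have "\<dots> = a / \<theta>"
    using \<open>\<theta> > 0\<close> less_imp_neq[OF \<open>a + g \<theta> > 0\<close>]
    by (simp add: add_divide_distrib[symmetric] distrib_left[symmetric] add.commute)
  finally show "laplace (\<lambda>y. tail_conv a y + a * conv (addend_density S a h) (\<lambda>_. 1) y) \<theta> = laplace (\<lambda>_. a) \<theta>"
    using \<open>\<theta> > 0\<close> by (simp add: laplace_const)
qed

text \<open>The renewal-type identity holds only almost everywhere. Convolutions with values in
  \<open>[0,\<infinity>]\<close> are associative at every point and insensitive to null sets, so that one more
  convolution with \<open>f\<close> turns it into an identity at every \<open>y > 0\<close>.\<close>

lemma self_convolution_primitive:
  assumes "a > 0"
  defines "f \<equiv> addend_density S a h"
  defines "u \<equiv> conv f f"
  shows "conv_caputo_primitive S u (\<lambda>y. a * f y - a * u y)"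
proof -
  have f: "laplace_integrable f" unfolding f_def by (rule addend_density_laplace[OF assms(1)])
  have u: "laplace_integrable u" unfolding u_def by (rule laplace_conv(2)[OF f f])
  have f0: "f x \<ge> 0" for x unfolding f_def by (rule addend_density_nonneg[OF assms(1)])
  have u0: "u x \<ge> 0" for x unfolding u_def by (intro conv_nonneg f0)
  have "u 0 = 0" by (simp add: u_def conv_def set_lebesgue_integral_def)
  note fm = laplace_integrable_measurable[OF f] and um = laplace_integrable_measurable[OF u]
  have om: "(\<lambda>x :: real. indicat_real {0<..} x * 1) \<in> borel_measurable borel" by simp
  note [measurable] = pos_part_measurable[OF fm] pos_part_measurable[OF um] pos_part_measurable[OF om]
  let ?f = "pos_part f" and ?u = "pos_part u" and ?one = "pos_part (\<lambda>_. 1)"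
  have ff: "AE y in lborel. nnconv ?f ?f y = ?u y"
    unfolding u_def by (rule AE_nnconv_eq_pos_part_conv[OF f0 f0 f f])
  have f1: "AE y in lborel. nnconv ?f ?one y = pos_part (conv f (\<lambda>_. 1)) y"
    by (rule AE_nnconv_eq_pos_part_conv) (auto simp: f0 f laplace_integrable_const)
  \<comment> \<open>\<open>r\<close> is any measurable representative of f * \<nu>:
    \<open>?f\<close> in the trivial case, \<open>nnconv ?f ?n\<close> otherwise. Leaving it free
    lets the caller pick the one for which associativity holds at every point.\<close>
  have prim: "m + ennreal a * nnconv ?u ?one y = ennreal a * nnconv ?f ?one y"
    if [measurable]: "r \<in> borel_measurable borel" and r: "AE y in lborel. r y = pos_part (tail_conv a) y"
      and m: "m = nnconv ?f r y" for m r y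
  proof -
    have t0: "tail_conv a y \<ge> 0" for y
      unfolding tail_conv_def using f0[unfolded f_def] levy_tail_nonneg
      by (auto split: bernstein.split intro: conv_nonneg)
    have "AE y in lborel. r y + ennreal a * nnconv ?f ?one y = ennreal a * ?one y"
      using r f1 AE_tail_conv[OF assms(1)]
    proof eventually_elim
      case (elim y)
      show ?case
      proof (cases "y > 0")
        case True
        then show ?thesis
          using elim t0[of y] conv_nonneg[of f "\<lambda>_. 1" y] f0 assms(1)
          by (simp add: pos_part_def f_def ennreal_mult[symmetric] ennreal_plus[symmetric] del: ennreal_plus)
      qed (use elim in \<open>simp add: pos_part_def\<close>)
    qed
    then have "nnconv ?f (\<lambda>y. r y + ennreal a * nnconv ?f ?one y) y = nnconv ?f (\<lambda>y. ennreal a * ?one y) y"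
      by (intro nnconv_cong_AE) auto
    then have "nnconv ?f r y + ennreal a * nnconv ?f (nnconv ?f ?one) y = ennreal a * nnconv ?f ?one y"
      by (simp add: nnconv_add_right nnconv_cmult_right)
    also have "nnconv ?f (nnconv ?f ?one) y = nnconv (nnconv ?f ?f) ?one y"
      by (rule nnconv_assoc[symmetric]) auto
    also have "\<dots> = nnconv ?u ?one y"
      using ff by (intro nnconv_cong_AE) auto
    finally show ?thesis using m by simp
  qed
  have f_one: "set_integrable lborel {0<..<y} (\<lambda>z. f (y - z) * 1)" for y
  proof -
    have "set_integrable lborel {0<..<y} f" by (rule laplace_integrable_imp_set_integrable[OF f])
    then have "integrable lborel (\<lambda>z. indicator {0<..<y} z * f z)" by (simp add: set_integrable_def)
    from lborel_integrable_real_affine[OF this, of "-1" y]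
    have "integrable lborel (\<lambda>z. indicator {0<..<y} (y - z) * f (y - z))" by simp
    also have "(\<lambda>z. indicator {0<..<y} (y - z) * f (y - z)) = (\<lambda>z. indicator {0<..<y} z *\<^sub>R (f (y - z) * 1))"
      by (auto simp: indicator_def fun_eq_iff)
    finally show ?thesis by (simp add: set_integrable_def)
  qed
  have fin: "nnconv ?f ?one y = ennreal (LBINT z:{0<..<y}. f z)" for y
    using nnconv_eq_conv[OF f0 _ f_one, of y] by (simp add: conv_one)
  \<comment> \<open>Both terms on the left of \<open>prim\<close> are bounded by \<open>a\<close>
    times the integral of f over (0,y). They are therefore finite, and the identity can be read as a
    subtraction of real numbers.\<close>
  have main: "m < \<infinity> \<and> enn2real m = (LBINT z:{0<..<y}. a * f z - a * u z)"
    if "r \<in> borel_measurable borel" "AE y in lborel. r y = pos_part (tail_conv a) y" "m = nnconv ?f r y" for m r y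
  proof -
    let ?F = "LBINT z:{0<..<y}. f z" and ?U = "LBINT z:{0<..<y}. u z"
    have F: "?F \<ge> 0" and U: "?U \<ge> 0"
      unfolding set_lebesgue_integral_def by (auto intro!: Bochner_Integration.integral_nonneg simp: f0 u0)
    have eq: "m + ennreal a * nnconv ?u ?one y = ennreal (a * ?F)"
      using prim[OF that] F assms(1) unfolding fin by (simp add: ennreal_mult)
    have "ennreal a * nnconv ?u ?one y \<le> ennreal (a * ?F)" "m \<le> ennreal (a * ?F)"
      unfolding eq[symmetric] by simp_all
    then have "ennreal a * nnconv ?u ?one y < \<infinity>" "m < \<infinity>"
      by (auto intro: le_less_trans[OF _ ennreal_less_top])
    then have "nnconv ?u ?one y < \<infinity>"
      using assms(1) by (auto simp: ennreal_mult_less_top)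
    from conv_eq_if_nnconv_finite(2)[OF u0 _ um om this]
    have "nnconv ?u ?one y = ennreal ?U"
      by (simp add: conv_one)
    then have "m + ennreal (a * ?U) = ennreal (a * ?F)"
      using eq assms(1) U by (simp add: ennreal_mult)
    then have "enn2real m + a * ?U = a * ?F"
      using \<open>m < \<infinity>\<close> F U assms(1)
      by (cases m) (auto simp: ennreal_plus[symmetric] simp del: ennreal_plus)
    moreover have "(LBINT z:{0<..<y}. a * f z - a * u z) = a * ?F - a * ?U"
      using laplace_integrable_imp_set_integrable[OF f] laplace_integrable_imp_set_integrable[OF u]
      by (subst set_integral_diff) auto
    ultimately show ?thesis using \<open>m < \<infinity>\<close> by simp
  qed
  have v: "set_integrable lborel {0<..<y} (\<lambda>z. a * f z - a * u z)" for y
    using laplace_integrable_imp_set_integrable[OF f] laplace_integrable_imp_set_integrable[OF u]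
    by (intro set_integral_diff) auto
  show ?thesis
  proof (cases S)
    case Drift
    have t: "tail_conv a = f" unfolding tail_conv_def f_def by (simp add: Drift)
    have "(LBINT z:{0<..<y}. a * f z - a * u z) = u y - u 0" if "y > 0" for y
    proof -
      have *: "nnconv ?f ?f y < \<infinity> \<and> enn2real (nnconv ?f ?f y) = (LBINT z:{0<..<y}. a * f z - a * u z)"
        by (rule main) (auto simp: t)
      then have "ennreal (u y) = nnconv ?f ?f y"
        unfolding u_def by (intro conv_eq_if_nnconv_finite(2)) (auto simp: f0 fm)
      with * u0[of y] show ?thesis by (metis \<open>u 0 = 0\<close> diff_zero enn2real_ennreal)
    qed
    then show ?thesis using v by (simp add: conv_caputo_primitive_def Drift)
  next
    case (Levy N)
    then have N: "levy_measure N" using wf by simp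
    let ?n = "pos_part (levy_tail N)"
    note nm = levy_tail_measurable_Ioi[OF N]
    note [measurable] = pos_part_measurable[OF nm]
    have t: "tail_conv a = conv f (levy_tail N)" unfolding tail_conv_def f_def by (simp add: Levy)
    have "set_integrable lborel {0<..<y} (\<lambda>s. (u (y - s) - u 0) * levy_tail N s) \<and>
        (LBINT z:{0<..<y}. a * f z - a * u z) = (LBINT s:{0<..<y}. (u (y - s) - u 0) * levy_tail N s)" if "y > 0" for y
    proof -
      have *: "nnconv ?u ?n y < \<infinity> \<and> enn2real (nnconv ?u ?n y) = (LBINT z:{0<..<y}. a * f z - a * u z)"
      proof -
        have 1: "AE y in lborel. nnconv ?f ?n y = pos_part (tail_conv a) y"
          unfolding t by (rule AE_nnconv_eq_pos_part_conv[OF f0 levy_tail_nonneg f laplace_levy_tail(1)[OF N]])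
        \<comment> \<open>Reassociation at this very \<open>y\<close> exhibits f * \<nu> as a
          factor, to which the renewal-type identity applies.\<close>
        have "nnconv ?u ?n y = nnconv (nnconv ?f ?f) ?n y"
          using ff by (intro nnconv_cong_AE) auto
        also have "\<dots> = nnconv ?f (nnconv ?f ?n) y"
          by (rule nnconv_assoc) auto
        finally show ?thesis by (intro main[OF _ 1]) simp_all
      qed
      then have fin: "nnconv ?u ?n y < \<infinity>" by blast
      note c = conv_eq_if_nnconv_finite[OF u0 levy_tail_nonneg um nm fin]
      have "conv u (levy_tail N) y \<ge> 0" by (intro conv_nonneg u0 levy_tail_nonneg)
      with c(2) * have "conv u (levy_tail N) y = (LBINT z:{0<..<y}. a * f z - a * u z)"
        by (metis enn2real_ennreal)
      then show ?thesis using c(1) by (simp add: conv_def \<open>u 0 = 0\<close>)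
    qed
    then show ?thesis using v by (simp add: conv_caputo_primitive_def Levy)
  qed
qed

text \<open>Chain rule for a moment(a) along a(t) = \<xi> exp (- lam t), where a' = - lam a. The
  exceptional set of y is the one of \<open>AE_kernel_integrable\<close>, hence the same for all
  t.\<close>

lemma AE_density_has_derivative:
  fixes lam \<xi> :: real
  assumes "\<xi> > 0"
  shows "AE y in lborel. y > 0 \<longrightarrow> (\<forall>t. ((\<lambda>t. addend_density S (\<xi> * exp (- lam * t)) h y) has_real_derivative
    - lam * (\<xi> * exp (- lam * t)) * (moment (\<xi> * exp (- lam * t)) 0 y - \<xi> * exp (- lam * t) * moment (\<xi> * exp (- lam * t)) 1 y)) (at t))"
  using AE_kernel_integrable
proof (eventually_elim, intro impI allI)
  fix y t :: real
  assume int: "y > 0 \<longrightarrow> (\<forall>a>0. \<forall>k. integrable (kernel y) (\<lambda>s. s ^ k * exp (- a * s)))" and "y > 0"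
  define a where "a t = \<xi> * exp (- lam * t)" for t
  have pos: "a t > 0" for t using assms by (simp add: a_def)
  have a': "(a has_real_derivative - lam * a t) (at t)"
    unfolding a_def[abs_def] by (auto intro!: derivative_eq_intros)
  have m: "((\<lambda>t. moment (a t) 0 y) has_real_derivative - moment (a t) 1 y * (- lam * a t)) (at t)"
    by (rule DERIV_chain2[OF moment_has_derivative a']) (use int \<open>y > 0\<close> pos in auto)
  have "((\<lambda>t. a t * moment (a t) 0 y) has_real_derivative - lam * a t * (moment (a t) 0 y - a t * moment (a t) 1 y)) (at t)"
    by (rule derivative_eq_intros a' m refl)+ (simp add: algebra_simps)
  then show "((\<lambda>t. addend_density S (\<xi> * exp (- lam * t)) h y) has_real_derivative
    - lam * (\<xi> * exp (- lam * t)) * (moment (\<xi> * exp (- lam * t)) 0 y - \<xi> * exp (- lam * t) * moment (\<xi> * exp (- lam * t)) 1 y)) (at t)"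
    unfolding a_def addend_density_eq[OF \<open>y > 0\<close>] .
qed

lemma moment_antimono:
  assumes int: "\<forall>a>0. \<forall>k. integrable (kernel y) (\<lambda>s. s ^ k * exp (- a * s))"
    and "y > 0" "0 < a" "a \<le> b"
  shows "moment b k y \<le> moment a k y"
  unfolding moment_def
proof (rule integral_mono_AE)
  show "integrable (kernel y) (\<lambda>s. s ^ k * exp (- b * s))" "integrable (kernel y) (\<lambda>s. s ^ k * exp (- a * s))"
    using int assms by auto
  show "AE s in kernel y. s ^ k * exp (- b * s) \<le> s ^ k * exp (- a * s)"
    using AE_kernel_pos[OF \<open>y > 0\<close>]
    by eventually_elim (use \<open>a \<le> b\<close> in \<open>auto intro!: mult_left_mono mult_right_mono\<close>)
qed

lemma density_solves_birth_equation:
  assumes "lam > 0" "\<xi> > 0"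
  shows "solves_birth_equation S lam \<xi> (addend_density S \<xi> h)
    (\<lambda>y t. addend_density S (\<xi> * exp (- lam * t)) h y)"
  unfolding solves_birth_equation_def
proof (intro conjI allI impI)
  define a where "a t = \<xi> * exp (- lam * t)" for t
  have pos: "a t > 0" for t using assms by (simp add: a_def)
  let ?F = "\<lambda>y t. addend_density S (\<xi> * exp (- lam * t)) h y"
  note deriv = AE_density_has_derivative[OF assms(2), of lam, folded a_def]
  have moment_int: "set_integrable lborel {0<..} (moment b k)" if "b > 0" for b k
    using laplace_moment(1)[OF that, of 0 k] by simp
  show "set_integrable lborel {0<..} (\<lambda>y. ?F y t)" for t
  proof -
    have "set_integrable lborel {0<..} (\<lambda>y. a t * moment (a t) 0 y)"
      using moment_int[OF pos] by simp
    then show ?thesis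
      unfolding a_def[symmetric]
      by (rule set_integrable_cong[THEN iffD1, rotated 3]) (auto simp: addend_density_eq)
  qed
  show "\<exists>G. set_integrable lborel {0<..} G \<and> (AE y in lborel. y > 0 \<longrightarrow>
      (\<forall>t\<in>{0<..T}. ?F y differentiable (at t) \<and> \<bar>deriv (?F y) t\<bar> \<le> G y))" if "T > 0" for T
  proof (intro exI conjI)
    \<comment> \<open>On (0,T] the parameter a(t) lies between a(T) and \<xi>, and moments decrease
      in their parameter: so the moments are taken at a(T) and the prefactors are bounded by
      \<xi>.\<close>
    let ?G = "\<lambda>y. lam * \<xi> * moment (a T) 0 y + lam * \<xi> * \<xi> * moment (a T) 1 y"
    show "set_integrable lborel {0<..} ?G"
      using moment_int[OF pos] by (intro set_integral_add) auto
    show "AE y in lborel. y > 0 \<longrightarrow> (\<forall>t\<in>{0<..T}. ?F y differentiable (at t) \<and> \<bar>deriv (?F y) t\<bar> \<le> ?G y)"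
      using deriv AE_kernel_integrable
    proof (eventually_elim, intro impI ballI)
      fix y t
      assume D: "y > 0 \<longrightarrow> (\<forall>t. ((\<lambda>t. addend_density S (a t) h y) has_real_derivative
          - lam * a t * (moment (a t) 0 y - a t * moment (a t) 1 y)) (at t))"
        and int: "y > 0 \<longrightarrow> (\<forall>a>0. \<forall>k. integrable (kernel y) (\<lambda>s. s ^ k * exp (- a * s)))"
        and "y > 0" and t: "t \<in> {0<..T}"
      have D': "(?F y has_real_derivative - lam * a t * (moment (a t) 0 y - a t * moment (a t) 1 y)) (at t)"
        using D \<open>y > 0\<close> unfolding a_def by blast
      have le: "a T \<le> a t" "a t \<le> \<xi>"
        using t assms by (auto simp: a_def mult_left_le)
      have mono: "moment (a t) k y \<le> moment (a T) k y" for k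
        using int \<open>y > 0\<close> le(1) by (intro moment_antimono pos) auto
      have nn: "0 \<le> moment (a t) k y" for k using \<open>y > 0\<close> by (rule moment_nonneg)
      have "\<bar>- lam * a t * (moment (a t) 0 y - a t * moment (a t) 1 y)\<bar>
          \<le> lam * a t * (moment (a t) 0 y + a t * moment (a t) 1 y)"
        using assms pos[of t] nn by (auto simp: abs_mult intro!: mult_left_mono abs_leI)
      also have "\<dots> \<le> lam * \<xi> * (moment (a T) 0 y + \<xi> * moment (a T) 1 y)"
        using assms le pos[of t] nn mono by (intro mult_mono add_mono) (auto intro: mult_nonneg_nonneg add_nonneg_nonneg)
      also have "\<dots> = ?G y" by (simp add: algebra_simps)
      finally have "\<bar>deriv (?F y) t\<bar> \<le> ?G y"
        unfolding DERIV_imp_deriv[OF D'] .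
      then show "?F y differentiable (at t) \<and> \<bar>deriv (?F y) t\<bar> \<le> ?G y"
        using D' by (auto simp: real_differentiable_def)
    qed
  qed
  show "AE y in lborel. y > 0 \<longrightarrow> continuous (at_right 0) (?F y)"
    using deriv
  proof (eventually_elim, intro impI)
    fix y assume "y > 0 \<longrightarrow> (\<forall>t. ((\<lambda>t. addend_density S (a t) h y) has_real_derivative
          - lam * a t * (moment (a t) 0 y - a t * moment (a t) 1 y)) (at t))" "y > 0"
    then have "continuous (at 0) (\<lambda>t. addend_density S (a t) h y)"
      by (blast intro: DERIV_isCont)
    then show "continuous (at_right 0) (?F y)"
      unfolding a_def by (rule continuous_at_imp_continuous_at_within)
  qed
  show "\<exists>v. conv_caputo_of S (\<lambda>y. space_conv ?F y t) v \<and>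
      (AE y in lborel. y > 0 \<longrightarrow> (?F y has_real_derivative - lam * (exp (lam * t) / \<xi>) * v y) (at t))" if "t > 0" for t
  proof (intro exI conjI)
    let ?f = "addend_density S (a t) h"
    have u: "(\<lambda>y. space_conv ?F y t) = conv ?f ?f"
      by (simp add: space_conv_def conv_def fun_eq_iff a_def)
    \<comment> \<open>The derivative is v = a (f - f * f). As exp (lam t) / \<xi> is 1 / a, the
      right side of the equation becomes - lam (f - f * f), and \<open>AE_self_convolution\<close>
      recognises this as the time derivative of f.\<close>
    show "conv_caputo_of S (\<lambda>y. space_conv ?F y t) (\<lambda>y. a t * ?f y - a t * conv ?f ?f y)"
      unfolding u by (intro conv_caputo_of_primitive wf self_convolution_primitive pos)
    have e: "exp (lam * t) / \<xi> = 1 / a t"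
      by (simp add: a_def exp_minus field_simps)
    show "AE y in lborel. y > 0 \<longrightarrow> (?F y has_real_derivative
        - lam * (exp (lam * t) / \<xi>) * (a t * ?f y - a t * conv ?f ?f y)) (at t)"
      using deriv AE_self_convolution[OF pos, of t]
    proof (eventually_elim, intro impI)
      fix y assume D: "y > 0 \<longrightarrow> (\<forall>t. ((\<lambda>t. addend_density S (a t) h y) has_real_derivative
          - lam * a t * (moment (a t) 0 y - a t * moment (a t) 1 y)) (at t))"
        and c: "y > 0 \<longrightarrow> conv ?f ?f y = (a t)\<^sup>2 * moment (a t) 1 y" and "y > 0"
      have "- lam * (exp (lam * t) / \<xi>) * (a t * ?f y - a t * conv ?f ?f y)
        = - lam * a t * (moment (a t) 0 y - a t * moment (a t) 1 y)"
        unfolding e using c \<open>y > 0\<close> pos[of t] by (simp add: addend_density_eq power2_eq_square field_simps)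
      then show "(?F y has_real_derivative
        - lam * (exp (lam * t) / \<xi>) * (a t * ?f y - a t * conv ?f ?f y)) (at t)"
        using D \<open>y > 0\<close> unfolding a_def by metis
    qed
  qed
  show "addend_density S (\<xi> * exp (- lam * 0)) h y = addend_density S \<xi> h y" for y by simp
qed

end

section \<open>Uniqueness: the Riccati equation for the Laplace transform\<close>

text \<open>Mean value theorem on [s,t]. Right continuity at 0 admits the end point 0, where no
  derivative is assumed.\<close>

lemma lipschitz_of_deriv_bound:
  fixes f :: "real \<Rightarrow> real"
  assumes "continuous (at_right 0) f"
    and d: "\<And>t. t \<in> {0<..T} \<Longrightarrow> f differentiable (at t) \<and> \<bar>deriv f t\<bar> \<le> G"
    and st: "s \<in> {0..T}" "t \<in> {0..T}"
  shows "\<bar>f t - f s\<bar> \<le> G * \<bar>t - s\<bar>"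
proof -
  have *: "\<bar>f t - f s\<bar> \<le> G * \<bar>t - s\<bar>" if "0 \<le> s" "s < t" "t \<le> T" for s t
  proof -
    have 1: "continuous_on {s..t} f"
      unfolding continuous_on_eq_continuous_within
    proof
      fix x assume x: "x \<in> {s..t}"
      show "continuous (at x within {s..t}) f"
      proof (cases "x = 0")
        case True
        then have "s = 0" using x \<open>0 \<le> s\<close> by simp
        have "continuous (at x within {0..}) f"
          unfolding True at_within_Ici_at_right by (rule assms(1))
        then show ?thesis by (rule continuous_within_subset) (use \<open>s = 0\<close> in auto)
      next
        case False
        then have "x \<in> {0<..T}" using x \<open>0 \<le> s\<close> \<open>t \<le> T\<close> by simp
        from d[OF this] have "f differentiable (at x)" by (rule conjunct1)
        then have "continuous (at x) f" by (rule differentiable_imp_continuous_within)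
        then show ?thesis by (rule continuous_at_imp_continuous_at_within)
      qed
    qed
    have 2: "f differentiable (at x)" if "s < x" "x < t" for x
    proof -
      have "x \<in> {0<..T}" using that \<open>0 \<le> s\<close> \<open>t \<le> T\<close> by simp
      from d[OF this] show ?thesis by (rule conjunct1)
    qed
    have "\<exists>l z. s < z \<and> z < t \<and> DERIV f z :> l \<and> f t - f s = (t - s) * l"
      by (rule MVT[OF \<open>s < t\<close> 1]) (rule 2)
    then obtain l z
      where z: "s < z" "z < t" "DERIV f z :> l" "f t - f s = (t - s) * l"
      by (elim exE conjE) (rule that)
    have "z \<in> {0<..T}" using z(1,2) that by simp
    from d[OF this] have "\<bar>l\<bar> \<le> G" unfolding DERIV_imp_deriv[OF z(3)] by (rule conjunct2)
    then have "\<bar>l\<bar> * \<bar>t - s\<bar> \<le> G * \<bar>t - s\<bar>" by (rule mult_right_mono) simp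
    then show ?thesis unfolding z(4) abs_mult by (simp only: mult.commute)
  qed
  show ?thesis
  proof (cases s t rule: linorder_cases)
    case less
    then show ?thesis using st by (intro *) auto
  next
    case greater
    then have "\<bar>f s - f t\<bar> \<le> G * \<bar>s - t\<bar>" using st by (intro *) auto
    then show ?thesis by (simp only: abs_minus_commute)
  qed simp
qed

text \<open>The comparison is made between primitives: convolution with 1 contributes 1/\<theta> to
  one side, the tail contributes g(\<theta>)/\<theta> to the other (a factor 1 in the trivial case).
  The condition u 0 = 0 removes the boundary term.\<close>

lemma caputo_primitive_laplace:
  assumes S: "wf_bernstein S" and u: "laplace_integrable u" "u 0 = 0"
    and w: "laplace_integrable w" and prim: "conv_caputo_primitive S u w" and "\<theta> > 0"
  shows "laplace w \<theta> = bernstein_fun S \<theta> * laplace u \<theta>"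
proof -
  have one: "laplace (conv (\<lambda>_. 1) w) \<theta> = laplace w \<theta> / \<theta>"
    using laplace_conv(3)[OF laplace_integrable_const w \<open>\<theta> > 0\<close>] \<open>\<theta> > 0\<close> by (simp add: laplace_const)
  have "laplace (conv (\<lambda>_. 1) w) \<theta> = bernstein_fun S \<theta> / \<theta> * laplace u \<theta>"
  proof (cases S)
    case Drift
    have "laplace (conv (\<lambda>_. 1) w) \<theta> = laplace u \<theta>"
      by (rule laplace_cong) (use conv_caputo_primitiveD(2)[OF prim] in \<open>simp add: conv_def Drift u(2)\<close>)
    then show ?thesis using \<open>\<theta> > 0\<close> by (simp add: Drift)
  next
    case (Levy N)
    then have N: "levy_measure N" using S by simp
    have "laplace (conv (\<lambda>_. 1) w) \<theta> = laplace (conv u (levy_tail N)) \<theta>"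
      by (rule laplace_cong) (use conv_caputo_primitiveD(2)[OF prim] in \<open>simp add: conv_def Levy u(2)\<close>)
    then show ?thesis
      using laplace_conv(3)[OF u(1) laplace_levy_tail(1)[OF N] \<open>\<theta> > 0\<close>] laplace_levy_tail(2)[OF N \<open>\<theta> > 0\<close>]
      unfolding Levy by simp
  qed
  then show ?thesis unfolding one using \<open>\<theta> > 0\<close> by simp
qed

lemma solves_birth_equationD:
  assumes "solves_birth_equation S lam \<xi> f0 f"
  shows "\<forall>t\<ge>0. set_integrable lborel {0<..} (\<lambda>y. f y t)"
    and "\<forall>T>0. \<exists>G. set_integrable lborel {0<..} G \<and>
        (AE y in lborel. y > 0 \<longrightarrow> (\<forall>t\<in>{0<..T}. f y differentiable (at t) \<and> \<bar>deriv (f y) t\<bar> \<le> G y))"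
    and "AE y in lborel. y > 0 \<longrightarrow> continuous (at_right 0) (f y)"
    and "\<forall>t>0. \<exists>v. conv_caputo_of S (\<lambda>y. space_conv f y t) v \<and>
        (AE y in lborel. y > 0 \<longrightarrow>
           (f y has_real_derivative (- lam * (exp (lam * t) / \<xi>) * v y)) (at t))"
    and "\<forall>y>0. f y 0 = f0 y"
proof -
  note d = assms[unfolded solves_birth_equation_def]
  note d2 = conjunct2[OF d] and d3 = conjunct2[OF conjunct2[OF d]]
  note d4 = conjunct2[OF d3]
  show "\<forall>t\<ge>0. set_integrable lborel {0<..} (\<lambda>y. f y t)"
    by (rule conjunct1[OF d])
  show "\<forall>T>0. \<exists>G. set_integrable lborel {0<..} G \<and>
      (AE y in lborel. y > 0 \<longrightarrow> (\<forall>t\<in>{0<..T}. f y differentiable (at t) \<and> \<bar>deriv (f y) t\<bar> \<le> G y))"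
    by (rule conjunct1[OF d2])
  show "AE y in lborel. y > 0 \<longrightarrow> continuous (at_right 0) (f y)"
    by (rule conjunct1[OF d3])
  show "\<forall>t>0. \<exists>v. conv_caputo_of S (\<lambda>y. space_conv f y t) v \<and>
      (AE y in lborel. y > 0 \<longrightarrow>
         (f y has_real_derivative (- lam * (exp (lam * t) / \<xi>) * v y)) (at t))"
    by (rule conjunct1[OF d4])
  show "\<forall>y>0. f y 0 = f0 y"
    by (rule conjunct2[OF d4])
qed

text \<open>An increment bound valid from time 0 on; it serves both the continuity of the transform
  up to the initial time and differentiation under the integral.\<close>

lemma solution_AE_lipschitz:
  assumes f: "solves_birth_equation S lam \<xi> f0 f" and "T > 0"
  obtains G where "set_integrable lborel {0<..} G"
    and "AE y in lborel. y > 0 \<longrightarrow> (\<forall>s\<in>{0..T}. \<forall>t\<in>{0..T}. \<bar>f y t - f y s\<bar> \<le> G y * \<bar>t - s\<bar>)"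
    and "AE y in lborel. y > 0 \<longrightarrow> (\<forall>t\<in>{0<..T}. \<bar>deriv (f y) t\<bar> \<le> G y)"
proof -
  obtain G where G: "set_integrable lborel {0<..} G"
    and d: "AE y in lborel. y > 0 \<longrightarrow> (\<forall>t\<in>{0<..T}. f y differentiable (at t) \<and> \<bar>deriv (f y) t\<bar> \<le> G y)"
    using solves_birth_equationD(2)[OF f, THEN spec, THEN mp, OF \<open>T > 0\<close>] by (elim exE conjE) (rule that)
  have c: "AE y in lborel. y > 0 \<longrightarrow> continuous (at_right 0) (f y)"
    by (rule solves_birth_equationD(3)[OF f])
  show ?thesis
  proof (rule that[OF G])
    show "AE y in lborel. y > 0 \<longrightarrow> (\<forall>s\<in>{0..T}. \<forall>t\<in>{0..T}. \<bar>f y t - f y s\<bar> \<le> G y * \<bar>t - s\<bar>)"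
      using c d
    proof eventually_elim
      case (elim y)
      then show ?case
        by (intro impI ballI lipschitz_of_deriv_bound[of "f y" T "G y"]) auto
    qed
    show "AE y in lborel. y > 0 \<longrightarrow> (\<forall>t\<in>{0<..T}. \<bar>deriv (f y) t\<bar> \<le> G y)"
      using d by eventually_elim blast
  qed
qed

lemma solution_laplace_integrable:
  assumes f: "solves_birth_equation S lam \<xi> f0 f" and "t \<ge> 0"
  shows "laplace_integrable (\<lambda>y. f y t)"
  using solves_birth_equationD(1)[OF f] \<open>t \<ge> 0\<close> by (intro set_integrable_imp_laplace_integrable) simp

lemma solution_laplace_continuous:
  assumes f: "solves_birth_equation S lam \<xi> f0 f" and "\<theta> > 0" "T > 0"
  shows "continuous_on {0..T} (\<lambda>t. laplace (\<lambda>y. f y t) \<theta>)"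
proof -
  obtain G where G: "set_integrable lborel {0<..} G"
    and lip: "AE y in lborel. y > 0 \<longrightarrow> (\<forall>s\<in>{0..T}. \<forall>t\<in>{0..T}. \<bar>f y t - f y s\<bar> \<le> G y * \<bar>t - s\<bar>)"
    using solution_AE_lipschitz[OF f \<open>T > 0\<close>] by blast
  define K where "K = (\<integral>y. indicator {0<..} y * \<bar>G y\<bar> \<partial>lborel)"
  have iG: "integrable lborel (\<lambda>y. indicator {0<..} y * \<bar>G y\<bar>)"
    using integrable_norm[OF G[unfolded set_integrable_def]] by (simp add: abs_mult)
  have "K \<ge> 0" unfolding K_def by (intro Bochner_Integration.integral_nonneg) auto
  have "\<bar>laplace (\<lambda>y. f y t) \<theta> - laplace (\<lambda>y. f y s) \<theta>\<bar> \<le> K * \<bar>t - s\<bar>"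
    if s: "s \<in> {0..T}" and t: "t \<in> {0..T}" for s t
  proof -
    have i: "integrable lborel (\<lambda>y. indicator {0<..} y * (exp (- \<theta> * y) * f y r))" if "r \<in> {0..T}" for r
      using laplace_integrableD[OF solution_laplace_integrable[OF f] \<open>\<theta> > 0\<close>] that by simp
    have "\<bar>laplace (\<lambda>y. f y t) \<theta> - laplace (\<lambda>y. f y s) \<theta>\<bar>
        = \<bar>\<integral>y. indicator {0<..} y * (exp (- \<theta> * y) * f y t) - indicator {0<..} y * (exp (- \<theta> * y) * f y s) \<partial>lborel\<bar>"
      using i s t by (simp add: laplace_def set_lebesgue_integral_def)
    also have "\<dots> \<le> (\<integral>y. \<bar>indicator {0<..} y * (exp (- \<theta> * y) * f y t) - indicator {0<..} y * (exp (- \<theta> * y) * f y s)\<bar> \<partial>lborel)"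
      by (rule integral_abs_bound)
    also have "\<dots> \<le> (\<integral>y. indicator {0<..} y * \<bar>G y\<bar> * \<bar>t - s\<bar> \<partial>lborel)"
    proof (rule integral_mono_AE)
      show "AE y in lborel. \<bar>indicator {0<..} y * (exp (- \<theta> * y) * f y t) - indicator {0<..} y * (exp (- \<theta> * y) * f y s)\<bar>
          \<le> indicator {0<..} y * \<bar>G y\<bar> * \<bar>t - s\<bar>"
        using lip
      proof eventually_elim
        case (elim y)
        show ?case
        proof (cases "y > 0")
          case True
          have "\<bar>exp (- \<theta> * y) * f y t - exp (- \<theta> * y) * f y s\<bar> = exp (- \<theta> * y) * \<bar>f y t - f y s\<bar>"
            unfolding right_diff_distrib[symmetric] abs_mult by simp
          also have "\<dots> \<le> \<bar>f y t - f y s\<bar>"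
            using True \<open>\<theta> > 0\<close> by (intro mult_left_le_one_le) auto
          also have "\<dots> \<le> G y * \<bar>t - s\<bar>" using elim True s t by blast
          also have "\<dots> \<le> \<bar>G y\<bar> * \<bar>t - s\<bar>" by (intro mult_right_mono) auto
          finally show ?thesis using True by simp
        qed simp
      qed
    qed (use i s t iG in auto)
    also have "\<dots> = K * \<bar>t - s\<bar>" by (simp add: K_def)
    finally show ?thesis .
  qed
  then have "K-lipschitz_on {0..T} (\<lambda>t. laplace (\<lambda>y. f y t) \<theta>)"
    using \<open>K \<ge> 0\<close> by (intro lipschitz_onI) (auto simp: dist_real_def)
  then show ?thesis by (rule lipschitz_on_continuous_on)
qed

lemma solution_laplace_riccati:
  assumes S: "wf_bernstein S" and f: "solves_birth_equation S lam \<xi> f0 f" and "t > 0" "\<theta> > 0"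
    and "lam > 0" "\<xi> > 0"
  shows "((\<lambda>t. laplace (\<lambda>y. f y t) \<theta>) has_real_derivative
    - lam * (exp (lam * t) / \<xi>) * bernstein_fun S \<theta> * (laplace (\<lambda>y. f y t) \<theta>)\<^sup>2) (at t)"
proof -
  define c where "c = - lam * (exp (lam * t) / \<xi>)"
  have "c \<noteq> 0" using \<open>lam > 0\<close> \<open>\<xi> > 0\<close> by (simp add: c_def)
  \<comment> \<open>With the horizon 2 t, all times within distance t of t are covered by the
    bounds.\<close>
  have "2 * t > 0" using \<open>t > 0\<close> by simp
  obtain G where G: "set_integrable lborel {0<..} G"
    and lip: "AE y in lborel. y > 0 \<longrightarrow> (\<forall>s\<in>{0..2 * t}. \<forall>r\<in>{0..2 * t}. \<bar>f y r - f y s\<bar> \<le> G y * \<bar>r - s\<bar>)"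
    and dG: "AE y in lborel. y > 0 \<longrightarrow> (\<forall>s\<in>{0<..2 * t}. \<bar>deriv (f y) s\<bar> \<le> G y)"
    using solution_AE_lipschitz[OF f \<open>2 * t > 0\<close>] by blast
  define u where "u = conv (\<lambda>y. f y t) (\<lambda>y. f y t)"
  have u_eq: "(\<lambda>y. space_conv f y t) = u"
    by (simp add: u_def space_conv_def conv_def fun_eq_iff)
  have fi: "laplace_integrable (\<lambda>y. f y t)"
    using solution_laplace_integrable[OF f] \<open>t > 0\<close> by simp
  have ui: "laplace_integrable u" unfolding u_def by (rule laplace_conv(2)[OF fi fi])
  have u0: "u 0 = 0" by (simp add: u_def conv_def set_lebesgue_integral_def)
  obtain v where v: "conv_caputo_of S u v"
    and vd: "AE y in lborel. y > 0 \<longrightarrow> (f y has_real_derivative c * v y) (at t)"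
    using solves_birth_equationD(4)[OF f, THEN spec, THEN mp, OF \<open>t > 0\<close>] unfolding u_eq c_def[symmetric]
    by (elim exE conjE) (rule that)
  obtain w where w: "conv_caputo_primitive S u w" and vw: "AE y in lborel. y > 0 \<longrightarrow> v y = w y"
    using conv_caputo_ofD[OF S v] by blast
  have wd: "AE y in lborel. y > 0 \<longrightarrow> (f y has_real_derivative c * w y) (at t)"
    using vd vw by eventually_elim auto
  \<comment> \<open>The primitive condition speaks of bounded intervals only, so measurability on
    the half-line is obtained as a limit of truncations.\<close>
  have w_meas: "(\<lambda>y. indicator {0<..} y * w y) \<in> borel_measurable borel"
  proof (rule borel_measurable_LIMSEQ_real)
    show "(\<lambda>y. indicator {0<..<real (Suc n)} y * w y) \<in> borel_measurable borel" for n
      using conv_caputo_primitiveD(1)[OF w, of "real (Suc n)"]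
      by (simp add: set_integrable_def del: of_nat_Suc)
    show "(\<lambda>n. indicator {0<..<real (Suc n)} y * w y) \<longlonglongrightarrow> indicator {0<..} y * w y" for y :: real
    proof (rule tendsto_eventually)
      obtain n0 :: nat where "y < real n0" using reals_Archimedean2 by blast
      then have "y < real (Suc n)" if "n \<ge> n0" for n using that by (simp add: le_less_trans less_le_trans)
      then show "\<forall>\<^sub>F n in sequentially. indicator {0<..<real (Suc n)} y * w y = indicator {0<..} y * w y"
        unfolding eventually_sequentially by (intro exI[of _ n0]) (auto simp: indicator_def simp del: of_nat_Suc)
    qed
  qed
  \<comment> \<open>Integrability up to infinity comes from the time variable: c w is the time
    derivative of f at t, which \<open>G\<close> dominates, and c is not 0.\<close>
  have "set_integrable lborel {0<..} w"
    unfolding set_integrable_def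
  proof (rule Bochner_Integration.integrable_bound)
    show "integrable lborel (\<lambda>y. (1 / \<bar>c\<bar>) * (indicator {0<..} y *\<^sub>R G y))"
      using G by (simp add: set_integrable_def)
    show "(\<lambda>y. indicator {0<..} y *\<^sub>R w y) \<in> borel_measurable lborel"
      using w_meas by simp
    show "AE y in lborel. norm (indicator {0<..} y *\<^sub>R w y) \<le> norm ((1 / \<bar>c\<bar>) * (indicator {0<..} y *\<^sub>R G y))"
      using dG wd
    proof eventually_elim
      case (elim y)
      show ?case
      proof (cases "y > 0")
        case True
        then have "deriv (f y) t = c * w y" using elim by (blast dest: DERIV_imp_deriv)
        moreover have "\<bar>deriv (f y) t\<bar> \<le> G y"
          by (rule mp[OF elim(1) True, THEN bspec]) (use \<open>t > 0\<close> in auto)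
        ultimately have "\<bar>c\<bar> * \<bar>w y\<bar> \<le> \<bar>G y\<bar>"
          by (simp add: abs_mult)
        then show ?thesis using True \<open>c \<noteq> 0\<close> by (simp add: field_simps abs_mult)
      qed simp
    qed
  qed
  then have wi: "laplace_integrable w" by (rule set_integrable_imp_laplace_integrable)
  have "((\<lambda>r. \<integral>y. indicator {0<..} y * (exp (- \<theta> * y) * f y r) \<partial>lborel) has_real_derivative
      (\<integral>y. indicator {0<..} y * (exp (- \<theta> * y) * (c * w y)) \<partial>lborel)) (at t)"
  proof (rule has_real_derivative_lebesgue_integral[OF \<open>t > 0\<close>])
    show "integrable lborel (\<lambda>y. indicator {0<..} y * (exp (- \<theta> * y) * f y r))" if "\<bar>r - t\<bar> < t" for r
      using that by (intro laplace_integrableD solution_laplace_integrable[OF f] \<open>\<theta> > 0\<close>) auto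
    show "integrable lborel (\<lambda>y. indicator {0<..} y *\<^sub>R G y)"
      using G by (simp add: set_integrable_def)
    show "AE y in lborel. \<forall>r. \<bar>r - t\<bar> < t \<longrightarrow>
        \<bar>indicator {0<..} y * (exp (- \<theta> * y) * f y r) - indicator {0<..} y * (exp (- \<theta> * y) * f y t)\<bar>
          \<le> (indicator {0<..} y *\<^sub>R G y) * \<bar>r - t\<bar>"
      using lip
    proof (eventually_elim, intro allI impI)
      fix y r :: real
      assume l: "y > 0 \<longrightarrow> (\<forall>s\<in>{0..2 * t}. \<forall>r\<in>{0..2 * t}. \<bar>f y r - f y s\<bar> \<le> G y * \<bar>r - s\<bar>)" and r: "\<bar>r - t\<bar> < t"
      show "\<bar>indicator {0<..} y * (exp (- \<theta> * y) * f y r) - indicator {0<..} y * (exp (- \<theta> * y) * f y t)\<bar>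
          \<le> (indicator {0<..} y *\<^sub>R G y) * \<bar>r - t\<bar>"
      proof (cases "y > 0")
        case True
        have "r \<in> {0..2 * t}" "t \<in> {0..2 * t}" using r by auto
        have "\<bar>exp (- \<theta> * y) * f y r - exp (- \<theta> * y) * f y t\<bar> = exp (- \<theta> * y) * \<bar>f y r - f y t\<bar>"
          unfolding right_diff_distrib[symmetric] abs_mult by simp
        also have "\<dots> \<le> \<bar>f y r - f y t\<bar>"
          using True \<open>\<theta> > 0\<close> by (intro mult_left_le_one_le) auto
        also have "\<dots> \<le> G y * \<bar>r - t\<bar>"
          using l True \<open>r \<in> _\<close> \<open>t \<in> _\<close> by blast
        finally show ?thesis using True by simp
      qed simp
    qed
    show "AE y in lborel. ((\<lambda>r. indicator {0<..} y * (exp (- \<theta> * y) * f y r)) has_real_derivative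
        indicator {0<..} y * (exp (- \<theta> * y) * (c * w y))) (at t)"
      using wd
    proof eventually_elim
      case (elim y)
      then show ?case
        by (cases "y > 0") (auto intro!: DERIV_cmult)
    qed
    show "(\<lambda>y. indicator {0<..} y * (exp (- \<theta> * y) * (c * w y))) \<in> borel_measurable lborel"
      using laplace_integrableD[OF laplace_integrable_cmult[OF wi] \<open>\<theta> > 0\<close>, of c] by (rule borel_measurable_integrable)
  qed
  then have "((\<lambda>t. laplace (\<lambda>y. f y t) \<theta>) has_real_derivative laplace (\<lambda>y. c * w y) \<theta>) (at t)"
    by (simp add: laplace_def set_lebesgue_integral_def)
  moreover have "laplace w \<theta> = bernstein_fun S \<theta> * (laplace (\<lambda>y. f y t) \<theta>)\<^sup>2"
    using caputo_primitive_laplace[OF S ui u0 wi w \<open>\<theta> > 0\<close>] laplace_conv(3)[OF fi fi \<open>\<theta> > 0\<close>]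
    by (simp add: u_def power2_eq_square)
  ultimately show ?thesis
    unfolding c_def[symmetric] by (simp only: laplace_cmult mult.assoc)
qed

lemma birth_equation_unique:
  assumes S: "wf_bernstein S" and "lam > 0" "\<xi> > 0"
    and p: "solves_birth_equation S lam \<xi> f0 p" and q: "solves_birth_equation S lam \<xi> f0 q" and "t \<ge> 0"
  shows "AE y in lborel. y > 0 \<longrightarrow> p y t = q y t"
proof (rule laplace_eq_imp_AE_eq)
  show "laplace_integrable (\<lambda>y. p y t)" "laplace_integrable (\<lambda>y. q y t)"
    using solution_laplace_integrable[OF p] solution_laplace_integrable[OF q] \<open>t \<ge> 0\<close> by auto
  fix \<theta> :: real assume "\<theta> > 0"
  have p0: "laplace (\<lambda>y. p y 0) \<theta> = laplace (\<lambda>y. q y 0) \<theta>"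
    using solves_birth_equationD(5)[OF p] solves_birth_equationD(5)[OF q] by (intro laplace_cong) simp
  show "laplace (\<lambda>y. p y t) \<theta> = laplace (\<lambda>y. q y t) \<theta>"
  proof (cases "t = 0")
    case False
    then have "t > 0" using \<open>t \<ge> 0\<close> by simp
    define \<phi> \<psi> where "\<phi> r = laplace (\<lambda>y. p y r) \<theta>" and "\<psi> r = laplace (\<lambda>y. q y r) \<theta>" for r
    \<comment> \<open>The factor left over from \<phi>^2 - \<psi>^2 = (\<phi> + \<psi>) (\<phi> -
      \<psi>). Continuity on the compact interval supplies the bound \<open>K\<close> for the
      Gronwall argument.\<close>
    define k where "k r = - lam * (exp (lam * r) / \<xi>) * bernstein_fun S \<theta> * (\<phi> r + \<psi> r)" for r
    have cont: "continuous_on {0..t} \<phi>" "continuous_on {0..t} \<psi>"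
      unfolding \<phi>_def \<psi>_def using solution_laplace_continuous[OF p \<open>\<theta> > 0\<close> \<open>t > 0\<close>]
        solution_laplace_continuous[OF q \<open>\<theta> > 0\<close> \<open>t > 0\<close>] by auto
    then have "continuous_on {0..t} k"
      unfolding k_def by (intro continuous_intros) (use \<open>\<xi> > 0\<close> in auto)
    then have "compact (k ` {0..t})" by (intro compact_continuous_image) auto
    then obtain K where K: "\<And>r. r \<in> {0..t} \<Longrightarrow> \<bar>k r\<bar> \<le> K"
      by (force dest!: compact_imp_bounded simp: bounded_iff)
    have "\<phi> t - \<psi> t = 0"
    proof (rule linear_ode_zero[where D="\<lambda>r. \<phi> r - \<psi> r" and k=k and K=K])
      show "continuous_on {0..t} (\<lambda>r. \<phi> r - \<psi> r)" by (intro continuous_intros cont)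
      show "\<phi> 0 - \<psi> 0 = 0" using p0 by (simp add: \<phi>_def \<psi>_def)
      show "0 \<le> t" by fact
      fix r :: real assume r: "0 < r" "r < t"
      define C where "C = - lam * (exp (lam * r) / \<xi>) * bernstein_fun S \<theta>"
      have "k r * (\<phi> r - \<psi> r) = C * (\<phi> r)\<^sup>2 - C * (\<psi> r)\<^sup>2"
        unfolding k_def C_def[symmetric] by (simp add: power2_eq_square algebra_simps)
      then show "((\<lambda>r. \<phi> r - \<psi> r) has_real_derivative k r * (\<phi> r - \<psi> r)) (at r)"
        using DERIV_diff[OF solution_laplace_riccati[OF S p r(1) \<open>\<theta> > 0\<close> assms(2,3)]
            solution_laplace_riccati[OF S q r(1) \<open>\<theta> > 0\<close> assms(2,3)]]
        unfolding \<phi>_def[symmetric] \<psi>_def[symmetric] C_def[symmetric] by (simp only:)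
      show "k r \<le> K" using K[of r] r by auto
    qed
    then show ?thesis by (simp add: \<phi>_def \<psi>_def)
  qed (simp add: p0)
qed

theorem theorem3p2:
  fixes lam \<xi> :: real and S :: bernstein
    and P :: "'b measure" and A :: "real \<Rightarrow> 'b \<Rightarrow> real" and h :: "real \<Rightarrow> real \<Rightarrow> real"
    and M :: "'a measure" and B :: "real \<Rightarrow> 'a \<Rightarrow> nat"
    and X :: "nat \<Rightarrow> 'a \<Rightarrow> real" and Y :: "real \<Rightarrow> 'a \<Rightarrow> real"
  assumes "lam > 0" and "\<xi> > 0"
    and "wf_bernstein S"
    and "subordinator P (bernstein_fun S) A"
    and "subordinator_density S P A h"
    and "linear_birth_process M lam B"
    and "prob_space.indep_vars M (\<lambda>_. borel) X {1..}"
    and "\<And>j. j \<ge> 1 \<Longrightarrow> distributed M lborel (X j) (\<lambda>x. ennreal (addend_density S \<xi> h x))"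
    and "prob_space.indep_set M
           (sets (vimage_algebra (space M) (\<lambda>\<omega>. \<lambda>j\<in>{1..}. X j \<omega>) (PiM {1..} (\<lambda>_. borel))))
           (sets (vimage_algebra (space M) (\<lambda>\<omega>. \<lambda>t\<in>{0::real..}. B t \<omega>)
             (PiM {0::real..} (\<lambda>_. count_space UNIV))))"
    and "\<And>t \<omega>. Y t \<omega> = (\<Sum>j = 1..B t \<omega>. X j \<omega>)"
  shows "\<exists>f.
           (\<forall>t\<ge>0. (\<forall>y. 0 \<le> f y t) \<and> distributed M lborel (Y t) (\<lambda>y. ennreal (f y t))) \<and>
           solves_birth_equation S lam \<xi> (addend_density S \<xi> h) f \<and>
           (\<forall>f'. solves_birth_equation S lam \<xi> (addend_density S \<xi> h) f' \<longrightarrow>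
              (\<forall>t\<ge>0. AE y in lborel. y > 0 \<longrightarrow> f' y t = f y t))"
proof -
  interpret subordinated S P A h
    by standard (fact assms)+
  let ?f = "\<lambda>y t. addend_density S (\<xi> * exp (- lam * t)) h y"
  have "Y t = (\<lambda>\<omega>. \<Sum>j = 1..B t \<omega>. X j \<omega>)" for t
    using assms(10) by auto
  then have "\<forall>t\<ge>0. (\<forall>y. 0 \<le> ?f y t) \<and> distributed M lborel (Y t) (\<lambda>y. ennreal (?f y t))"
    using random_sum_distributed[OF assms(1,2) _ assms(6-9)] addend_density_nonneg \<open>\<xi> > 0\<close> by simp
  moreover note sol = density_solves_birth_equation[OF assms(1,2)]
  moreover have "\<forall>f'. solves_birth_equation S lam \<xi> (addend_density S \<xi> h) f' \<longrightarrow>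
      (\<forall>t\<ge>0. AE y in lborel. y > 0 \<longrightarrow> f' y t = ?f y t)"
    by (intro allI impI) (rule birth_equation_unique[OF assms(3,1,2) _ sol])
  ultimately show ?thesis
    by (intro exI[of _ ?f] conjI)
qed

end
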